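(* The dual space $JT^*$ of the James tree space $JT$ is asymptotically uniformly convex.
   Context: All Banach spaces are real. For a Banach space $\mathfrak X$, $S(\mathfrak X)$ is its unit sphere. Let $\mathfrak N(\mathfrak X)$ be the collection of all norm-closed finite-codimensional subspaces of $\mathfrak X$, i.e. the subspaces $\{x\in\mathfrak X: x_i^*(x)=0,\ 1\le i\le n\}$ with $n\in\mathbb N$, $x_i^*\in\mathfrak X^*$. For an infinite-dimensional Banach space $\mathfrak X$, the modulus of asymptotic convexity $\overline{\delta}_{\mathfrak X}:[0,1]\to[0,1]$ is $$\overline{\delta}_{\mathfrak X}(\varepsilon)=\inf_{x\in S(\mathfrak X)}\ \sup_{\mathcal Y\in\mathfrak N(\mathfrak X)}\ \inf_{y\in S(\mathcal Y)}\big[\,\|x+\varepsilon y\|-1\,\big],$$ and $\mathfrak X$ is asymptotically uniformly convex if $\overline{\delta}_{\mathfrak X}(\varepsilon)>0$ for each $\varepsilon\in(0,1]$. The James tree space. Let $\Delta_0=\{\emptyset\}$, $\Delta_n=\{-1,+1\}^n$ for $n\in\mathbb N$, and $\mathcal T=\bigcup_{n=0}^\infty\Delta_n$ (the binary tree), ordered by: $t_1<t_2$ if either $t_1=\emptyset$ and $t_2\neq\emptyset$, or $t_1\in\Delta_n$, $t_2\in\Delta_m$ with $1\le n<m$ and $t_1$ consists of the first $n$ coordinates of $t_2$. A segment of $\mathcal T$ is a finite linearly ordered subset $\{t_n,t_{n+1},\dots,t_{n+k}\}$ with $t_i\in\Delta_i$ for $n\le i\le n+k$. $JT$ is the completion of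 the space of finitely supported functions $x:\mathcal T\to\mathbb R$ under the norm $$\|x\|_{JT}=\sup\Big\{\Big[\sum_{i=1}^n\Big|\sum_{t\in S_i}x_t\Big|^2\Big]^{1/2}: S_1,\dots,S_n\text{ disjoint segments of }\mathcal T\Big\}.$$ $JT^*$ is the Banach dual of $JT$ with the dual norm. *)

theory Defs
  imports "HOL-Analysis.Analysis" "HOL-Library.Sublist" "HOL-Library.Disjoint_Sets"
begin

section \<open>Asymptotic uniform convexity\<close>

definition finite_codim_subspaces :: "'a::real_normed_vector set set" where
  "finite_codim_subspaces =
     {Y. \<exists>F :: ('a \<Rightarrow>\<^sub>L real) set. finite F \<and> Y = {x. \<forall>f\<in>F. blinfun_apply f x = 0}}"

definition infinite_dimensional :: "'a::real_vector itself \<Rightarrow> bool" where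
  "infinite_dimensional _ \<longleftrightarrow> \<not> (\<exists>B :: 'a set. finite B \<and> span B = UNIV)"

text \<open>
  The infima and suprema are conditional ones in the reals.  In an infinite-dimensional space
  all index sets are nonempty, and the relevant families are bounded since
  \<open>\<bar>norm (x + \<epsilon> *\<^sub>R y) - 1\<bar> \<le> \<epsilon>\<close> for unit vectors and \<open>\<epsilon> \<ge> 0\<close>.
\<close>

definition asymp_convexity_modulus :: "'a::banach itself \<Rightarrow> real \<Rightarrow> real" where
  "asymp_convexity_modulus _ \<epsilon> =
     (INF x\<in>sphere (0::'a) 1. SUP Y\<in>finite_codim_subspaces. INF y\<in>Y \<inter> sphere 0 1.
        norm (x + \<epsilon> *\<^sub>R y) - 1)"

definition asymptotically_uniformly_convex :: "'a::banach itself \<Rightarrow> bool" where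
  "asymptotically_uniformly_convex T \<longleftrightarrow>
     infinite_dimensional T \<and> (\<forall>\<epsilon>. 0 < \<epsilon> \<and> \<epsilon> \<le> 1 \<longrightarrow> asymp_convexity_modulus T \<epsilon> > 0)"


section \<open>Completion of a normed space\<close>

definition cauchy_equiv :: "(nat \<Rightarrow> 'a::real_normed_vector) \<Rightarrow> (nat \<Rightarrow> 'a) \<Rightarrow> bool" where
  "cauchy_equiv X Y \<longleftrightarrow> Cauchy X \<and> Cauchy Y \<and> (\<lambda>n. X n - Y n) \<longlonglongrightarrow> 0"

lemma cauchy_equiv_refl: "Cauchy X \<Longrightarrow> cauchy_equiv X X"
  by (simp add: cauchy_equiv_def)

lemma part_equivp_cauchy_equiv: "part_equivp (cauchy_equiv :: (nat \<Rightarrow> 'a::real_normed_vector) \<Rightarrow> _)"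
proof (rule part_equivpI)
  show "\<exists>X. cauchy_equiv X (X :: nat \<Rightarrow> 'a)"
    by (rule exI[of _ "\<lambda>_. 0"], rule cauchy_equiv_refl) (simp add: convergent_Cauchy convergent_const)
  show "symp (cauchy_equiv :: (nat \<Rightarrow> 'a) \<Rightarrow> _)"
  proof (rule sympI)
    fix X Y :: "nat \<Rightarrow> 'a" assume "cauchy_equiv X Y"
    then show "cauchy_equiv Y X"
      using tendsto_minus[of "\<lambda>n. X n - Y n" 0 sequentially] by (simp add: cauchy_equiv_def)
  qed
  show "transp (cauchy_equiv :: (nat \<Rightarrow> 'a) \<Rightarrow> _)"
  proof (rule transpI)
    fix X Y Z :: "nat \<Rightarrow> 'a" assume "cauchy_equiv X Y" "cauchy_equiv Y Z"
    then show "cauchy_equiv X Z"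
      using tendsto_add[of "\<lambda>n. X n - Y n" 0 sequentially "\<lambda>n. Y n - Z n" 0]
      by (simp add: cauchy_equiv_def)
  qed
qed

quotient_type (overloaded) 'a completion = "nat \<Rightarrow> 'a::real_normed_vector" / partial: cauchy_equiv
  by (rule part_equivp_cauchy_equiv)

lemma Cauchy_norm_real: "Cauchy X \<Longrightarrow> convergent (\<lambda>n. norm (X n :: 'a::real_normed_vector))"
proof -
  assume X: "Cauchy X"
  have "Cauchy (\<lambda>n. norm (X n))"
  proof (rule CauchyI)
    fix e :: real assume "e > 0"
    then obtain M where "\<forall>m\<ge>M. \<forall>n\<ge>M. norm (X m - X n) < e"
      using X CauchyD by blast
    then have "\<forall>m\<ge>M. \<forall>n\<ge>M. norm (norm (X m) - norm (X n)) < e"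
      by (metis le_less_trans norm_triangle_ineq3 real_norm_def)
    then show "\<exists>M. \<forall>m\<ge>M. \<forall>n\<ge>M. norm (norm (X m) - norm (X n)) < e" by blast
  qed
  then show ?thesis by (simp add: Cauchy_convergent_iff)
qed

lemma Cauchy_add_seq:
  fixes X Y :: "nat \<Rightarrow> 'a::real_normed_vector"
  assumes "Cauchy X" "Cauchy Y"
  shows "Cauchy (\<lambda>n. X n + Y n)"
proof (rule CauchyI)
  fix e :: real assume "e > 0"
  then have "e / 2 > 0" by simp
  obtain M where M: "\<forall>m\<ge>M. \<forall>n\<ge>M. norm (X m - X n) < e / 2"
    using assms(1) \<open>e / 2 > 0\<close> CauchyD by blast
  obtain N where N: "\<forall>m\<ge>N. \<forall>n\<ge>N. norm (Y m - Y n) < e / 2"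
    using assms(2) \<open>e / 2 > 0\<close> CauchyD by blast
  have "norm (X m + Y m - (X n + Y n)) < e" if "m \<ge> max M N" "n \<ge> max M N" for m n
  proof -
    have "norm (X m + Y m - (X n + Y n)) \<le> norm (X m - X n) + norm (Y m - Y n)"
      using norm_diff_triangle_ineq by blast
    also have "\<dots> < e / 2 + e / 2"
      using M N that by (intro add_strict_mono) auto
    finally show ?thesis by simp
  qed
  then show "\<exists>M. \<forall>m\<ge>M. \<forall>n\<ge>M. norm (X m + Y m - (X n + Y n)) < e" by blast
qed

lemma Cauchy_scaleR_seq:
  fixes X :: "nat \<Rightarrow> 'a::real_normed_vector"
  shows "Cauchy X \<Longrightarrow> Cauchy (\<lambda>n. r *\<^sub>R X n)"
  using bounded_linear.Cauchy[OF bounded_linear_scaleR_right] .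

lemma Cauchy_uminus_seq:
  fixes X :: "nat \<Rightarrow> 'a::real_normed_vector"
  shows "Cauchy X \<Longrightarrow> Cauchy (\<lambda>n. - X n)"
  using Cauchy_scaleR_seq[of X "-1"] by simp

lemma Cauchy_diff_seq:
  fixes X Y :: "nat \<Rightarrow> 'a::real_normed_vector"
  shows "Cauchy X \<Longrightarrow> Cauchy Y \<Longrightarrow> Cauchy (\<lambda>n. X n - Y n)"
  using Cauchy_add_seq[OF _ Cauchy_uminus_seq, of X Y] by simp

instantiation completion :: (real_normed_vector) real_vector
begin

lift_definition zero_completion :: "'a completion" is "\<lambda>_. 0"
  by (simp add: cauchy_equiv_def convergent_Cauchy convergent_const)

lift_definition plus_completion :: "'a completion \<Rightarrow> 'a completion \<Rightarrow> 'a completion"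
  is "\<lambda>X Y n. X n + Y n"
  using tendsto_add_zero by (fastforce simp: cauchy_equiv_def Cauchy_add_seq add_diff_add)

lift_definition uminus_completion :: "'a completion \<Rightarrow> 'a completion" is "\<lambda>X n. - X n"
proof -
  fix X Y :: "nat \<Rightarrow> 'a" assume "cauchy_equiv X Y"
  then show "cauchy_equiv (\<lambda>n. - X n) (\<lambda>n. - Y n)"
    using tendsto_minus[of "\<lambda>n. X n - Y n" 0 sequentially]
    by (simp add: cauchy_equiv_def Cauchy_uminus_seq)
qed

lift_definition minus_completion :: "'a completion \<Rightarrow> 'a completion \<Rightarrow> 'a completion"
  is "\<lambda>X Y n. X n - Y n"
proof -
  fix X X' Y Y' :: "nat \<Rightarrow> 'a" assume "cauchy_equiv X X'" "cauchy_equiv Y Y'"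
  then show "cauchy_equiv (\<lambda>n. X n - Y n) (\<lambda>n. X' n - Y' n)"
    using tendsto_diff[of "\<lambda>n. X n - X' n" 0 sequentially "\<lambda>n. Y n - Y' n" 0]
    by (simp add: cauchy_equiv_def Cauchy_diff_seq algebra_simps)
qed

lift_definition scaleR_completion :: "real \<Rightarrow> 'a completion \<Rightarrow> 'a completion" is "\<lambda>r X n. r *\<^sub>R X n"
proof -
  fix r :: real and X Y :: "nat \<Rightarrow> 'a" assume "cauchy_equiv X Y"
  then show "cauchy_equiv (\<lambda>n. r *\<^sub>R X n) (\<lambda>n. r *\<^sub>R Y n)"
    using tendsto_scaleR[OF tendsto_const, of "\<lambda>n. X n - Y n" 0 sequentially r]
    by (simp add: cauchy_equiv_def Cauchy_scaleR_seq scaleR_diff_right)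
qed

instance
proof
  fix x y z :: "'a completion" and a b :: real
  show "x + y + z = x + (y + z)"
    by transfer (simp add: cauchy_equiv_def Cauchy_add_seq add.assoc)
  show "x + y = y + x"
    by transfer (simp add: cauchy_equiv_def Cauchy_add_seq add.commute)
  show "0 + x = x"
    by transfer (simp add: cauchy_equiv_def)
  show "- x + x = 0"
    by transfer (simp add: cauchy_equiv_def convergent_Cauchy convergent_const)
  show "x - y = x + - y"
    by transfer (simp add: cauchy_equiv_def Cauchy_diff_seq)
  show "a *\<^sub>R (x + y) = a *\<^sub>R x + a *\<^sub>R y"
    by transfer (simp add: cauchy_equiv_def scaleR_add_right Cauchy_add_seq Cauchy_scaleR_seq)
  show "(a + b) *\<^sub>R x = a *\<^sub>R x + b *\<^sub>R x"
    by transfer (simp add: cauchy_equiv_def scaleR_add_left Cauchy_add_seq Cauchy_scaleR_seq)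
  show "a *\<^sub>R b *\<^sub>R x = (a * b) *\<^sub>R x"
    by transfer (simp add: cauchy_equiv_def Cauchy_scaleR_seq)
  show "1 *\<^sub>R x = x"
    by transfer (simp add: cauchy_equiv_def)
qed

end

instantiation completion :: (real_normed_vector) real_normed_vector
begin

lift_definition norm_completion :: "'a completion \<Rightarrow> real" is "\<lambda>X. lim (\<lambda>n. norm (X n))"
proof -
  fix X Y :: "nat \<Rightarrow> 'a" assume XY: "cauchy_equiv X Y"
  then have "(\<lambda>n. norm (X n)) \<longlonglongrightarrow> lim (\<lambda>n. norm (X n))"
    by (simp add: cauchy_equiv_def Cauchy_norm_real convergent_LIMSEQ_iff[symmetric])
  moreover have "(\<lambda>n. norm (Y n) - norm (X n)) \<longlonglongrightarrow> 0"
  proof (rule Lim_null_comparison)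
    show "\<forall>\<^sub>F n in sequentially. norm (norm (Y n) - norm (X n)) \<le> norm (X n - Y n)"
    proof (intro always_eventually allI)
      fix n
      show "norm (norm (Y n) - norm (X n)) \<le> norm (X n - Y n)"
        using norm_triangle_ineq3[of "Y n" "X n"] by (simp add: norm_minus_commute)
    qed
    show "(\<lambda>n. norm (X n - Y n)) \<longlonglongrightarrow> 0"
      using XY by (simp add: cauchy_equiv_def tendsto_norm_zero)
  qed
  ultimately have "(\<lambda>n. norm (Y n)) \<longlonglongrightarrow> lim (\<lambda>n. norm (X n))"
    using tendsto_add by fastforce
  then show "lim (\<lambda>n. norm (X n)) = lim (\<lambda>n. norm (Y n))"
    by (simp add: limI)
qed

definition sgn_completion :: "'a completion \<Rightarrow> 'a completion" where
  "sgn_completion x = scaleR (inverse (norm x)) x"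

definition dist_completion :: "'a completion \<Rightarrow> 'a completion \<Rightarrow> real" where
  "dist_completion x y = norm (x - y)"

definition uniformity_completion :: "('a completion \<times> 'a completion) filter" where
  "uniformity_completion = (INF e\<in>{0<..}. principal {(x, y). dist x y < e})"

definition open_completion :: "'a completion set \<Rightarrow> bool" where
  "open_completion U \<longleftrightarrow> (\<forall>x\<in>U. eventually (\<lambda>(x', y). x' = x \<longrightarrow> y \<in> U) uniformity)"

instance
proof
  have L: "(\<lambda>n. norm (X n)) \<longlonglongrightarrow> lim (\<lambda>n. norm (X n))" if "cauchy_equiv X X" for X :: "nat \<Rightarrow> 'a"
    using that by (simp add: cauchy_equiv_def Cauchy_norm_real convergent_LIMSEQ_iff[symmetric])
  fix x y :: "'a completion" and a :: real
  show "dist x y = norm (x - y)" by (rule dist_completion_def)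
  show "sgn x = x /\<^sub>R norm x" by (rule sgn_completion_def)
  show "uniformity = (INF e\<in>{0<..}. principal {(x :: 'a completion, y). dist x y < e})"
    by (rule uniformity_completion_def)
  show "open U \<longleftrightarrow> (\<forall>x\<in>U. \<forall>\<^sub>F (x', y) in uniformity. x' = x \<longrightarrow> y \<in> U)" for U :: "'a completion set"
    by (rule open_completion_def)
  show "norm x = 0 \<longleftrightarrow> x = 0"
  proof (transfer, rule iffI)
    fix X :: "nat \<Rightarrow> 'a" assume X: "cauchy_equiv X X"
    { assume "lim (\<lambda>n. norm (X n)) = 0"
      then have "X \<longlonglongrightarrow> 0" using L[OF X] by (simp add: tendsto_norm_zero_iff)
      then show "cauchy_equiv X (\<lambda>_. 0)"
        using X by (simp add: cauchy_equiv_def convergent_Cauchy convergent_const) }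
    { assume "cauchy_equiv X (\<lambda>_. 0)"
      then have "(\<lambda>n. norm (X n)) \<longlonglongrightarrow> 0" by (simp add: cauchy_equiv_def tendsto_norm_zero)
      then show "lim (\<lambda>n. norm (X n)) = 0" by (rule limI) }
  qed
  show "norm (x + y) \<le> norm x + norm y"
  proof transfer
    fix X Y :: "nat \<Rightarrow> 'a" assume X: "cauchy_equiv X X" and Y: "cauchy_equiv Y Y"
    then have "cauchy_equiv (\<lambda>n. X n + Y n) (\<lambda>n. X n + Y n)"
      by (simp add: cauchy_equiv_def Cauchy_add_seq)
    from L[OF this] tendsto_add[OF L[OF X] L[OF Y]]
    show "lim (\<lambda>n. norm (X n + Y n)) \<le> lim (\<lambda>n. norm (X n)) + lim (\<lambda>n. norm (Y n))"
      by (rule LIMSEQ_le) (auto intro: norm_triangle_ineq)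
  qed
  show "norm (a *\<^sub>R x) = \<bar>a\<bar> * norm x"
  proof transfer
    fix a :: real and X :: "nat \<Rightarrow> 'a" assume X: "cauchy_equiv X X"
    have "(\<lambda>n. \<bar>a\<bar> * norm (X n)) \<longlonglongrightarrow> \<bar>a\<bar> * lim (\<lambda>n. norm (X n))"
      by (intro tendsto_mult tendsto_const L[OF X])
    then show "lim (\<lambda>n. norm (a *\<^sub>R X n)) = \<bar>a\<bar> * lim (\<lambda>n. norm (X n))"
      by (simp add: limI)
  qed
qed

end

lift_definition to_completion :: "'a::real_normed_vector \<Rightarrow> 'a completion" is "\<lambda>x _. x"
  by (simp add: cauchy_equiv_def convergent_Cauchy convergent_const)

lemma linear_to_completion: "linear (to_completion :: 'a::real_normed_vector \<Rightarrow> _)"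
proof (rule linearI)
  fix x y :: 'a and r :: real
  show "to_completion (x + y) = to_completion x + to_completion y"
    by transfer (simp add: cauchy_equiv_def convergent_Cauchy convergent_const)
  show "to_completion (r *\<^sub>R x) = r *\<^sub>R to_completion x"
    by transfer (simp add: cauchy_equiv_def convergent_Cauchy convergent_const)
qed

lemma norm_to_completion: "norm (to_completion x) = norm x"
  by transfer simp

lemma to_completion_approx:
  fixes x :: "'a::real_normed_vector completion"
  obtains A where "Cauchy A" "(\<lambda>n. to_completion (A n)) \<longlonglongrightarrow> x"
    "x = abs_completion A"
proof -
  obtain A where A: "cauchy_equiv A A" "x = abs_completion A"
    by (metis Quotient3_completion Quotient3_def)
  then have cA: "Cauchy A" by (simp add: cauchy_equiv_def)
  have eq: "norm (x - to_completion (A n)) = lim (\<lambda>m. norm (A m - A n))" for n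
  proof -
    have "x - to_completion (A n) = abs_completion (\<lambda>m. A m - A n)"
      unfolding A(2) to_completion.abs_eq
      using A(1) by (intro minus_completion.abs_eq)
        (simp_all add: eq_onp_def cauchy_equiv_refl convergent_Cauchy convergent_const)
    moreover have "cauchy_equiv (\<lambda>m. A m - A n) (\<lambda>m. A m - A n)"
      using cA by (intro cauchy_equiv_refl Cauchy_diff_seq) (simp_all add: convergent_Cauchy convergent_const)
    ultimately show ?thesis by (simp add: norm_completion.abs_eq)
  qed
  have "(\<lambda>n. to_completion (A n)) \<longlonglongrightarrow> x"
  proof (rule LIMSEQ_I)
    fix e :: real assume "e > 0"
    then have "e / 2 > 0" by simp
    then obtain M where M: "\<forall>m\<ge>M. \<forall>n\<ge>M. norm (A m - A n) < e / 2"
      using cA CauchyD by blast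
    have "norm (to_completion (A n) - x) < e" if "n \<ge> M" for n
    proof -
      have "Cauchy (\<lambda>m. A m - A n)"
        using cA by (intro Cauchy_diff_seq) (simp_all add: convergent_Cauchy convergent_const)
      then have "(\<lambda>m. norm (A m - A n)) \<longlonglongrightarrow> lim (\<lambda>m. norm (A m - A n))"
        by (simp add: Cauchy_norm_real convergent_LIMSEQ_iff[symmetric])
      then have "lim (\<lambda>m. norm (A m - A n)) \<le> e / 2"
        using M that by (intro LIMSEQ_le_const2[where X = "\<lambda>m. norm (A m - A n)"])
          (auto intro!: exI[of _ M] less_imp_le)
      then show ?thesis using \<open>e > 0\<close> eq[of n] by (simp add: norm_minus_commute)
    qed
    then show "\<exists>M. \<forall>n\<ge>M. norm (to_completion (A n) - x) < e" by blast
  qed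
  then show thesis using that cA A(2) by blast
qed

lemma dense_to_completion:
  "closure (range to_completion) = (UNIV :: 'a::real_normed_vector completion set)"
proof -
  have "x \<in> closure (range to_completion)" for x :: "'a completion"
  proof -
    obtain A where "(\<lambda>n. to_completion (A n)) \<longlonglongrightarrow> x" by (rule to_completion_approx)
    then show ?thesis unfolding closure_sequential by (intro exI[of _ "\<lambda>n. to_completion (A n)"]) simp
  qed
  then show ?thesis by blast
qed

lemma abs_completion_limit:
  assumes "Cauchy A"
  shows "(\<lambda>n. to_completion (A n)) \<longlonglongrightarrow> abs_completion A"
proof -
  obtain B where B: "Cauchy B" "(\<lambda>n. to_completion (B n)) \<longlonglongrightarrow> abs_completion A"
    "abs_completion A = abs_completion B" by (rule to_completion_approx)
  have "cauchy_equiv A B"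
    using B(1,3) assms Quotient3_rel[OF Quotient3_completion, of A B] by (simp add: cauchy_equiv_refl)
  then have "(\<lambda>n. A n - B n) \<longlonglongrightarrow> 0" by (simp add: cauchy_equiv_def)
  then have "(\<lambda>n. norm (to_completion (A n - B n))) \<longlonglongrightarrow> 0"
    by (simp add: norm_to_completion tendsto_norm_zero)
  then have "(\<lambda>n. to_completion (A n) - to_completion (B n)) \<longlonglongrightarrow> 0"
    by (simp add: tendsto_norm_zero_iff linear_diff[OF linear_to_completion])
  from tendsto_add[OF this B(2)] show ?thesis by simp
qed

instance completion :: (real_normed_vector) banach
proof
  fix X :: "nat \<Rightarrow> 'a completion" assume X: "Cauchy X"
  have "\<exists>a. norm (X n - to_completion a) < inverse (real (Suc n))" for n
  proof -
    obtain A where "(\<lambda>k. to_completion (A k)) \<longlonglongrightarrow> X n" by (rule to_completion_approx)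
    then obtain k where "norm (to_completion (A k) - X n) < inverse (real (Suc n))"
      using LIMSEQ_D[of "\<lambda>k. to_completion (A k)" "X n" "inverse (real (Suc n))"] by auto
    then have "norm (X n - to_completion (A k)) < inverse (real (Suc n))"
      by (simp only: norm_minus_commute)
    then show ?thesis ..
  qed
  then obtain a where a: "\<And>n. norm (X n - to_completion (a n)) < inverse (real (Suc n))"
    using choice[of "\<lambda>n a. norm (X n - to_completion a) < inverse (real (Suc n))"] by blast
  have d: "(\<lambda>n. X n - to_completion (a n)) \<longlonglongrightarrow> 0"
    by (rule Lim_null_comparison[OF _ LIMSEQ_inverse_real_of_nat])
      (use a in \<open>auto intro!: always_eventually less_imp_le\<close>)
  then have "Cauchy (\<lambda>n. X n - (X n - to_completion (a n)))"
    by (intro Cauchy_diff_seq X LIMSEQ_imp_Cauchy[OF d])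
  then have "Cauchy (\<lambda>n. to_completion (a n))" by simp
  then have "Cauchy a"
    unfolding Cauchy_iff
    by (simp only: linear_diff[OF linear_to_completion, symmetric] norm_to_completion)
  from tendsto_add[OF abs_completion_limit[OF this] d]
  show "convergent X" by (auto simp: convergent_def)
qed


section \<open>The James tree space\<close>

text \<open>
  A node at level \<open>n\<close> is a list of length \<open>n\<close>, with \<open>False\<close> and \<open>True\<close> standing for \<open>-1\<close> and \<open>+1\<close>;
  the tree order is the prefix order.
\<close>

type_synonym node = "bool list"

definition is_segment :: "node set \<Rightarrow> bool" where
  "is_segment S \<longleftrightarrow>
     (\<exists>n k t. S = t ` {n..n + k} \<and> (\<forall>i\<in>{n..n + k}. length (t i) = i)) \<and>
     (\<forall>s\<in>S. \<forall>t\<in>S. s = t \<or> strict_prefix s t \<or> strict_prefix t s)"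

definition jt_norm :: "(node \<Rightarrow> real) \<Rightarrow> real" where
  "jt_norm x = (SUP F\<in>{F. finite F \<and> (\<forall>S\<in>F. is_segment S) \<and> disjoint F}.
     sqrt (\<Sum>S\<in>F. \<bar>\<Sum>t\<in>S. x t\<bar>\<^sup>2))"

lemma is_segment_finite: "is_segment S \<Longrightarrow> finite S"
  by (auto simp: is_segment_def)

lemma is_segment_singleton: "is_segment {t}"
  unfolding is_segment_def
  by (intro conjI exI[of _ "length t"] exI[of _ 0] exI[of _ "\<lambda>_. t"]) auto

lemma jt_norm_bound:
  assumes fin: "finite {t. x t \<noteq> 0}" and F: "finite F" "\<forall>S\<in>F. is_segment S" "disjoint F"
  shows "sqrt (\<Sum>S\<in>F. \<bar>\<Sum>t\<in>S. x t\<bar>\<^sup>2) \<le> (\<Sum>t\<in>{t. x t \<noteq> 0}. \<bar>x t\<bar>)"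
proof -
  let ?A = "{t. x t \<noteq> 0}"
  have "sqrt (\<Sum>S\<in>F. \<bar>\<Sum>t\<in>S. x t\<bar>\<^sup>2) = L2_set (\<lambda>S. \<bar>\<Sum>t\<in>S. x t\<bar>) F"
    by (simp add: L2_set_def)
  also have "\<dots> \<le> (\<Sum>S\<in>F. \<bar>\<Sum>t\<in>S. x t\<bar>)"
    by (rule L2_set_le_sum) simp
  also have "\<dots> \<le> (\<Sum>S\<in>F. \<Sum>t\<in>S. \<bar>x t\<bar>)"
    by (intro sum_mono sum_abs)
  also have "\<dots> = (\<Sum>t\<in>\<Union>F. \<bar>x t\<bar>)"
    using F is_segment_finite
    by (subst sum.Union_disjoint) (auto simp: disjoint_def)
  also have "\<dots> = (\<Sum>t\<in>\<Union>F \<inter> ?A. \<bar>x t\<bar>)"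
    using F is_segment_finite by (intro sum.mono_neutral_right) auto
  also have "\<dots> \<le> (\<Sum>t\<in>?A. \<bar>x t\<bar>)"
    using fin by (intro sum_mono2) auto
  finally show ?thesis .
qed

lemma jt_norm_bdd_above:
  assumes "finite {t. x t \<noteq> 0}"
  shows "bdd_above ((\<lambda>F. sqrt (\<Sum>S\<in>F. \<bar>\<Sum>t\<in>S. x t\<bar>\<^sup>2)) `
           {F. finite F \<and> (\<forall>S\<in>F. is_segment S) \<and> disjoint F})"
  using jt_norm_bound[OF assms] by (intro bdd_aboveI2) blast

lemma jt_norm_upper:
  assumes "finite {t. x t \<noteq> 0}" "finite F" "\<forall>S\<in>F. is_segment S" "disjoint F"
  shows "sqrt (\<Sum>S\<in>F. \<bar>\<Sum>t\<in>S. x t\<bar>\<^sup>2) \<le> jt_norm x"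
  unfolding jt_norm_def
  by (rule cSUP_upper[OF _ jt_norm_bdd_above]) (use assms in auto)

lemma jt_norm_least:
  assumes "\<And>F. finite F \<Longrightarrow> \<forall>S\<in>F. is_segment S \<Longrightarrow> disjoint F \<Longrightarrow>
             sqrt (\<Sum>S\<in>F. \<bar>\<Sum>t\<in>S. x t\<bar>\<^sup>2) \<le> b"
  shows "jt_norm x \<le> b"
  unfolding jt_norm_def
proof (rule cSUP_least)
  show "{F. finite F \<and> (\<forall>S\<in>F. is_segment S) \<and> disjoint F} \<noteq> {}"
    by (auto intro!: exI[of _ "{}"])
qed (use assms in auto)

lemma abs_le_jt_norm:
  assumes "finite {t. x t \<noteq> 0}"
  shows "\<bar>x t\<bar> \<le> jt_norm x"
  using jt_norm_upper[OF assms, of "{{t}}"] by (simp add: is_segment_singleton)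

typedef jt_fin = "{x :: node \<Rightarrow> real. finite {t. x t \<noteq> 0}}"
  by (rule exI[of _ "\<lambda>_. 0"]) simp

setup_lifting type_definition_jt_fin

instantiation jt_fin :: real_vector
begin

lift_definition zero_jt_fin :: jt_fin is "\<lambda>_. 0" by simp

lift_definition plus_jt_fin :: "jt_fin \<Rightarrow> jt_fin \<Rightarrow> jt_fin" is "\<lambda>x y t. x t + y t"
proof -
  fix x y :: "node \<Rightarrow> real" assume "finite {t. x t \<noteq> 0}" "finite {t. y t \<noteq> 0}"
  then have "finite ({t. x t \<noteq> 0} \<union> {t. y t \<noteq> 0})" by simp
  then show "finite {t. x t + y t \<noteq> 0}" by (rule rev_finite_subset) auto
qed

lift_definition minus_jt_fin :: "jt_fin \<Rightarrow> jt_fin \<Rightarrow> jt_fin" is "\<lambda>x y t. x t - y t"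
proof -
  fix x y :: "node \<Rightarrow> real" assume "finite {t. x t \<noteq> 0}" "finite {t. y t \<noteq> 0}"
  then have "finite ({t. x t \<noteq> 0} \<union> {t. y t \<noteq> 0})" by simp
  then show "finite {t. x t - y t \<noteq> 0}" by (rule rev_finite_subset) auto
qed

lift_definition uminus_jt_fin :: "jt_fin \<Rightarrow> jt_fin" is "\<lambda>x t. - x t" by simp

lift_definition scaleR_jt_fin :: "real \<Rightarrow> jt_fin \<Rightarrow> jt_fin" is "\<lambda>r x t. r * x t"
  by (erule rev_finite_subset) auto

instance
proof
  fix x y z :: jt_fin and a b :: real
  show "x + y + z = x + (y + z)" by transfer (simp add: add.assoc)
  show "x + y = y + x" by transfer (simp add: add.commute)
  show "0 + x = x" by transfer simp
  show "- x + x = 0" by transfer simp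
  show "x - y = x + - y" by transfer simp
  show "a *\<^sub>R (x + y) = a *\<^sub>R x + a *\<^sub>R y" by transfer (simp add: distrib_left)
  show "(a + b) *\<^sub>R x = a *\<^sub>R x + b *\<^sub>R x" by transfer (simp add: distrib_right)
  show "a *\<^sub>R b *\<^sub>R x = (a * b) *\<^sub>R x" by transfer (simp add: mult.assoc)
  show "1 *\<^sub>R x = x" by transfer simp
qed

end

instantiation jt_fin :: real_normed_vector
begin

lift_definition norm_jt_fin :: "jt_fin \<Rightarrow> real" is jt_norm .

definition sgn_jt_fin :: "jt_fin \<Rightarrow> jt_fin" where
  "sgn_jt_fin x = scaleR (inverse (norm x)) x"

definition dist_jt_fin :: "jt_fin \<Rightarrow> jt_fin \<Rightarrow> real" where
  "dist_jt_fin x y = norm (x - y)"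

definition uniformity_jt_fin :: "(jt_fin \<times> jt_fin) filter" where
  "uniformity_jt_fin = (INF e\<in>{0<..}. principal {(x, y). dist x y < e})"

definition open_jt_fin :: "jt_fin set \<Rightarrow> bool" where
  "open_jt_fin U \<longleftrightarrow> (\<forall>x\<in>U. eventually (\<lambda>(x', y). x' = x \<longrightarrow> y \<in> U) uniformity)"

instance
proof
  fix x y :: jt_fin and a :: real
  show "dist x y = norm (x - y)" by (rule dist_jt_fin_def)
  show "sgn x = x /\<^sub>R norm x" by (rule sgn_jt_fin_def)
  show "uniformity = (INF e\<in>{0<..}. principal {(x :: jt_fin, y). dist x y < e})"
    by (rule uniformity_jt_fin_def)
  show "open U \<longleftrightarrow> (\<forall>x\<in>U. \<forall>\<^sub>F (x', y) in uniformity. x' = x \<longrightarrow> y \<in> U)" for U :: "jt_fin set"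
    by (rule open_jt_fin_def)
  show "norm x = 0 \<longleftrightarrow> x = 0"
  proof (transfer, rule iffI)
    fix x :: "node \<Rightarrow> real" assume fin: "finite {t. x t \<noteq> 0}"
    show "x = (\<lambda>_. 0)" if "jt_norm x = 0"
      using abs_le_jt_norm[OF fin] that by (auto simp: fun_eq_iff)
    have "jt_norm (\<lambda>_. 0) \<le> 0" by (rule jt_norm_least) simp
    moreover have "0 \<le> jt_norm (\<lambda>_. 0)" using abs_le_jt_norm[of "\<lambda>_. 0"] by simp
    ultimately show "jt_norm x = 0" if "x = (\<lambda>_. 0)"
      using that by simp
  qed
  show "norm (x + y) \<le> norm x + norm y"
  proof transfer
    fix x y :: "node \<Rightarrow> real"
    assume fx: "finite {t. x t \<noteq> 0}" and fy: "finite {t. y t \<noteq> 0}"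
    show "jt_norm (\<lambda>t. x t + y t) \<le> jt_norm x + jt_norm y"
    proof (rule jt_norm_least)
      fix F :: "node set set"
      assume F: "finite F" "\<forall>S\<in>F. is_segment S" "disjoint F"
      have "sqrt (\<Sum>S\<in>F. \<bar>\<Sum>t\<in>S. x t + y t\<bar>\<^sup>2) = L2_set (\<lambda>S. (\<Sum>t\<in>S. x t) + (\<Sum>t\<in>S. y t)) F"
        by (simp add: L2_set_def sum.distrib)
      also have "\<dots> \<le> L2_set (\<lambda>S. \<Sum>t\<in>S. x t) F + L2_set (\<lambda>S. \<Sum>t\<in>S. y t) F"
        by (rule L2_set_triangle_ineq)
      also have "\<dots> \<le> jt_norm x + jt_norm y"
        using jt_norm_upper[OF fx F] jt_norm_upper[OF fy F] by (simp add: L2_set_def)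
      finally show "sqrt (\<Sum>S\<in>F. \<bar>\<Sum>t\<in>S. x t + y t\<bar>\<^sup>2) \<le> jt_norm x + jt_norm y" .
    qed
  qed
  show "norm (a *\<^sub>R x) = \<bar>a\<bar> * norm x"
  proof transfer
    fix a :: real and x :: "node \<Rightarrow> real" assume fin: "finite {t. x t \<noteq> 0}"
    have le: "jt_norm (\<lambda>t. c * u t) \<le> \<bar>c\<bar> * jt_norm u" if "finite {t. u t \<noteq> 0}" for c u
    proof (rule jt_norm_least)
      fix F :: "node set set"
      assume F: "finite F" "\<forall>S\<in>F. is_segment S" "disjoint F"
      have "sqrt (\<Sum>S\<in>F. \<bar>\<Sum>t\<in>S. c * u t\<bar>\<^sup>2) = \<bar>c\<bar> * sqrt (\<Sum>S\<in>F. \<bar>\<Sum>t\<in>S. u t\<bar>\<^sup>2)"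
        by (simp add: sum_distrib_left[symmetric] power_mult_distrib real_sqrt_mult)
      also have "\<dots> \<le> \<bar>c\<bar> * jt_norm u"
        by (intro mult_left_mono jt_norm_upper[OF that F]) simp
      finally show "sqrt (\<Sum>S\<in>F. \<bar>\<Sum>t\<in>S. c * u t\<bar>\<^sup>2) \<le> \<bar>c\<bar> * jt_norm u" .
    qed
    show "jt_norm (\<lambda>t. a * x t) = \<bar>a\<bar> * jt_norm x"
    proof (cases "a = 0")
      case True
      have "jt_norm (\<lambda>_. 0) \<le> 0" by (rule jt_norm_least) simp
      moreover have "0 \<le> jt_norm (\<lambda>_. 0)" using abs_le_jt_norm[of "\<lambda>_. 0"] by simp
      ultimately show ?thesis using True by simp
    next
      case False
      have "finite {t. a * x t \<noteq> 0}" using fin by (rule rev_finite_subset) auto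
      from le[OF this, of "inverse a"] False have "\<bar>a\<bar> * jt_norm x \<le> jt_norm (\<lambda>t. a * x t)"
        by (simp add: mult.assoc[symmetric] field_simps)
      with le[OF fin, of a] show ?thesis by simp
    qed
  qed
qed

end

type_synonym jt = "jt_fin completion"

type_synonym jt_dual = "jt \<Rightarrow>\<^sub>L real"

end

theory Submission
  imports Defs
begin

text \<open>
  Let \<open>f\<close> be a functional of norm \<open>1\<close>.  A lower bound for \<open>norm (f + \<epsilon> *\<^sub>R g)\<close>, where \<open>norm g = 1\<close> and
  \<open>g\<close> ranges over a suitable subspace of finite codimension, is obtained by evaluation at
  \<open>x + \<tau> *\<^sub>R Z\<close>, where \<open>x\<close> nearly norms \<open>f\<close> and \<open>Z\<close> nearly norms \<open>g\<close>.  If \<open>g x = 0\<close>, \<open>f Z\<close> is negligible and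
  \<open>norm (x + \<tau> *\<^sub>R Z) \<le> 1 + C * \<tau>\<^sup>2\<close>, then the choice of \<open>\<tau>\<close> proportional to \<open>\<epsilon>\<close> gives
  \<open>norm (f + \<epsilon> *\<^sub>R g) \<ge> 1 + c * \<epsilon>\<^sup>2\<close> with an absolute constant \<open>c > 0\<close>.  The vector \<open>x\<close> is finitely
  supported, and \<open>g\<close> is required to vanish at the nodes up to some level \<open>m\<close> beyond the support
  of \<open>x\<close>.  Then \<open>g x = 0\<close>, and \<open>Z\<close> may be chosen with support beyond \<open>m\<close>, except that coordinates on
  level \<open>m\<close> itself can be added to \<open>Z\<close> at will.  Two difficulties remain.

  The norm of \<open>x + \<tau> *\<^sub>R Z\<close>.  A segment may run through the supports of both vectors, which in general
  costs a term linear in \<open>\<tau>\<close>.  It turns out that the nearly optimal segments for \<open>x\<close> ending at a node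
  \<open>u\<close> of level \<open>m\<close> have sums of one sign only: two such segments with sums of substantially different
  signs could be improved by cutting the longer one.  If the sums of \<open>Z\<close> over segments
  starting at \<open>u\<close> have the opposite sign, then the linear term is harmless (\<open>gluing\<close>).  This is
  arranged by coordinates on level \<open>m\<close>, of \<open>\<ell>\<^sub>2\<close>-norm at most \<open>1\<close> (\<open>segsum_bounds\<close>), which \<open>g\<close> does not
  notice.

  The value \<open>f Z\<close>.  It is small when \<open>f\<close> is a limit of finitely supported functionals, but for a
  branch functional \<open>x \<mapsto> \<Sum> x\<^sub>t\<close>, the sum being over the nodes \<open>t\<close> of a branch, it need not be.  These are
  the only exceptions: far out in the tree every functional is, up to a small error, a combination
  of finitely many branch functionals (\<open>every_functional_branch_like\<close>).  So \<open>g\<close> is also required to have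
  limit \<open>0\<close> along these finitely many branches.  A coordinate far out on each of them then
  annihilates the branch functionals at \<open>Z\<close>, while \<open>g Z\<close> hardly changes and the signs of the segment
  sums are preserved (\<open>cancel_branches\<close>).

  The structure of functionals comes from gluing as well.  If vectors on which a functional is at
  least \<open>r > 0\<close> can be glued successively, then \<open>k\<close> of them have a sum of norm at most \<open>sqrt (C * k)\<close>
  with value at least \<open>k * r\<close>, which is impossible for large \<open>k\<close> (\<open>gluing_unbounded\<close>).  In this way
  one obtains the limits along branches, and the fact that a functional all of whose limits are \<open>0\<close>
  has vanishing tails; the limits themselves are square summable, and subtracting the
  corresponding combination of branch functionals reduces the general case to this one.
\<close>


section \<open>Segments and the norm\<close>

text \<open>The part of the path from the root to \<open>v\<close> at levels \<open>\<ge> i\<close>.  Describing a segment by its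
  starting level and its last node turns sums over segments into sums over intervals of levels.\<close>

definition seg :: "nat \<Rightarrow> node \<Rightarrow> node set" where
  "seg i v = (\<lambda>k. take k v) ` {i..length v}"

lemma inj_on_take_level: "inj_on (\<lambda>k. take k v) {i..length v}"
proof (rule inj_onI)
  fix a b assume "a \<in> {i..length v}" "b \<in> {i..length v}" "take a v = take b v"
  then show "a = b" by (metis atLeastAtMost_iff length_take min_absorb2)
qed

lemma sum_seg: "(\<Sum>t\<in>seg i v. h t) = (\<Sum>k=i..length v. h (take k v))"
  unfolding seg_def by (rule sum.reindex[OF inj_on_take_level, unfolded o_def])

lemma finite_seg [simp]: "finite (seg i v)"
  by (simp add: seg_def)

lemma mem_seg_iff: "t \<in> seg i v \<longleftrightarrow> i \<le> length t \<and> prefix t v"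
proof
  assume "t \<in> seg i v"
  then show "i \<le> length t \<and> prefix t v" by (auto simp: seg_def take_is_prefix)
next
  assume "i \<le> length t \<and> prefix t v"
  then show "t \<in> seg i v"
    unfolding seg_def by (intro image_eqI[of _ _ "length t"]) (auto simp: prefix_def)
qed

lemma is_segment_iff_seg: "is_segment S \<longleftrightarrow> (\<exists>i v. i \<le> length v \<and> S = seg i v)"
proof
  assume "is_segment S"
  then obtain n k t where S: "S = t ` {n..n + k}" and len: "\<forall>i\<in>{n..n + k}. length (t i) = i"
    and cmp: "\<forall>a\<in>S. \<forall>b\<in>S. a = b \<or> strict_prefix a b \<or> strict_prefix b a"
    unfolding is_segment_def by (elim conjE exE)
  define v where "v = t (n + k)"
  have lv: "length v = n + k" using len by (simp add: v_def)
  have "t i = take i v" if "i \<in> {n..n + k}" for i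
  proof -
    have "prefix (t i) v"
    proof -
      have "t i = v \<or> strict_prefix (t i) v \<or> strict_prefix v (t i)"
        using cmp S that by (simp add: v_def)
      moreover have "\<not> strict_prefix v (t i)"
        using prefix_length_less[of v "t i"] len lv that by auto
      ultimately show ?thesis by (auto simp: strict_prefix_def)
    qed
    then show ?thesis using len that by (auto simp: prefix_def)
  qed
  then have "S = seg n v" unfolding S seg_def lv by (rule image_cong[OF refl])
  then show "\<exists>i v. i \<le> length v \<and> S = seg i v" using lv by (intro exI[of _ n] exI[of _ v]) simp
next
  assume "\<exists>i v. i \<le> length v \<and> S = seg i v"
  then obtain i v where iv: "i \<le> length v" "S = seg i v" by blast
  have "S = (\<lambda>k. take k v) ` {i..i + (length v - i)}" using iv by (simp add: seg_def)
  moreover have "\<forall>s\<in>S. \<forall>t\<in>S. s = t \<or> strict_prefix s t \<or> strict_prefix t s"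
  proof (intro ballI)
    fix s t assume "s \<in> S" "t \<in> S"
    then have "prefix s v" "prefix t v" by (auto simp: iv(2) mem_seg_iff)
    from prefix_same_cases[OF this] show "s = t \<or> strict_prefix s t \<or> strict_prefix t s"
      by (auto simp: strict_prefix_def)
  qed
  moreover have "\<forall>k\<in>{i..i + (length v - i)}. length (take k v) = k"
    using iv(1) by simp
  ultimately show "is_segment S" unfolding is_segment_def by blast
qed

lemma is_segment_seg: "i \<le> length v \<Longrightarrow> is_segment (seg i v)"
  by (auto simp: is_segment_iff_seg)

lemma seg_nonempty: "i \<le> length v \<Longrightarrow> seg i v \<noteq> {}"
  by (simp add: seg_def)

lemma is_segment_nonempty: "is_segment S \<Longrightarrow> S \<noteq> {}"
  by (auto simp: is_segment_iff_seg seg_nonempty)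

definition level :: "nat \<Rightarrow> node set" where
  "level m = {t. length t = m}"

lemma finite_level [simp]: "finite (level m)"
  using finite_lists_length_eq[of "UNIV :: bool set" m] by (simp add: level_def)

definition segment_family :: "node set set \<Rightarrow> bool" where
  "segment_family F \<longleftrightarrow> finite F \<and> (\<forall>S\<in>F. is_segment S) \<and> disjoint F"

definition segsum :: "jt_fin \<Rightarrow> node set \<Rightarrow> real" where
  "segsum x S = (\<Sum>t\<in>S. Rep_jt_fin x t)"

lemma segsum_add: "segsum (x + y) S = segsum x S + segsum y S"
  by (simp add: segsum_def plus_jt_fin.rep_eq sum.distrib)

lemma segsum_diff: "segsum (x - y) S = segsum x S - segsum y S"
  by (simp add: segsum_def minus_jt_fin.rep_eq sum_subtractf)

lemma segsum_scaleR: "segsum (r *\<^sub>R x) S = r * segsum x S"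
  by (simp add: segsum_def scaleR_jt_fin.rep_eq sum_distrib_left)

lemma finite_support: "finite {t. Rep_jt_fin x t \<noteq> 0}"
  using Rep_jt_fin[of x] by simp

lemma segment_family_le_norm:
  assumes "segment_family F"
  shows "(\<Sum>S\<in>F. (segsum x S)\<^sup>2) \<le> (norm x)\<^sup>2"
proof -
  have "sqrt (\<Sum>S\<in>F. (segsum x S)\<^sup>2) \<le> norm x"
    using jt_norm_upper[OF finite_support, of F x] assms
    by (simp add: segment_family_def segsum_def norm_jt_fin.rep_eq)
  then show ?thesis using sqrt_le_D by blast
qed

lemma norm_le_by_families:
  assumes "\<And>F. segment_family F \<Longrightarrow> (\<Sum>S\<in>F. (segsum x S)\<^sup>2) \<le> b"
  shows "(norm x)\<^sup>2 \<le> b"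
proof -
  have b: "0 \<le> b" using assms[of "{}"] by (simp add: segment_family_def)
  have "norm x \<le> sqrt b"
    unfolding norm_jt_fin.rep_eq
    by (rule jt_norm_least, rule real_sqrt_le_mono)
      (use assms in \<open>simp add: segment_family_def segsum_def\<close>)
  then have "(norm x)\<^sup>2 \<le> (sqrt b)\<^sup>2" by (intro power_mono) auto
  then show ?thesis using b by simp
qed

text \<open>Cutting the segments of a family into disjoint pieces, or dropping pieces, yields a family that
  still competes in the supremum defining the norm.\<close>

lemma refined_family_le_norm:
  assumes F: "segment_family F"
    and H: "\<And>S. S \<in> F \<Longrightarrow> segment_family (H S) \<and> \<Union>(H S) \<subseteq> S"
  shows "(\<Sum>S\<in>F. \<Sum>T\<in>H S. (segsum x T)\<^sup>2) \<le> (norm x)\<^sup>2"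
proof -
  have apart: "T \<inter> T' = {}" if "S \<in> F" "S' \<in> F" "S \<noteq> S'" "T \<in> H S" "T' \<in> H S'" for S S' T T'
  proof -
    have "S \<inter> S' = {}" using F that(1-3) by (auto simp: segment_family_def dest: disjointD)
    moreover have "T \<subseteq> S" "T' \<subseteq> S'" using H that by blast+
    ultimately show ?thesis by blast
  qed
  have ne: "T \<noteq> {}" if "S \<in> F" "T \<in> H S" for S T
    using H[OF that(1)] that(2) is_segment_nonempty by (auto simp: segment_family_def)
  have "(\<Sum>S\<in>F. \<Sum>T\<in>H S. (segsum x T)\<^sup>2) = (\<Sum>T\<in>(\<Union>S\<in>F. H S). (segsum x T)\<^sup>2)"
  proof (rule sum.UNION_disjoint[symmetric])
    show "finite F" using F by (simp add: segment_family_def)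
    show "\<forall>S\<in>F. finite (H S)" using H by (simp add: segment_family_def)
    show "\<forall>S\<in>F. \<forall>S'\<in>F. S \<noteq> S' \<longrightarrow> H S \<inter> H S' = {}"
    proof (intro ballI impI)
      fix S S' assume S: "S \<in> F" "S' \<in> F" "S \<noteq> S'"
      have False if "T \<in> H S" "T \<in> H S'" for T
        using apart[OF S that] ne[OF S(1) that(1)] by simp
      then show "H S \<inter> H S' = {}" by blast
    qed
  qed
  also have "\<dots> \<le> (norm x)\<^sup>2"
  proof (rule segment_family_le_norm)
    have "disjoint (\<Union>S\<in>F. H S)"
    proof (rule disjointI)
      fix T T' assume "T \<in> (\<Union>S\<in>F. H S)" "T' \<in> (\<Union>S\<in>F. H S)" and ne': "T \<noteq> T'"
      then obtain S S' where S: "S \<in> F" "S' \<in> F" "T \<in> H S" "T' \<in> H S'" by blast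
      show "T \<inter> T' = {}"
      proof (cases "S = S'")
        case True
        then show ?thesis
          using H[OF S(1)] S(3,4) ne' by (auto simp: segment_family_def dest: disjointD)
      next
        case False
        then show ?thesis using apart S by simp
      qed
    qed
    then show "segment_family (\<Union>S\<in>F. H S)"
      using F H by (auto simp: segment_family_def)
  qed
  finally show ?thesis .
qed

text \<open>Upper bounds for the norm can be proved one segment at a time, because the pieces of disjoint
  segments form a disjoint family again.  The weights \<open>d\<close> pay for an error located at single nodes;
  each node lies in at most one segment of a family, so it is charged only once.\<close>

lemma norm_domination:
  fixes x y z :: jt_fin and d :: "node \<Rightarrow> real"
  assumes U: "finite U" "\<And>u. u \<in> U \<Longrightarrow> 0 \<le> d u"
    and dom: "\<And>S. is_segment S \<Longrightarrow> \<exists>H K. segment_family H \<and> segment_family K \<and> \<Union>H \<subseteq> S \<and> \<Union>K \<subseteq> S \<and>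
      (segsum y S)\<^sup>2 \<le> (\<Sum>T\<in>H. (segsum x T)\<^sup>2) + (\<Sum>T\<in>K. (segsum z T)\<^sup>2) + (\<Sum>u\<in>S \<inter> U. d u)"
  shows "(norm y)\<^sup>2 \<le> (norm x)\<^sup>2 + (norm z)\<^sup>2 + (\<Sum>u\<in>U. d u)"
proof (rule norm_le_by_families)
  fix F assume F: "segment_family F"
  obtain H K where HK: "\<And>S. is_segment S \<Longrightarrow> segment_family (H S) \<and> segment_family (K S) \<and>
      \<Union>(H S) \<subseteq> S \<and> \<Union>(K S) \<subseteq> S \<and>
      (segsum y S)\<^sup>2 \<le> (\<Sum>T\<in>H S. (segsum x T)\<^sup>2) + (\<Sum>T\<in>K S. (segsum z T)\<^sup>2) + (\<Sum>u\<in>S \<inter> U. d u)"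
    using dom by metis
  have seg: "is_segment S" if "S \<in> F" for S using F that by (simp add: segment_family_def)
  have "(\<Sum>S\<in>F. (segsum y S)\<^sup>2) \<le>
      (\<Sum>S\<in>F. (\<Sum>T\<in>H S. (segsum x T)\<^sup>2) + (\<Sum>T\<in>K S. (segsum z T)\<^sup>2) + (\<Sum>u\<in>S \<inter> U. d u))"
    using HK seg by (intro sum_mono) blast
  also have "\<dots> = (\<Sum>S\<in>F. \<Sum>T\<in>H S. (segsum x T)\<^sup>2) + (\<Sum>S\<in>F. \<Sum>T\<in>K S. (segsum z T)\<^sup>2)
      + (\<Sum>S\<in>F. \<Sum>u\<in>S \<inter> U. d u)"
    by (simp add: sum.distrib)
  also have "\<dots> \<le> (norm x)\<^sup>2 + (norm z)\<^sup>2 + (\<Sum>u\<in>U. d u)"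
  proof (intro add_mono refined_family_le_norm[OF F])
    have "(\<Sum>S\<in>F. \<Sum>u\<in>S \<inter> U. d u) = (\<Sum>u\<in>(\<Union>S\<in>F. S \<inter> U). d u)"
    proof (rule sum.UNION_disjoint[symmetric])
      show "\<forall>S\<in>F. \<forall>S'\<in>F. S \<noteq> S' \<longrightarrow> (S \<inter> U) \<inter> (S' \<inter> U) = {}"
      proof (intro ballI impI)
        fix S S' assume "S \<in> F" "S' \<in> F" "S \<noteq> S'"
        then have "S \<inter> S' = {}" using F by (auto simp: segment_family_def dest: disjointD)
        then show "(S \<inter> U) \<inter> (S' \<inter> U) = {}" by blast
      qed
    qed (use F U in \<open>auto simp: segment_family_def\<close>)
    also have "\<dots> \<le> (\<Sum>u\<in>U. d u)" using U by (intro sum_mono2) auto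
    finally show "(\<Sum>S\<in>F. \<Sum>u\<in>S \<inter> U. d u) \<le> (\<Sum>u\<in>U. d u)" .
  qed (use HK seg in auto)
  finally show "(\<Sum>S\<in>F. (segsum y S)\<^sup>2) \<le> (norm x)\<^sup>2 + (norm z)\<^sup>2 + (\<Sum>u\<in>U. d u)" .
qed

lemma segment_family_empty [simp]: "segment_family {}"
  by (simp add: segment_family_def)

lemma segment_family_single: "is_segment S \<Longrightarrow> segment_family {S}"
  by (simp add: segment_family_def)


section \<open>Unit vectors, levels and tails\<close>

lift_definition unit_at :: "node \<Rightarrow> jt_fin" is "\<lambda>t s. if s = t then 1 else 0"
  by simp

definition supp_lt :: "nat \<Rightarrow> jt_fin \<Rightarrow> bool" where
  "supp_lt m x \<longleftrightarrow> (\<forall>t. m \<le> length t \<longrightarrow> Rep_jt_fin x t = 0)"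

definition supp_ge :: "nat \<Rightarrow> jt_fin \<Rightarrow> bool" where
  "supp_ge m x \<longleftrightarrow> (\<forall>t. length t < m \<longrightarrow> Rep_jt_fin x t = 0)"

lemma supp_ge_add: "supp_ge m x \<Longrightarrow> supp_ge m y \<Longrightarrow> supp_ge m (x + y)"
  by (simp add: supp_ge_def plus_jt_fin.rep_eq)

lemma supp_ge_diff: "supp_ge m x \<Longrightarrow> supp_ge m y \<Longrightarrow> supp_ge m (x - y)"
  by (simp add: supp_ge_def minus_jt_fin.rep_eq)

lemma supp_ge_scaleR: "supp_ge m x \<Longrightarrow> supp_ge m (r *\<^sub>R x)"
  by (simp add: supp_ge_def scaleR_jt_fin.rep_eq)

lemma supp_ge_mono: "supp_ge m x \<Longrightarrow> n \<le> m \<Longrightarrow> supp_ge n x"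
  by (simp add: supp_ge_def)

lemma supp_lt_mono: "supp_lt m x \<Longrightarrow> m \<le> n \<Longrightarrow> supp_lt n x"
  by (simp add: supp_lt_def)

lemma Rep_jt_fin_sum: "Rep_jt_fin (\<Sum>i\<in>I. h i) t = (\<Sum>i\<in>I. Rep_jt_fin (h i) t)"
  by (induction I rule: infinite_finite_induct) (simp_all add: zero_jt_fin.rep_eq plus_jt_fin.rep_eq)

lemma ex_supp_lt: "\<exists>m. supp_lt m x"
proof -
  let ?A = "length ` {t. Rep_jt_fin x t \<noteq> 0}"
  have "supp_lt (Suc (Max (insert 0 ?A))) x"
    unfolding supp_lt_def
  proof (intro allI impI, rule ccontr)
    fix t assume t: "Suc (Max (insert 0 ?A)) \<le> length t" "Rep_jt_fin x t \<noteq> 0"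
    then have "length t \<le> Max (insert 0 ?A)"
      using finite_support[of x] by (intro Max_ge) auto
    then show False using t by simp
  qed
  then show ?thesis ..
qed

definition spread :: "nat \<Rightarrow> (node \<Rightarrow> real) \<Rightarrow> jt_fin" where
  "spread m w = (\<Sum>u\<in>level m. w u *\<^sub>R unit_at u)"

lemma Rep_spread: "Rep_jt_fin (spread m w) t = (if length t = m then w t else 0)"
proof -
  have "Rep_jt_fin (spread m w) t = (\<Sum>u\<in>level m. if t = u then w u else 0)"
    unfolding spread_def Rep_jt_fin_sum by (intro sum.cong) (auto simp: scaleR_jt_fin.rep_eq unit_at.rep_eq)
  also have "\<dots> = (if length t = m then w t else 0)"
    by (subst sum.delta'[OF finite_level]) (simp add: level_def)
  finally show ?thesis .
qed

lemma supp_ge_spread: "supp_ge m (spread m w)"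
  by (simp add: supp_ge_def Rep_spread)

lemma segsum_spread:
  "segsum (spread m w) (seg i v) = (if i \<le> m \<and> m \<le> length v then w (take m v) else 0)"
proof -
  have "segsum (spread m w) (seg i v) = (\<Sum>k=i..length v. if k = m then w (take m v) else 0)"
    unfolding segsum_def sum_seg by (intro sum.cong) (auto simp: Rep_spread)
  then show ?thesis by simp
qed

lemma norm_spread: "(norm (spread m w))\<^sup>2 \<le> (\<Sum>u\<in>level m. (w u)\<^sup>2)"
proof -
  have "(norm (spread m w))\<^sup>2 \<le> (norm (0::jt_fin))\<^sup>2 + (norm (0::jt_fin))\<^sup>2 + (\<Sum>u\<in>level m. (w u)\<^sup>2)"
  proof (rule norm_domination)
    fix S assume "is_segment S"
    then obtain i v where iv: "S = seg i v" by (auto simp: is_segment_iff_seg)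
    have "(segsum (spread m w) S)\<^sup>2 \<le> (\<Sum>u\<in>S \<inter> level m. (w u)\<^sup>2)"
    proof (cases "i \<le> m \<and> m \<le> length v")
      case True
      then have "{take m v} \<subseteq> S \<inter> level m" by (auto simp: iv mem_seg_iff take_is_prefix level_def)
      then have "(\<Sum>u\<in>{take m v}. (w u)\<^sup>2) \<le> (\<Sum>u\<in>S \<inter> level m. (w u)\<^sup>2)"
        by (intro sum_mono2) (auto simp: iv)
      then show ?thesis using True by (simp add: iv segsum_spread)
    next
      case False
      then show ?thesis by (auto simp: iv segsum_spread intro!: sum_nonneg)
    qed
    then show "\<exists>H K. segment_family H \<and> segment_family K \<and> \<Union>H \<subseteq> S \<and> \<Union>K \<subseteq> S \<and>
      (segsum (spread m w) S)\<^sup>2 \<le> (\<Sum>T\<in>H. (segsum 0 T)\<^sup>2) + (\<Sum>T\<in>K. (segsum 0 T)\<^sup>2) + (\<Sum>u\<in>S \<inter> level m. (w u)\<^sup>2)"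
      by (intro exI[of _ "{}"]) simp
  qed auto
  then show ?thesis by simp
qed

lemma unit_at_spread: "unit_at t = spread (length t) (\<lambda>u. if u = t then 1 else 0)"
  by (rule Rep_jt_fin_inject[THEN iffD1]) (auto simp: fun_eq_iff unit_at.rep_eq Rep_spread)

lemma norm_unit_at: "norm (unit_at t) \<le> 1"
proof -
  have "(norm (unit_at t))\<^sup>2 \<le> (\<Sum>u\<in>level (length t). (if u = t then 1 else 0)\<^sup>2)"
    unfolding unit_at_spread[of t] by (rule norm_spread)
  also have "\<dots> = (\<Sum>u\<in>level (length t). (if u = t then 1 else 0))"
    by (intro sum.cong) auto
  also have "\<dots> = 1" by (subst sum.delta[OF finite_level]) (simp add: level_def)
  finally show ?thesis by (metis norm_ge_zero one_power2 power2_le_imp_le zero_le_one)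
qed

lemma supp_ge_unit_at: "m \<le> length t \<Longrightarrow> supp_ge m (unit_at t)"
  by (auto simp: supp_ge_def unit_at.rep_eq)

lemma segsum_unit_at: "finite S \<Longrightarrow> segsum (unit_at t) S = (if t \<in> S then 1 else 0)"
  by (simp add: segsum_def unit_at.rep_eq)

lift_definition tail :: "nat \<Rightarrow> jt_fin \<Rightarrow> jt_fin" is "\<lambda>m x t. if m \<le> length t then x t else 0"
  by (erule rev_finite_subset) auto

lemma supp_ge_tail: "supp_ge m (tail m x)"
  by (simp add: supp_ge_def tail.rep_eq)

lemma segsum_supp_ge:
  assumes "supp_ge m x" "i \<le> m"
  shows "segsum x (seg i v) = segsum x (seg m v)"
  unfolding segsum_def sum_seg using assms
  by (intro sum.mono_neutral_right) (auto simp: supp_ge_def)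

lemma norm_tail: "norm (tail m x) \<le> norm x"
proof -
  have "(norm (tail m x))\<^sup>2 \<le> (norm x)\<^sup>2 + (norm (0::jt_fin))\<^sup>2 + (\<Sum>u\<in>({}::node set). 0)"
  proof (rule norm_domination)
    fix S assume "is_segment S"
    then obtain i v where iv: "i \<le> length v" "S = seg i v" by (auto simp: is_segment_iff_seg)
    let ?j = "max i m"
    have "segsum (tail m x) S = segsum x (seg ?j v)"
      unfolding iv segsum_def sum_seg
      by (rule sum.mono_neutral_cong_right) (auto simp: tail.rep_eq)
    moreover have "seg ?j v = {} \<or> is_segment (seg ?j v)"
    proof (cases "?j \<le> length v")
      case True
      then show ?thesis using is_segment_seg by blast
    next
      case False
      then show ?thesis by (simp add: seg_def)
    qed
    moreover have "seg ?j v \<subseteq> S" by (auto simp: iv mem_seg_iff)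
    ultimately show "\<exists>H K. segment_family H \<and> segment_family K \<and> \<Union>H \<subseteq> S \<and> \<Union>K \<subseteq> S \<and>
      (segsum (tail m x) S)\<^sup>2 \<le> (\<Sum>T\<in>H. (segsum x T)\<^sup>2) + (\<Sum>T\<in>K. (segsum 0 T)\<^sup>2) + (\<Sum>u\<in>S \<inter> {}. 0)"
      by (intro exI[of _ "if seg ?j v = {} then {} else {seg ?j v}"] exI[of _ "{}"])
        (auto simp: segment_family_single segsum_def)
  qed auto
  then show ?thesis by (simp add: power2_le_iff_abs_le)
qed

lemma jt_fin_expand: "x = tail m x + (\<Sum>t\<in>{t. length t < m}. Rep_jt_fin x t *\<^sub>R unit_at t)"
proof -
  have fin: "finite {t :: node. length t < m}"
  proof (rule finite_subset)
    show "{t :: node. length t < m} \<subseteq> (\<Union>n<m. level n)" by (auto simp: level_def)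
  qed auto
  have "Rep_jt_fin (\<Sum>t\<in>{t. length t < m}. Rep_jt_fin x t *\<^sub>R unit_at t) s
      = (\<Sum>t\<in>{t. length t < m}. if s = t then Rep_jt_fin x t else 0)" for s
    unfolding Rep_jt_fin_sum by (intro sum.cong) (auto simp: scaleR_jt_fin.rep_eq unit_at.rep_eq)
  then have "Rep_jt_fin (\<Sum>t\<in>{t. length t < m}. Rep_jt_fin x t *\<^sub>R unit_at t) s
      = (if length s < m then Rep_jt_fin x s else 0)" for s
    using fin by simp
  then show ?thesis
    by (intro Rep_jt_fin_inject[THEN iffD1])
      (auto simp: fun_eq_iff plus_jt_fin.rep_eq tail.rep_eq)
qed


section \<open>Gluing vectors without first-order cost\<close>

text \<open>Think of \<open>s j\<close> as the sum of \<open>x\<close> over the levels \<open>j, \<dots>, m\<close> of a path and of \<open>b\<close> as the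
  contribution of a second vector that continues the path.  The sign \<open>\<sigma>\<close>, opposite to that of \<open>b\<close>,
  is the sign of the last \<open>s k\<close> that exceeds the bound \<open>c\<close> for \<open>b\<close> in absolute value.  If \<open>s j\<close> has
  this sign, then \<open>b\<close> can increase its square by a second-order term only; if \<open>s j\<close> has the other
  sign, then either \<open>\<bar>s j\<bar> \<le> c\<close> and everything is of second order, or \<open>j < k\<close> and cutting the path
  at level \<open>k\<close> separates two sums of opposite signs, which gains at least as much as \<open>b\<close> can
  contribute.  Taking the last large sum, not the largest one, is what guarantees \<open>j < k\<close>: a segment
  can be cut, but it cannot be prolonged within a disjoint family.\<close>

lemma last_large_sign:
  fixes s :: "nat \<Rightarrow> real" and c :: real
  assumes c: "0 \<le> c"
  shows "\<exists>\<sigma>. (\<sigma> = 1 \<or> \<sigma> = -1) \<and> (\<forall>j b. j \<le> m \<longrightarrow> - c \<le> \<sigma> * b \<longrightarrow> \<sigma> * b \<le> 0 \<longrightarrow>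
      (s j + b)\<^sup>2 \<le> (s j)\<^sup>2 + 3 * c\<^sup>2 \<or>
      (\<exists>j'. j < j' \<and> j' \<le> m \<and> (s j + b)\<^sup>2 \<le> (s j - s j')\<^sup>2 + (s j')\<^sup>2))"
proof -
  define J where "J = {j. j \<le> m \<and> c < \<bar>s j\<bar>}"
  define \<sigma> :: real where "\<sigma> = (if J = {} \<or> 0 < s (Max J) then 1 else -1)"
  have fin: "finite J" by (simp add: J_def)
  have \<sigma>: "\<sigma> = 1 \<or> \<sigma> = -1" by (simp add: \<sigma>_def)
  have "(s j + b)\<^sup>2 \<le> (s j)\<^sup>2 + 3 * c\<^sup>2 \<or>
      (\<exists>j'. j < j' \<and> j' \<le> m \<and> (s j + b)\<^sup>2 \<le> (s j - s j')\<^sup>2 + (s j')\<^sup>2)"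
    if j: "j \<le> m" and b: "- c \<le> \<sigma> * b" "\<sigma> * b \<le> 0" for j b
  proof -
    have absb: "\<bar>b\<bar> \<le> c" using b \<sigma> by auto
    then have b2: "b\<^sup>2 \<le> c\<^sup>2" by (rule power2_le_iff_abs_le[THEN iffD2, OF c])
    have expand: "(s j + b)\<^sup>2 = (s j)\<^sup>2 + 2 * (s j * b) + b\<^sup>2" by (simp add: power2_sum)
    consider "\<bar>s j\<bar> \<le> c" | "c < \<bar>s j\<bar>" "0 \<le> \<sigma> * s j" | "c < \<bar>s j\<bar>" "\<sigma> * s j < 0" by linarith
    then show ?thesis
    proof cases
      case 1
      have "s j * b \<le> \<bar>s j\<bar> * \<bar>b\<bar>" by (simp add: abs_mult[symmetric])
      also have "\<dots> \<le> c * c" using 1 absb by (intro mult_mono) auto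
      finally show ?thesis using b2 expand by (simp add: power2_eq_square)
    next
      case 2
      have "s j * b = (\<sigma> * s j) * (\<sigma> * b)" using \<sigma> by auto
      also have "\<dots> \<le> 0" using 2(2) b(2) by (rule mult_nonneg_nonpos)
      finally show ?thesis using b2 expand zero_le_power2[of c] by linarith
    next
      case 3
      define k where "k = Max J"
      have "j \<in> J" using 3 j by (simp add: J_def)
      then have k: "k \<in> J" "j \<le> k" using fin by (auto simp: k_def intro: Max_in)
      then have sk: "c < \<sigma> * s k" "k \<le> m"
        using \<open>j \<in> J\<close> c by (auto simp: \<sigma>_def J_def k_def)
      then have "j \<noteq> k" using 3 c by auto
      have "\<bar>s j + b\<bar> \<le> \<bar>s j - s k\<bar>" using \<sigma> 3 b sk c by auto
      then have "(s j + b)\<^sup>2 \<le> (s j - s k)\<^sup>2" by (simp add: abs_le_square_iff)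
      then have "(s j + b)\<^sup>2 \<le> (s j - s k)\<^sup>2 + (s k)\<^sup>2" by (simp add: add_increasing2)
      then show ?thesis using \<open>j \<noteq> k\<close> k sk by (intro disjI2 exI[of _ k]) auto
    qed
  qed
  with \<sigma> show ?thesis by (intro exI[of _ \<sigma>] conjI) simp_all
qed

lemma segsum_supp_lt:
  assumes "supp_lt m x" "m \<le> length v"
  shows "segsum x (seg i v) = segsum x (seg i (take m v))"
  unfolding segsum_def sum_seg using assms
  by (intro sum.mono_neutral_cong_right) (auto simp: supp_lt_def min_def)

lemma segsum_split:
  assumes "i < j" "j \<le> length v"
  shows "segsum x (seg i v) = segsum x (seg i (take (j - 1) v)) + segsum x (seg j v)"
proof -
  let ?h = "\<lambda>k. Rep_jt_fin x (take k v)"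
  have "{i..length v} = {i..j - 1} \<union> {j..length v}" using assms by auto
  then have "sum ?h {i..length v} = sum ?h {i..j - 1} + sum ?h {j..length v}"
    using assms by (simp add: sum.union_disjoint[symmetric] disjoint_iff)
  moreover have "segsum x (seg i (take (j - 1) v)) = sum ?h {i..j - 1}"
    unfolding segsum_def sum_seg using assms by (intro sum.cong) (auto simp: min_def)
  ultimately show ?thesis by (simp add: segsum_def sum_seg)
qed

lemma segsum_zero_levels:
  assumes "\<And>t. t \<in> S \<Longrightarrow> Rep_jt_fin x t = 0"
  shows "segsum x S = 0"
  using assms by (simp add: segsum_def)

text \<open>In general \<open>norm (x + \<tau> *\<^sub>R z)\<close> may exceed \<open>norm x\<close> by a multiple of \<open>\<tau>\<close>, however far apart the
  supports are, since a segment may run through both.  But for each node \<open>u\<close> at the interface level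
  the segments ending at \<open>u\<close> that are nearly optimal for \<open>x\<close> agree in the sign of their sum; if \<open>z\<close>
  contributes with the opposite sign beyond every \<open>u\<close>, then only a second-order term remains.  The
  signs depend on \<open>x\<close> and on the sizes \<open>c\<close>, but not on \<open>z\<close>.\<close>

lemma gluing:
  assumes x: "supp_lt m x" and c: "\<And>u. 0 \<le> c u"
  obtains \<sigma> :: "node \<Rightarrow> real" where "\<And>u. \<sigma> u = 1 \<or> \<sigma> u = -1"
    "\<And>z. supp_ge m z \<Longrightarrow>
      (\<And>v. m \<le> length v \<Longrightarrow> - c (take m v) \<le> \<sigma> (take m v) * segsum z (seg m v) \<and>
                           \<sigma> (take m v) * segsum z (seg m v) \<le> 0) \<Longrightarrow>
      (norm (x + z))\<^sup>2 \<le> (norm x)\<^sup>2 + (norm z)\<^sup>2 + 3 * (\<Sum>u\<in>level m. (c u)\<^sup>2)"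
proof -
  let ?P = "\<lambda>u \<sigma>. (\<sigma> = 1 \<or> \<sigma> = -1) \<and> (\<forall>j b. j \<le> m \<longrightarrow> - c u \<le> \<sigma> * b \<longrightarrow> \<sigma> * b \<le> 0 \<longrightarrow>
      (segsum x (seg j u) + b)\<^sup>2 \<le> (segsum x (seg j u))\<^sup>2 + 3 * (c u)\<^sup>2 \<or>
      (\<exists>j'. j < j' \<and> j' \<le> m \<and> (segsum x (seg j u) + b)\<^sup>2
        \<le> (segsum x (seg j u) - segsum x (seg j' u))\<^sup>2 + (segsum x (seg j' u))\<^sup>2))"
  have "\<forall>u. \<exists>\<sigma>. ?P u \<sigma>" by (intro allI last_large_sign c)
  from choice[OF this] obtain \<sigma> :: "node \<Rightarrow> real" where P: "\<forall>u. ?P u (\<sigma> u)" ..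
  have \<sigma>: "\<sigma> u = 1 \<or> \<sigma> u = -1" for u using P by simp
  have split: "(segsum x (seg j u) + b)\<^sup>2 \<le> (segsum x (seg j u))\<^sup>2 + 3 * (c u)\<^sup>2 \<or>
      (\<exists>j'. j < j' \<and> j' \<le> m \<and> (segsum x (seg j u) + b)\<^sup>2
        \<le> (segsum x (seg j u) - segsum x (seg j' u))\<^sup>2 + (segsum x (seg j' u))\<^sup>2)"
    if "j \<le> m" "- c u \<le> \<sigma> u * b" "\<sigma> u * b \<le> 0" for u j b
    using P that by simp
  have "(norm (x + z))\<^sup>2 \<le> (norm x)\<^sup>2 + (norm z)\<^sup>2 + 3 * (\<Sum>u\<in>level m. (c u)\<^sup>2)"
    if z: "supp_ge m z"
      and sgn: "\<And>v. m \<le> length v \<Longrightarrow> - c (take m v) \<le> \<sigma> (take m v) * segsum z (seg m v) \<and>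
                           \<sigma> (take m v) * segsum z (seg m v) \<le> 0" for z
  proof -
    have "(norm (x + z))\<^sup>2 \<le> (norm x)\<^sup>2 + (norm z)\<^sup>2 + (\<Sum>u\<in>level m. 3 * (c u)\<^sup>2)"
    proof (rule norm_domination)
      fix S assume S: "is_segment S"
      then obtain i v where iv: "i \<le> length v" "S = seg i v" by (auto simp: is_segment_iff_seg)
      have extra: "0 \<le> (\<Sum>u\<in>S \<inter> level m. 3 * (c u)\<^sup>2)" by (intro sum_nonneg) auto
      let ?goal = "\<lambda>H K. segment_family H \<and> segment_family K \<and> \<Union>H \<subseteq> S \<and> \<Union>K \<subseteq> S \<and>
        (segsum (x + z) S)\<^sup>2 \<le> (\<Sum>T\<in>H. (segsum x T)\<^sup>2) + (\<Sum>T\<in>K. (segsum z T)\<^sup>2)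
          + (\<Sum>u\<in>S \<inter> level m. 3 * (c u)\<^sup>2)"
      consider "m \<le> i" | "length v < m" | "i < m" "m \<le> length v" by linarith
      then show "\<exists>H K. ?goal H K"
      proof cases
        case 1
        then have "segsum x S = 0"
          using x by (intro segsum_zero_levels) (auto simp: iv mem_seg_iff supp_lt_def)
        then have "?goal {} {S}" using S extra by (simp add: segsum_add segment_family_single)
        then show ?thesis by (intro exI)
      next
        case 2
        then have "segsum z S = 0"
          using z by (intro segsum_zero_levels) (auto simp: iv mem_seg_iff supp_ge_def dest: prefix_length_le)
        then have "?goal {S} {}" using S extra by (simp add: segsum_add segment_family_single)
        then show ?thesis by (intro exI)
      next
        case 3
        define u where "u = take m v"
        define b where "b = segsum z (seg m v)"
        have lu: "length u = m" using 3 by (simp add: u_def)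
        have xS: "segsum x S = segsum x (seg i u)"
          unfolding iv u_def by (rule segsum_supp_lt[OF x 3(2)])
        have zS: "segsum z S = b"
          unfolding iv b_def by (rule segsum_supp_ge[OF z]) (use 3 in simp)
        have "u \<in> S \<inter> level m" using 3 by (auto simp: iv mem_seg_iff u_def take_is_prefix level_def)
        then have "(\<Sum>u\<in>{u}. 3 * (c u)\<^sup>2) \<le> (\<Sum>u\<in>S \<inter> level m. 3 * (c u)\<^sup>2)"
          by (intro sum_mono2) auto
        then have cu: "3 * (c u)\<^sup>2 \<le> (\<Sum>u\<in>S \<inter> level m. 3 * (c u)\<^sup>2)" by simp
        have "- c u \<le> \<sigma> u * b" "\<sigma> u * b \<le> 0" using sgn[OF 3(2)] by (auto simp: u_def b_def)
        from split[OF less_imp_le[OF 3(1)] this] show ?thesis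
        proof (elim disjE exE conjE)
          assume "(segsum x (seg i u) + b)\<^sup>2 \<le> (segsum x (seg i u))\<^sup>2 + 3 * (c u)\<^sup>2"
          then have "?goal {S} {}"
            using S cu by (simp add: segsum_add segment_family_single xS zS)
          then show ?thesis by (intro exI)
        next
          fix j assume j: "i < j" "j \<le> m" and le: "(segsum x (seg i u) + b)\<^sup>2
            \<le> (segsum x (seg i u) - segsum x (seg j u))\<^sup>2 + (segsum x (seg j u))\<^sup>2"
          let ?A = "seg i (take (j - 1) u)" and ?B = "seg j u"
          have disj: "?A \<inter> ?B = {}" using j lu
            by (auto simp: mem_seg_iff dest!: prefix_length_le)
          have seg: "is_segment ?A" "is_segment ?B" using j lu by (auto intro!: is_segment_seg)
          then have "?A \<noteq> ?B" using disj is_segment_nonempty by auto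
          have "prefix u v" "prefix (take (j - 1) u) v"
            by (auto simp: u_def take_is_prefix)
          then have sub: "?A \<subseteq> S" "?B \<subseteq> S" using j
            by (auto simp: iv mem_seg_iff intro: prefix_order.trans)
          have "segsum x ?A = segsum x (seg i u) - segsum x ?B"
            using segsum_split[of i j u x] j lu by simp
          then have "(segsum (x + z) S)\<^sup>2 \<le> (\<Sum>T\<in>{?A, ?B}. (segsum x T)\<^sup>2)"
            using le \<open>?A \<noteq> ?B\<close> by (simp add: segsum_add xS zS)
          moreover have "segment_family {?A, ?B}"
            using seg disj by (auto simp: segment_family_def disjoint_def)
          ultimately have "?goal {?A, ?B} {}" using sub extra by simp
          then show ?thesis by (intro exI)
        qed
      qed
    qed auto
    then show ?thesis by (simp add: sum_distrib_left)
  qed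
  with \<sigma> show thesis by (rule that)
qed

text \<open>A bounded functional cannot gain \<open>r\<close> in each of \<open>k\<close> steps while the norm grows only
  like \<open>sqrt k\<close>.  That functionals converge along branches, and that they are small far out in the
  tree when the limits are \<open>0\<close>, is derived from this contradiction.\<close>

lemma gluing_unbounded:
  fixes f :: "jt_fin \<Rightarrow>\<^sub>L real"
  assumes r: "0 < r" and step: "\<And>x. \<exists>z. (norm (x + z))\<^sup>2 \<le> (norm x)\<^sup>2 + C \<and> r \<le> f z"
  shows False
proof -
  have "\<exists>x. (norm x)\<^sup>2 \<le> real k * C \<and> real k * r \<le> f x" for k
  proof (induction k)
    case 0
    show ?case by (intro exI[of _ 0]) (simp add: blinfun.zero_right)
  next
    case (Suc k)
    then obtain x where x: "(norm x)\<^sup>2 \<le> real k * C" "real k * r \<le> f x" by blast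
    obtain z where z: "(norm (x + z))\<^sup>2 \<le> (norm x)\<^sup>2 + C" "r \<le> f z" using step by blast
    have "f (x + z) = f x + f z" by (rule blinfun.add_right)
    then show ?case using x z by (intro exI[of _ "x + z"]) (simp add: algebra_simps)
  qed
  then have bound: "real k * r\<^sup>2 \<le> (norm f)\<^sup>2 * C" if "0 < k" for k
  proof -
    obtain x where x: "(norm x)\<^sup>2 \<le> real k * C" "real k * r \<le> f x"
      using \<open>\<And>k. \<exists>x. (norm x)\<^sup>2 \<le> real k * C \<and> real k * r \<le> f x\<close> by blast
    have "real k * r \<le> norm f * norm x"
      using x(2) norm_blinfun[of f x] by (simp add: abs_le_iff)
    then have "(real k * r)\<^sup>2 \<le> (norm f * norm x)\<^sup>2"
      using r by (intro power_mono) auto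
    also have "\<dots> = (norm f)\<^sup>2 * (norm x)\<^sup>2" by (rule power_mult_distrib)
    also have "\<dots> \<le> (norm f)\<^sup>2 * (real k * C)" using x(1) by (intro mult_left_mono) auto
    finally have "real k * (real k * r\<^sup>2) \<le> real k * ((norm f)\<^sup>2 * C)"
      by (simp add: power2_eq_square algebra_simps)
    then show ?thesis using that by simp
  qed
  obtain k :: nat where k: "(norm f)\<^sup>2 * C / r\<^sup>2 < real k" using reals_Archimedean2 by blast
  have "(norm f)\<^sup>2 * C < real (Suc k) * r\<^sup>2"
  proof -
    have "(norm f)\<^sup>2 * C < real k * r\<^sup>2" using k r by (simp add: field_simps)
    also have "\<dots> \<le> real (Suc k) * r\<^sup>2" by (intro mult_right_mono) auto
    finally show ?thesis .
  qed
  then show False using bound[of "Suc k"] by simp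
qed

text \<open>The sizes needed for gluing are square summable with a bound that does not depend on the number
  of nodes at the level, because the segments where the largest sums are attained are disjoint.\<close>

lemma segsum_bounds:
  obtains c where "\<And>u. 0 \<le> c u" "\<And>v. m \<le> length v \<Longrightarrow> \<bar>segsum z (seg m v)\<bar> \<le> c (take m v)"
    "(\<Sum>u\<in>level m. (c u)\<^sup>2) \<le> (norm z)\<^sup>2"
proof -
  define V where "V u = {v. m \<le> length v \<and> take m v = u}" for u :: node
  define W where "W u = (\<lambda>v. \<bar>segsum z (seg m v)\<bar>) ` V u" for u
  let ?supp = "{t. Rep_jt_fin z t \<noteq> 0}"
  have "finite (W u)" for u
  proof (rule finite_subset)
    show "finite ((\<lambda>T. \<bar>\<Sum>t\<in>T. Rep_jt_fin z t\<bar>) ` Pow ?supp)" using finite_support by simp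
    have "segsum z S = (\<Sum>t\<in>S \<inter> ?supp. Rep_jt_fin z t)" if "finite S" for S
      unfolding segsum_def using that by (intro sum.mono_neutral_right) auto
    then show "W u \<subseteq> (\<lambda>T. \<bar>\<Sum>t\<in>T. Rep_jt_fin z t\<bar>) ` Pow ?supp"
      by (auto simp: W_def)
  qed
  note finW = this
  have "\<exists>v. v \<in> V u \<and> \<bar>segsum z (seg m v)\<bar> = Max (W u)" if "u \<in> level m" for u
  proof -
    have "u \<in> V u" using that by (simp add: V_def level_def)
    then have "Max (W u) \<in> W u" by (intro Max_in finW) (auto simp: W_def)
    then show ?thesis by (auto simp: W_def)
  qed
  then obtain best where best: "\<And>u. u \<in> level m \<Longrightarrow> best u \<in> V u \<and> \<bar>segsum z (seg m (best u))\<bar> = Max (W u)"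
    by metis
  define c where "c u = (if u \<in> level m then Max (W u) else 0)" for u
  show thesis
  proof (rule that[of c])
    show "0 \<le> c u" for u using best[of u] abs_ge_zero[of "segsum z (seg m (best u))"] by (auto simp: c_def)
    show "\<bar>segsum z (seg m v)\<bar> \<le> c (take m v)" if "m \<le> length v" for v
      using that finW[of "take m v"] by (auto simp: c_def level_def W_def V_def intro!: Max_ge)
    have inj: "seg m (best u) \<inter> seg m (best u') = {}" if "u \<in> level m" "u' \<in> level m" "u \<noteq> u'" for u u'
    proof -
      have "take m (best u) \<noteq> take m (best u')"
        using best[OF that(1)] best[OF that(2)] that(3) by (simp add: V_def)
      moreover have "take m t = take m b" if "m \<le> length t" "prefix t b" for t b :: node
        using that by (auto simp: prefix_def)
      ultimately show ?thesis by (auto simp: mem_seg_iff) metis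
    qed
    have ne: "seg m (best u) \<noteq> {}" if "u \<in> level m" for u
      using best[OF that] by (intro seg_nonempty) (simp add: V_def)
    have injon: "inj_on (\<lambda>u. seg m (best u)) (level m)"
    proof (rule inj_onI, rule ccontr)
      fix u u' assume "u \<in> level m" "u' \<in> level m" "seg m (best u) = seg m (best u')" "u \<noteq> u'"
      then show False using inj[of u u'] ne[of u] by simp
    qed
    have "(\<Sum>u\<in>level m. (c u)\<^sup>2) = (\<Sum>u\<in>level m. (segsum z (seg m (best u)))\<^sup>2)"
    proof (rule sum.cong[OF refl])
      fix u assume "u \<in> level m"
      then have "c u = \<bar>segsum z (seg m (best u))\<bar>" using best by (simp add: c_def)
      then show "(c u)\<^sup>2 = (segsum z (seg m (best u)))\<^sup>2" by simp
    qed
    also have "\<dots> = (\<Sum>S\<in>(\<lambda>u. seg m (best u)) ` level m. (segsum z S)\<^sup>2)"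
      by (simp add: sum.reindex[OF injon])
    also have "\<dots> \<le> (norm z)\<^sup>2"
    proof (rule segment_family_le_norm)
      have "is_segment (seg m (best u))" if "u \<in> level m" for u
        using best[OF that] by (intro is_segment_seg) (simp add: V_def)
      moreover have "disjoint ((\<lambda>u. seg m (best u)) ` level m)"
      proof (rule disjointI)
        fix S S' assume "S \<in> (\<lambda>u. seg m (best u)) ` level m" "S' \<in> (\<lambda>u. seg m (best u)) ` level m" "S \<noteq> S'"
        then show "S \<inter> S' = {}" using inj by auto
      qed
      ultimately show "segment_family ((\<lambda>u. seg m (best u)) ` level m)"
        by (auto simp: segment_family_def)
    qed
    finally show "(\<Sum>u\<in>level m. (c u)\<^sup>2) \<le> (norm z)\<^sup>2" .
  qed
qed


section \<open>Functionals along branches\<close>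

definition branch_node :: "(nat \<Rightarrow> bool) \<Rightarrow> nat \<Rightarrow> node" where
  "branch_node \<gamma> n = map \<gamma> [0..<n]"

lemma length_branch_node [simp]: "length (branch_node \<gamma> n) = n"
  by (simp add: branch_node_def)

lemma take_branch_node: "k \<le> n \<Longrightarrow> take k (branch_node \<gamma> n) = branch_node \<gamma> k"
  by (simp add: branch_node_def take_map)

lemma prefix_branch_node: "k \<le> n \<Longrightarrow> prefix (branch_node \<gamma> k) (branch_node \<gamma> n)"
  by (metis take_branch_node take_is_prefix)

lemma segsum_unit_at_seg:
  "m \<le> length t \<Longrightarrow> segsum (unit_at t) (seg m v) = (if prefix t v then 1 else 0)"
  by (simp add: segsum_unit_at mem_seg_iff)

lemma prefix_take_eq: "m \<le> length t \<Longrightarrow> prefix t v \<Longrightarrow> take m v = take m t"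
  by (auto simp: prefix_def)

text \<open>When \<open>z\<close> lives beyond one node \<open>u\<close>, there is only one sign to respect.  It is unknown, so an
  application has to offer a suitable \<open>z\<close> for either value.\<close>

lemma gluing_beyond_node:
  assumes x: "supp_lt m x" and u: "length u = m"
  obtains s :: real where "s = 1 \<or> s = -1"
    "\<And>z. supp_ge m z \<Longrightarrow> norm z \<le> 2 \<Longrightarrow>
      (\<And>v. m \<le> length v \<Longrightarrow> s * segsum z (seg m v) \<in> {0..1}) \<Longrightarrow>
      (\<And>v. m \<le> length v \<Longrightarrow> take m v \<noteq> u \<Longrightarrow> segsum z (seg m v) = 0) \<Longrightarrow>
      (norm (x + z))\<^sup>2 \<le> (norm x)\<^sup>2 + 7"
proof -
  let ?c = "\<lambda>t. if t = u then 1 else 0 :: real"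
  obtain \<sigma> :: "node \<Rightarrow> real" where \<sigma>: "\<And>u. \<sigma> u = 1 \<or> \<sigma> u = -1"
    and glue: "\<And>z. supp_ge m z \<Longrightarrow>
      (\<And>v. m \<le> length v \<Longrightarrow> - ?c (take m v) \<le> \<sigma> (take m v) * segsum z (seg m v) \<and>
                           \<sigma> (take m v) * segsum z (seg m v) \<le> 0) \<Longrightarrow>
      (norm (x + z))\<^sup>2 \<le> (norm x)\<^sup>2 + (norm z)\<^sup>2 + 3 * (\<Sum>u\<in>level m. (?c u)\<^sup>2)"
    by (rule gluing[OF x, of ?c]) auto
  have "(\<Sum>u\<in>level m. (?c u)\<^sup>2) = (\<Sum>t\<in>level m. if t = u then 1 else 0)" by (intro sum.cong) auto
  also have "\<dots> = 1" using u by (subst sum.delta[OF finite_level]) (simp add: level_def)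
  finally have c1: "(\<Sum>u\<in>level m. (?c u)\<^sup>2) = 1" .
  show thesis
  proof (rule that[of "- \<sigma> u"])
    show "- \<sigma> u = 1 \<or> - \<sigma> u = -1" using \<sigma>[of u] by auto
    fix z assume z: "supp_ge m z" "norm z \<le> 2"
      and *: "\<And>v. m \<le> length v \<Longrightarrow> - \<sigma> u * segsum z (seg m v) \<in> {0..1}"
        "\<And>v. m \<le> length v \<Longrightarrow> take m v \<noteq> u \<Longrightarrow> segsum z (seg m v) = 0"
    have "(norm (x + z))\<^sup>2 \<le> (norm x)\<^sup>2 + (norm z)\<^sup>2 + 3 * (\<Sum>u\<in>level m. (?c u)\<^sup>2)"
    proof (rule glue[OF z(1)])
      fix v :: node assume "m \<le> length v"
      then show "- ?c (take m v) \<le> \<sigma> (take m v) * segsum z (seg m v) \<and>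
                           \<sigma> (take m v) * segsum z (seg m v) \<le> 0"
        using *[of v] by (cases "take m v = u") auto
    qed
    moreover have "(norm z)\<^sup>2 \<le> 2\<^sup>2" using z(2) by (intro power_mono) auto
    ultimately show "(norm (x + z))\<^sup>2 \<le> (norm x)\<^sup>2 + 7" using c1 by simp
  qed
qed

lemma oscillation:
  fixes X :: "nat \<Rightarrow> real"
  assumes "bounded (range X)" "\<not> convergent X"
  obtains a b where "a < b" "\<And>N. \<exists>n\<ge>N. X n < a" "\<And>N. \<exists>n\<ge>N. b < X n"
proof -
  obtain l r where r: "strict_mono r" "(X \<circ> r) \<longlonglongrightarrow> l"
    using bounded_imp_convergent_subsequence[OF assms(1)] by blast
  have "\<not> X \<longlonglongrightarrow> l" using assms(2) by (auto simp: convergent_def)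
  then obtain e where e: "0 < e" "\<And>N. \<exists>n\<ge>N. e \<le> \<bar>X n - l\<bar>"
    unfolding LIMSEQ_iff by (auto simp: not_less)
  have near: "\<exists>n\<ge>N. \<bar>X n - l\<bar> < e / 2" for N
  proof -
    obtain M where M: "\<forall>n\<ge>M. norm ((X \<circ> r) n - l) < e / 2"
      using r(2) e(1) unfolding LIMSEQ_iff by (meson half_gt_zero)
    have "N \<le> r (max M N)" using seq_suble[OF r(1), of "max M N"] by linarith
    then show ?thesis using M by (intro exI[of _ "r (max M N)"]) auto
  qed
  have "(\<exists>\<^sub>F n in sequentially. l + e \<le> X n) \<or> (\<exists>\<^sub>F n in sequentially. X n \<le> l - e)"
  proof -
    have "\<exists>\<^sub>F n in sequentially. l + e \<le> X n \<or> X n \<le> l - e"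
      unfolding frequently_sequentially
    proof
      fix N
      obtain n where "n \<ge> N" "e \<le> \<bar>X n - l\<bar>" using e(2) by blast
      then show "\<exists>n\<ge>N. l + e \<le> X n \<or> X n \<le> l - e" by (intro exI[of _ n]) linarith
    qed
    then show ?thesis by (simp add: frequently_disj_iff)
  qed
  then show thesis
  proof
    assume far: "\<exists>\<^sub>F n in sequentially. l + e \<le> X n"
    show thesis
    proof (rule that[of "l + e / 2" "l + 3 * e / 4"])
      show "l + e / 2 < l + 3 * e / 4" using e by simp
      fix N
      obtain n where "n \<ge> N" "\<bar>X n - l\<bar> < e / 2" using near by blast
      then show "\<exists>n\<ge>N. X n < l + e / 2" by (intro exI[of _ n]) linarith
      obtain k where "k \<ge> N" "l + e \<le> X k" using far unfolding frequently_sequentially by blast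
      then show "\<exists>n\<ge>N. l + 3 * e / 4 < X n" using e by (intro exI[of _ k]) linarith
    qed
  next
    assume far: "\<exists>\<^sub>F n in sequentially. X n \<le> l - e"
    show thesis
    proof (rule that[of "l - 3 * e / 4" "l - e / 2"])
      show "l - 3 * e / 4 < l - e / 2" using e by simp
      fix N
      obtain n where "n \<ge> N" "\<bar>X n - l\<bar> < e / 2" using near by blast
      then show "\<exists>n\<ge>N. l - e / 2 < X n" by (intro exI[of _ n]) linarith
      obtain k where "k \<ge> N" "X k \<le> l - e" using far unfolding frequently_sequentially by blast
      then show "\<exists>n\<ge>N. X n < l - 3 * e / 4" using e by (intro exI[of _ k]) linarith
    qed
  qed
qed

lemma abs_at_node_le_norm: "\<bar>blinfun_apply f (unit_at t)\<bar> \<le> norm (f :: jt_fin \<Rightarrow>\<^sub>L real)"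
proof -
  have "\<bar>f (unit_at t)\<bar> \<le> norm f * norm (unit_at t)" using norm_blinfun[of f "unit_at t"] by simp
  also have "\<dots> \<le> norm f * 1" by (intro mult_left_mono norm_unit_at) auto
  finally show ?thesis by simp
qed

text \<open>If the values oscillated, then differences of two unit vectors at nodes of the branch, the later
  one subtracted from the earlier one, would be available with values of either sign bounded away
  from \<open>0\<close>.  Their sums over segments starting at level \<open>m\<close> are \<open>0\<close> or \<open>1\<close>, so one of the two kinds
  can be glued, after multiplication by \<open>s\<close>, to any given vector.\<close>

lemma convergent_along_branch:
  fixes f :: "jt_fin \<Rightarrow>\<^sub>L real"
  shows "convergent (\<lambda>n. f (unit_at (branch_node \<gamma> n)))"
proof (rule ccontr)
  let ?X = "\<lambda>n. f (unit_at (branch_node \<gamma> n))"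
  assume "\<not> convergent ?X"
  moreover have "bounded (range ?X)"
    by (rule boundedI[of _ "norm f"]) (auto simp: abs_at_node_le_norm)
  ultimately obtain a b where ab: "a < b" "\<And>N. \<exists>n\<ge>N. ?X n < a" "\<And>N. \<exists>n\<ge>N. b < ?X n"
    using oscillation[of ?X] by metis
  have "\<exists>z. (norm (x + z))\<^sup>2 \<le> (norm x)\<^sup>2 + 7 \<and> b - a \<le> f z" for x
  proof -
    obtain m where m: "supp_lt m x" using ex_supp_lt by blast
    obtain s where s: "s = 1 \<or> s = -1" and glue: "\<And>z. supp_ge m z \<Longrightarrow> norm z \<le> 2 \<Longrightarrow>
      (\<And>v. m \<le> length v \<Longrightarrow> s * segsum z (seg m v) \<in> {0..1}) \<Longrightarrow>
      (\<And>v. m \<le> length v \<Longrightarrow> take m v \<noteq> branch_node \<gamma> m \<Longrightarrow> segsum z (seg m v) = 0) \<Longrightarrow>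
      (norm (x + z))\<^sup>2 \<le> (norm x)\<^sup>2 + 7"
      using gluing_beyond_node[OF m length_branch_node[of \<gamma> m]] by metis
    have "\<exists>p q. m \<le> p \<and> p < q \<and> b - a \<le> s * (?X p - ?X q)"
      using s
    proof
      assume "s = 1"
      obtain p where p: "p \<ge> m" "b < ?X p" using ab by blast
      obtain q where q: "q \<ge> Suc p" "?X q < a" using ab by blast
      show ?thesis using p q \<open>s = 1\<close> by (intro exI[of _ p] exI[of _ q]) simp
    next
      assume "s = -1"
      obtain p where p: "p \<ge> m" "?X p < a" using ab by blast
      obtain q where q: "q \<ge> Suc p" "b < ?X q" using ab by blast
      show ?thesis using p q \<open>s = -1\<close> by (intro exI[of _ p] exI[of _ q]) simp
    qed
    then obtain p q where pq: "m \<le> p" "p < q" "b - a \<le> s * (?X p - ?X q)" by blast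
    let ?p = "unit_at (branch_node \<gamma> p)" and ?q = "unit_at (branch_node \<gamma> q)"
    define z where "z = s *\<^sub>R (?p - ?q)"
    have sums: "segsum z (seg m v) = s * ((if prefix (branch_node \<gamma> p) v then 1 else 0)
        - (if prefix (branch_node \<gamma> q) v then 1 else 0))" for v
      using pq by (simp add: z_def segsum_scaleR segsum_diff segsum_unit_at_seg)
    have nest: "prefix (branch_node \<gamma> p) v" if "prefix (branch_node \<gamma> q) v" for v
      using that prefix_branch_node[of p q \<gamma>] pq by (auto intro: prefix_order.trans)
    have "(norm (x + z))\<^sup>2 \<le> (norm x)\<^sup>2 + 7"
    proof (rule glue)
      show "supp_ge m z" unfolding z_def using pq
        by (intro supp_ge_scaleR supp_ge_diff supp_ge_unit_at) auto
      have "norm z = norm (?p - ?q)" using s by (auto simp: z_def)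
      also have "\<dots> \<le> norm ?p + norm ?q" by (rule norm_triangle_ineq4)
      also have "\<dots> \<le> 2" using norm_unit_at[of "branch_node \<gamma> p"] norm_unit_at[of "branch_node \<gamma> q"] by simp
      finally show "norm z \<le> 2" .
      show "s * segsum z (seg m v) \<in> {0..1}" for v
        using s nest[of v] by (auto simp: sums)
      show "segsum z (seg m v) = 0" if "m \<le> length v" "take m v \<noteq> branch_node \<gamma> m" for v
      proof -
        have "\<not> prefix (branch_node \<gamma> p) v"
          using that pq prefix_take_eq[of m "branch_node \<gamma> p" v] by (auto simp: take_branch_node)
        then show ?thesis using nest by (auto simp: sums)
      qed
    qed
    moreover have "f z = s * (?X p - ?X q)"
      by (simp add: z_def blinfun.scaleR_right blinfun.diff_right)
    ultimately show ?thesis using pq by auto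
  qed
  then show False using gluing_unbounded[of "b - a" 7 f] ab(1) by auto
qed

text \<open>Koenig's lemma for the binary tree.\<close>

lemma infinite_branch:
  fixes A :: "node set"
  assumes "infinite A"
  shows "\<exists>\<gamma>. \<forall>n. infinite {a \<in> A. prefix (branch_node \<gamma> n) a}"
proof -
  define P where "P t \<longleftrightarrow> infinite {a \<in> A. prefix t a}" for t
  have step: "\<exists>b. P (t @ [b])" if "P t" for t
  proof (rule ccontr)
    assume "\<nexists>b. P (t @ [b])"
    then have "finite {a \<in> A. prefix (t @ [True]) a}" "finite {a \<in> A. prefix (t @ [False]) a}"
      by (auto simp: P_def)
    then have "finite ({t} \<union> {a \<in> A. prefix (t @ [True]) a} \<union> {a \<in> A. prefix (t @ [False]) a})"
      by simp
    moreover have "{a \<in> A. prefix t a} \<subseteq>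
        {t} \<union> {a \<in> A. prefix (t @ [True]) a} \<union> {a \<in> A. prefix (t @ [False]) a}"
    proof
      fix a assume a: "a \<in> {a \<in> A. prefix t a}"
      then obtain s where s: "a = t @ s" by (auto simp: prefix_def)
      show "a \<in> {t} \<union> {a \<in> A. prefix (t @ [True]) a} \<union> {a \<in> A. prefix (t @ [False]) a}"
      proof (cases s)
        case (Cons b s')
        then show ?thesis using a s by (cases b) auto
      qed (use s in simp)
    qed
    ultimately have "finite {a \<in> A. prefix t a}" by (rule rev_finite_subset)
    then show False using that by (simp add: P_def)
  qed
  define g where "g = rec_nat [] (\<lambda>_ t. t @ [SOME b. P (t @ [b])])"
  define \<gamma> where "\<gamma> n = (SOME b. P (g n @ [b]))" for n
  have g0: "g 0 = []" and gS: "g (Suc n) = g n @ [\<gamma> n]" for n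
    by (simp_all add: g_def \<gamma>_def)
  have "P (g n)" for n
  proof (induction n)
    case 0
    show ?case using assms by (simp add: g0 P_def)
  next
    case (Suc n)
    show ?case unfolding gS \<gamma>_def using step[OF Suc] by (rule someI_ex)
  qed
  moreover have "g n = branch_node \<gamma> n" for n
    by (induction n) (simp_all add: g0 gS branch_node_def)
  ultimately show ?thesis by (intro exI[of _ \<gamma>]) (simp add: P_def)
qed

text \<open>Suppose that \<open>\<bar>f\<bar>\<close> is at least \<open>\<theta>\<close> at nodes \<open>t\<close> of arbitrarily high level.  If the path to such
  a \<open>t\<close> can always be chosen to pass through a node with a small value, then subtracting the unit
  vector at that node adjusts the sign without losing much of \<open>f (unit_at t)\<close>, and gluing applies.
  Otherwise all paths to such nodes consist, from some level on, of nodes with large values, and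
  Koenig's lemma produces a branch on which \<open>f\<close> does not tend to \<open>0\<close>.\<close>

lemma uniformly_small_at_nodes:
  fixes f :: "jt_fin \<Rightarrow>\<^sub>L real"
  assumes null: "\<And>\<gamma>. (\<lambda>n. f (unit_at (branch_node \<gamma> n))) \<longlonglongrightarrow> 0" and \<theta>: "0 < \<theta>"
  shows "\<exists>n. \<forall>t. n \<le> length t \<longrightarrow> \<bar>f (unit_at t)\<bar> < \<theta>"
proof (rule ccontr)
  assume "\<not> ?thesis"
  then have big: "\<exists>t. n \<le> length t \<and> \<theta> \<le> \<bar>f (unit_at t)\<bar>" for n
    by (auto simp: not_less)
  show False
  proof (cases "\<forall>m. \<exists>t p. m \<le> p \<and> p < length t \<and> \<theta> \<le> \<bar>f (unit_at t)\<bar> \<and> \<bar>f (unit_at (take p t))\<bar> \<le> \<theta> / 2")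
    case True
    have "\<exists>z. (norm (x + z))\<^sup>2 \<le> (norm x)\<^sup>2 + 7 \<and> \<theta> / 2 \<le> f z" for x
    proof -
      obtain m where m: "supp_lt m x" using ex_supp_lt by blast
      obtain t p where p: "m \<le> p" "p < length t" and t: "\<theta> \<le> \<bar>f (unit_at t)\<bar>"
        and tp: "\<bar>f (unit_at (take p t))\<bar> \<le> \<theta> / 2" using True by blast
      have "length (take m t) = m" using p by simp
      then obtain s where s: "s = 1 \<or> s = -1" and glue: "\<And>z. supp_ge m z \<Longrightarrow> norm z \<le> 2 \<Longrightarrow>
        (\<And>v. m \<le> length v \<Longrightarrow> s * segsum z (seg m v) \<in> {0..1}) \<Longrightarrow>
        (\<And>v. m \<le> length v \<Longrightarrow> take m v \<noteq> take m t \<Longrightarrow> segsum z (seg m v) = 0) \<Longrightarrow>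
        (norm (x + z))\<^sup>2 \<le> (norm x)\<^sup>2 + 7"
        using gluing_beyond_node[OF m] by metis
      let ?P = "\<lambda>t v. if prefix t v then 1 else 0 :: real"
      have nest: "prefix (take p t) v" if "prefix t v" for v
        using that take_is_prefix prefix_order.trans by blast
      have off: "\<not> prefix (take p t) v" if "take m v \<noteq> take m t" for v
        using that p prefix_take_eq[of m "take p t" v] by (auto simp: min_def)
      have nu: "norm (unit_at t) \<le> 1" "norm (unit_at (take p t)) \<le> 1" by (rule norm_unit_at)+
      have supp: "supp_ge m (unit_at t)" "supp_ge m (unit_at (take p t))"
        using p by (auto intro!: supp_ge_unit_at)
      have sums: "segsum (unit_at t) (seg m v) = ?P t v"
        "segsum (unit_at (take p t)) (seg m v) = ?P (take p t) v" for v
        using p by (auto simp: segsum_unit_at_seg)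
      show ?thesis
      proof (cases "0 \<le> s * f (unit_at t)")
        case True
        define z where "z = s *\<^sub>R unit_at t"
        have "(norm (x + z))\<^sup>2 \<le> (norm x)\<^sup>2 + 7"
          using s nu supp off nest
          by (intro glue) (auto simp: z_def segsum_scaleR sums supp_ge_scaleR)
        moreover have "\<theta> / 2 \<le> f z"
          using s t True \<theta> by (auto simp: z_def blinfun.scaleR_right)
        ultimately show ?thesis by blast
      next
        case False
        define z where "z = s *\<^sub>R (unit_at (take p t) - unit_at t)"
        have "norm (unit_at (take p t) - unit_at t) \<le> 2"
          using norm_triangle_ineq4[of "unit_at (take p t)" "unit_at t"] nu by simp
        then have "norm z \<le> 2" using s by (auto simp: z_def)
        then have "(norm (x + z))\<^sup>2 \<le> (norm x)\<^sup>2 + 7"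
          using s supp off nest
          by (intro glue) (auto simp: z_def segsum_scaleR segsum_diff sums supp_ge_scaleR supp_ge_diff)
        moreover have "\<theta> / 2 \<le> f z"
          using s t tp False \<theta> by (auto simp: z_def blinfun.scaleR_right blinfun.diff_right)
        ultimately show ?thesis by blast
      qed
    qed
    then show False using gluing_unbounded[of "\<theta> / 2" 7 f] \<theta> by auto
  next
    case False
    then obtain m where m: "\<And>t p. m \<le> p \<Longrightarrow> p < length t \<Longrightarrow> \<theta> \<le> \<bar>f (unit_at t)\<bar> \<Longrightarrow>
        \<theta> / 2 < \<bar>f (unit_at (take p t))\<bar>"
      by (meson not_le)
    define A where "A = {t. \<theta> \<le> \<bar>f (unit_at t)\<bar>}"
    have "infinite A"
    proof
      assume "finite A"
      obtain t where t: "Suc (Max (length ` A)) \<le> length t" "t \<in> A"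
        using big by (auto simp: A_def)
      then have "length t \<le> Max (length ` A)" using \<open>finite A\<close> by simp
      then show False using t by simp
    qed
    then obtain \<gamma> where \<gamma>: "\<forall>n. infinite {a \<in> A. prefix (branch_node \<gamma> n) a}"
      using infinite_branch by blast
    have "\<theta> / 2 \<le> \<bar>f (unit_at (branch_node \<gamma> n))\<bar>" if "m \<le> n" for n
    proof -
      have "{a \<in> A. prefix (branch_node \<gamma> n) a} \<noteq> {branch_node \<gamma> n}"
        "{a \<in> A. prefix (branch_node \<gamma> n) a} \<noteq> {}" using \<gamma> by (metis finite.simps)+
      then obtain a where a: "a \<in> A" "prefix (branch_node \<gamma> n) a" "a \<noteq> branch_node \<gamma> n" by blast
      then have "n < length a" using prefix_length_less[of "branch_node \<gamma> n" a] by (auto simp: strict_prefix_def)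
      moreover have "take n a = branch_node \<gamma> n" using a(2) by (auto simp: prefix_def)
      ultimately show ?thesis using m[OF that, of a] a(1) by (auto simp: A_def)
    qed
    then have "\<theta> / 2 \<le> \<bar>0\<bar>"
      by (intro LIMSEQ_le_const[OF tendsto_rabs[OF null[of \<gamma>]]]) auto
    then show False using \<theta> by simp
  qed
qed

lemma blinfun_spread:
  "blinfun_apply f (spread m w) = (\<Sum>u\<in>level m. w u * blinfun_apply f (unit_at u))"
  for f :: "jt_fin \<Rightarrow>\<^sub>L real"
  by (simp add: spread_def blinfun.sum_right blinfun.scaleR_right)

text \<open>Any \<open>z\<close> can be given the signs required for gluing by adding a vector on the interface level
  that dominates its segment sums.\<close>

lemma gluing_corrected:
  assumes x: "supp_lt m x" and z: "supp_ge m z" and c: "\<And>u. 0 \<le> c u"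
    and zc: "\<And>v. m \<le> length v \<Longrightarrow> \<bar>segsum z (seg m v)\<bar> \<le> c (take m v)"
  obtains w where "\<And>u. \<bar>w u\<bar> = c u"
    "(norm (x + (z + spread m w)))\<^sup>2 \<le> (norm x)\<^sup>2 + (norm (z + spread m w))\<^sup>2 + 12 * (\<Sum>u\<in>level m. (c u)\<^sup>2)"
proof -
  obtain \<sigma> :: "node \<Rightarrow> real" where \<sigma>: "\<And>u. \<sigma> u = 1 \<or> \<sigma> u = -1"
    and glue: "\<And>z. supp_ge m z \<Longrightarrow>
      (\<And>v. m \<le> length v \<Longrightarrow> - (2 * c (take m v)) \<le> \<sigma> (take m v) * segsum z (seg m v) \<and>
                           \<sigma> (take m v) * segsum z (seg m v) \<le> 0) \<Longrightarrow>
      (norm (x + z))\<^sup>2 \<le> (norm x)\<^sup>2 + (norm z)\<^sup>2 + 3 * (\<Sum>u\<in>level m. (2 * c u)\<^sup>2)"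
    by (rule gluing[OF x, of "\<lambda>u. 2 * c u"]) (use c in auto)
  define w where "w u = - \<sigma> u * c u" for u
  have "(norm (x + (z + spread m w)))\<^sup>2 \<le> (norm x)\<^sup>2 + (norm (z + spread m w))\<^sup>2 + 3 * (\<Sum>u\<in>level m. (2 * c u)\<^sup>2)"
  proof (rule glue)
    show "supp_ge m (z + spread m w)" by (intro supp_ge_add z supp_ge_spread)
    fix v :: node assume v: "m \<le> length v"
    let ?u = "take m v"
    have "segsum (z + spread m w) (seg m v) = segsum z (seg m v) - \<sigma> ?u * c ?u"
      using v by (simp add: segsum_add segsum_spread w_def)
    then show "- (2 * c ?u) \<le> \<sigma> ?u * segsum (z + spread m w) (seg m v) \<and>
        \<sigma> ?u * segsum (z + spread m w) (seg m v) \<le> 0"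
      using \<sigma>[of ?u] zc[OF v] by (auto simp: abs_le_iff)
  qed
  moreover have "\<bar>w u\<bar> = c u" for u using \<sigma>[of u] c[of u] by (auto simp: w_def)
  ultimately show thesis by (intro that[of w]) (auto simp: power_mult_distrib sum_distrib_left)
qed

text \<open>The vector on level \<open>n\<close> that norms the restriction of \<open>f\<close> to this level has uniformly small
  entries, so for a fixed interface level \<open>m\<close> and large \<open>n\<close> the correction is negligible in spite of
  the number of nodes on level \<open>m\<close>.\<close>

lemma level_sums_vanish:
  fixes f :: "jt_fin \<Rightarrow>\<^sub>L real"
  assumes null: "\<And>\<gamma>. (\<lambda>n. f (unit_at (branch_node \<gamma> n))) \<longlonglongrightarrow> 0"
  shows "(\<lambda>n. \<Sum>u\<in>level n. (f (unit_at u))\<^sup>2) \<longlonglongrightarrow> 0"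
proof (rule ccontr)
  define A where "A n = (\<Sum>u\<in>level n. (f (unit_at u))\<^sup>2)" for n
  have A0: "0 \<le> A n" for n by (auto simp: A_def intro: sum_nonneg)
  assume "\<not> (\<lambda>n. \<Sum>u\<in>level n. (f (unit_at u))\<^sup>2) \<longlonglongrightarrow> 0"
  then have "\<not> A \<longlonglongrightarrow> 0" by (simp add: A_def[abs_def])
  then obtain e where e: "0 < e" "\<And>N. \<exists>n\<ge>N. e \<le> A n"
    unfolding LIMSEQ_iff using A0 by (auto simp: not_less)
  define r where "r = sqrt e"
  have r: "0 < r" using e by (simp add: r_def)
  have "\<exists>z. (norm (x + z))\<^sup>2 \<le> (norm x)\<^sup>2 + 16 \<and> r / 2 \<le> f z" for x
  proof -
    obtain m where m: "supp_lt m x" using ex_supp_lt by blast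
    define N where "N = real (card (level m))"
    have "replicate m True \<in> level m" by (simp add: level_def)
    then have "0 < card (level m)" by (auto simp: card_gt_0_iff)
    then have N: "1 \<le> N" by (simp add: N_def)
    \<comment> \<open>The correction has \<open>N\<close> entries of size \<open>c\<close>; this \<open>c\<close> makes both its norm and its value
      under \<open>f\<close> small.\<close>
    define c where "c = min (1 / N) (r / (2 * N * (norm f + 1)))"
    have c: "0 < c" "N * c \<le> 1"
      using N r by (auto simp: c_def field_simps min_def add_pos_nonneg)
    have "c * (2 * N * (norm f + 1)) \<le> r"
      using N by (subst pos_le_divide_eq[symmetric]) (auto simp: c_def add_nonneg_pos)
    moreover have "0 \<le> N * c" using N c by simp
    ultimately have cf: "N * c * norm f \<le> r / 2" by (simp add: algebra_simps)
    have c1: "c \<le> 1" using mult_right_mono[of 1 N c] N c by linarith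
    obtain n0 where n0: "\<And>t. n0 \<le> length t \<Longrightarrow> \<bar>f (unit_at t)\<bar> < c * r"
      using uniformly_small_at_nodes[OF null, of "c * r"] c r by auto
    obtain n where n: "max n0 m \<le> n" "e \<le> A n" using e by blast
    define q where "q = sqrt (A n)"
    have q: "r \<le> q" "q\<^sup>2 = A n" using n A0 by (auto simp: q_def r_def)
    have q0: "0 < q" using q r by simp
    define z where "z = spread n (\<lambda>u. f (unit_at u) / q)"
    have "(norm z)\<^sup>2 \<le> (\<Sum>u\<in>level n. (f (unit_at u) / q)\<^sup>2)" unfolding z_def by (rule norm_spread)
    also have "\<dots> = A n / q\<^sup>2" by (simp add: A_def power_divide sum_divide_distrib)
    also have "\<dots> = 1" unfolding q(2)[symmetric] using q0 by simp
    finally have z1: "norm z \<le> 1" by (simp add: abs_square_le_1)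
    have "f z = A n / q" by (simp add: z_def blinfun_spread A_def sum_divide_distrib power2_eq_square)
    also have "\<dots> = q" unfolding q(2)[symmetric] by (simp add: power2_eq_square)
    finally have fz: "f z = q" .
    have "supp_ge n z" unfolding z_def by (rule supp_ge_spread)
    then have zm: "supp_ge m z" by (rule supp_ge_mono) (use n in simp)
    obtain w where w: "\<And>u. \<bar>w u\<bar> = c" and glue: "(norm (x + (z + spread m w)))\<^sup>2
        \<le> (norm x)\<^sup>2 + (norm (z + spread m w))\<^sup>2 + 12 * (\<Sum>u\<in>level m. c\<^sup>2)"
    proof (rule gluing_corrected[OF m zm, of "\<lambda>_. c"])
      fix v :: node assume "m \<le> length v"
      have "\<bar>f (unit_at (take n v)) / q\<bar> \<le> c" if "n \<le> length v"
      proof -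
        have "\<bar>f (unit_at (take n v))\<bar> \<le> c * r" using n0[of "take n v"] n that by simp
        also have "\<dots> \<le> c * q" using q c by simp
        finally show ?thesis using q0 by (simp add: field_simps)
      qed
      then show "\<bar>segsum z (seg m v)\<bar> \<le> c" using n c by (simp add: z_def segsum_spread)
    qed (use c in auto)
    have "norm (spread m w) \<le> (\<Sum>u\<in>level m. norm (w u *\<^sub>R unit_at u))"
      unfolding spread_def by (rule norm_sum)
    also have "\<dots> \<le> (\<Sum>u\<in>level m. c)"
      using w norm_unit_at c by (intro sum_mono) (simp add: mult_left_le)
    also have "\<dots> \<le> 1" using c by (simp add: N_def)
    finally have "norm (z + spread m w) \<le> 2" using z1 norm_triangle_ineq[of z "spread m w"] by linarith
    then have "(norm (z + spread m w))\<^sup>2 \<le> 2\<^sup>2" by (intro power_mono) auto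
    moreover have "(\<Sum>u\<in>level m. c\<^sup>2) \<le> 1"
    proof -
      have "(\<Sum>u\<in>level m. c\<^sup>2) = (N * c) * c" by (simp add: N_def power2_eq_square)
      also have "\<dots> \<le> 1 * 1" using c c1 by (intro mult_mono) auto
      finally show ?thesis by simp
    qed
    ultimately have "(norm (x + (z + spread m w)))\<^sup>2 \<le> (norm x)\<^sup>2 + 16" using glue by simp
    moreover have "r / 2 \<le> f (z + spread m w)"
    proof -
      have "\<bar>f (spread m w)\<bar> \<le> (\<Sum>u\<in>level m. \<bar>w u * f (unit_at u)\<bar>)"
        unfolding blinfun_spread by (rule sum_abs)
      also have "\<dots> \<le> (\<Sum>u\<in>level m. c * norm f)"
        unfolding abs_mult w using c abs_at_node_le_norm by (intro sum_mono mult_left_mono) auto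
      also have "\<dots> = N * c * norm f" by (simp add: N_def)
      finally show ?thesis using cf fz q by (simp add: blinfun.add_right)
    qed
    ultimately show ?thesis by blast
  qed
  then show False using gluing_unbounded[of "r / 2" 16 f] r by auto
qed

text \<open>By the preceding lemma \<open>f\<close> is small on every correction, which is a vector on a single level
  with \<open>\<ell>\<^sub>2\<close>-norm at most \<open>1\<close>.  Hence corrections can be added to vectors on which \<open>f\<close> is large.\<close>

lemma vanishing_tails:
  fixes f :: "jt_fin \<Rightarrow>\<^sub>L real"
  assumes null: "\<And>\<gamma>. (\<lambda>n. f (unit_at (branch_node \<gamma> n))) \<longlonglongrightarrow> 0" and \<eta>: "0 < \<eta>"
  shows "\<exists>m. \<forall>z. supp_ge m z \<longrightarrow> \<bar>f z\<bar> \<le> \<eta> * norm z"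
proof (rule ccontr)
  assume "\<not> ?thesis"
  then have big: "\<exists>z. supp_ge m z \<and> \<eta> * norm z < \<bar>f z\<bar>" for m by (auto simp: not_le)
  define A where "A n = (\<Sum>u\<in>level n. (f (unit_at u))\<^sup>2)" for n
  have A0: "0 \<le> A n" for n by (auto simp: A_def intro: sum_nonneg)
  have "A \<longlonglongrightarrow> 0" unfolding A_def by (rule level_sums_vanish[OF null])
  moreover have "0 < (\<eta> / 2)\<^sup>2" using \<eta> by simp
  ultimately obtain m1 where m1: "\<And>n. m1 \<le> n \<Longrightarrow> A n < (\<eta> / 2)\<^sup>2"
    unfolding LIMSEQ_iff using A0 by (metis abs_of_nonneg diff_zero real_norm_def)
  have "\<exists>z. (norm (x + z))\<^sup>2 \<le> (norm x)\<^sup>2 + 16 \<and> \<eta> / 2 \<le> f z" for x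
  proof -
    obtain m0 where m0: "supp_lt m0 x" using ex_supp_lt by blast
    define m where "m = max m0 m1"
    have x: "supp_lt m x" using m0 by (rule supp_lt_mono) (simp add: m_def)
    obtain z0 where z0: "supp_ge m z0" "\<eta> * norm z0 < \<bar>f z0\<bar>" using big by blast
    then have nz: "0 < norm z0" by (auto simp: blinfun.zero_right)
    define z where "z = (sgn (f z0) / norm z0) *\<^sub>R z0"
    have zm: "supp_ge m z" unfolding z_def by (intro supp_ge_scaleR z0)
    have "0 < \<eta> * norm z0" using \<eta> nz by (rule mult_pos_pos)
    then have "f z0 \<noteq> 0" using z0(2) by auto
    then have z1: "norm z = 1" using nz by (simp add: z_def abs_sgn_eq)
    have "f z = \<bar>f z0\<bar> / norm z0" by (simp add: z_def blinfun.scaleR_right abs_sgn mult.commute)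
    moreover have "\<eta> < \<bar>f z0\<bar> / norm z0" using z0(2) nz by (simp add: pos_less_divide_eq)
    ultimately have fz: "\<eta> \<le> f z" by linarith
    obtain c where c: "\<And>u. 0 \<le> c u" "\<And>v. m \<le> length v \<Longrightarrow> \<bar>segsum z (seg m v)\<bar> \<le> c (take m v)"
      "(\<Sum>u\<in>level m. (c u)\<^sup>2) \<le> (norm z)\<^sup>2" using segsum_bounds[of m z] by metis
    obtain w where w: "\<And>u. \<bar>w u\<bar> = c u" and glue: "(norm (x + (z + spread m w)))\<^sup>2
        \<le> (norm x)\<^sup>2 + (norm (z + spread m w))\<^sup>2 + 12 * (\<Sum>u\<in>level m. (c u)\<^sup>2)"
      using gluing_corrected[OF x zm c(1,2)] by metis
    have w2: "(\<Sum>u\<in>level m. (w u)\<^sup>2) \<le> 1"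
    proof -
      have "(w u)\<^sup>2 = (c u)\<^sup>2" for u by (metis power2_abs w)
      then show ?thesis using c(3) z1 by simp
    qed
    then have "(norm (spread m w))\<^sup>2 \<le> 1" using norm_spread[of m w] by linarith
    then have "norm (spread m w) \<le> 1" by (simp add: abs_square_le_1)
    then have "norm (z + spread m w) \<le> 2" using z1 norm_triangle_ineq[of z "spread m w"] by linarith
    then have "(norm (z + spread m w))\<^sup>2 \<le> 2\<^sup>2" by (intro power_mono) auto
    then have "(norm (x + (z + spread m w)))\<^sup>2 \<le> (norm x)\<^sup>2 + 16" using glue c(3) z1 by simp
    moreover have "\<eta> / 2 \<le> f (z + spread m w)"
    proof -
      have "(f (spread m w))\<^sup>2 \<le> (\<Sum>u\<in>level m. (w u)\<^sup>2) * A m"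
        unfolding blinfun_spread A_def by (rule Cauchy_Schwarz_ineq_sum)
      also have "\<dots> \<le> 1 * A m" using w2 A0 by (intro mult_right_mono)
      also have "\<dots> \<le> (\<eta> / 2)\<^sup>2" using m1[of m] by (simp add: m_def)
      finally have "\<bar>f (spread m w)\<bar> \<le> \<eta> / 2" using \<eta> by (simp add: power2_le_iff_abs_le)
      then show ?thesis using fz by (simp add: blinfun.add_right)
    qed
    ultimately show ?thesis by blast
  qed
  then show False using gluing_unbounded[of "\<eta> / 2" 16 f] \<eta> by auto
qed


section \<open>The structure of the dual\<close>

definition branch_limit :: "(nat \<Rightarrow> bool) \<Rightarrow> (jt_fin \<Rightarrow>\<^sub>L real) \<Rightarrow>\<^sub>L real" where
  "branch_limit \<gamma> = Blinfun (\<lambda>f. lim (\<lambda>n. blinfun_apply f (unit_at (branch_node \<gamma> n))))"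

lemma branch_limit_tendsto:
  "(\<lambda>n. blinfun_apply f (unit_at (branch_node \<gamma> n))) \<longlonglongrightarrow> blinfun_apply (branch_limit \<gamma>) f"
proof -
  let ?L = "\<lambda>f :: jt_fin \<Rightarrow>\<^sub>L real. lim (\<lambda>n. f (unit_at (branch_node \<gamma> n)))"
  have lim: "(\<lambda>n. f (unit_at (branch_node \<gamma> n))) \<longlonglongrightarrow> ?L f" for f :: "jt_fin \<Rightarrow>\<^sub>L real"
    using convergent_along_branch[of f \<gamma>] by (simp add: convergent_LIMSEQ_iff)
  have "bounded_linear ?L"
  proof (rule bounded_linear_intro[where K = 1])
    fix f g :: "jt_fin \<Rightarrow>\<^sub>L real" and r :: real
    show "?L (f + g) = ?L f + ?L g"
      using tendsto_add[OF lim[of f] lim[of g]] by (intro limI) (simp add: blinfun.add_left)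
    show "?L (r *\<^sub>R f) = r *\<^sub>R ?L f"
      using tendsto_mult[OF tendsto_const[of r] lim[of f]] by (intro limI) (simp add: blinfun.scaleR_left)
    have "\<bar>?L f\<bar> \<le> norm f"
      by (rule LIMSEQ_le_const2[OF tendsto_rabs[OF lim]]) (auto simp: abs_at_node_le_norm)
    then show "norm (?L f) \<le> norm f * 1" by simp
  qed
  then show ?thesis using lim[of f] by (simp add: branch_limit_def bounded_linear_Blinfun_apply)
qed

lemma branch_limit_eqI:
  "(\<lambda>n. blinfun_apply f (unit_at (branch_node \<gamma> n))) \<longlonglongrightarrow> l \<Longrightarrow> blinfun_apply (branch_limit \<gamma>) f = l"
  using branch_limit_tendsto LIMSEQ_unique by blast

lemma level_sum_le_norm:
  fixes f :: "jt_fin \<Rightarrow>\<^sub>L real"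
  shows "(\<Sum>u\<in>level n. (f (unit_at u))\<^sup>2) \<le> (norm f)\<^sup>2"
proof -
  define A where "A = (\<Sum>u\<in>level n. (f (unit_at u))\<^sup>2)"
  define z where "z = spread n (\<lambda>u. f (unit_at u))"
  have A0: "0 \<le> A" by (auto simp: A_def intro: sum_nonneg)
  have "f z = A" by (simp add: z_def A_def blinfun_spread power2_eq_square)
  then have "A \<le> norm f * norm z" using norm_blinfun[of f z] by simp
  then have "A\<^sup>2 \<le> (norm f * norm z)\<^sup>2" using A0 by (intro power_mono)
  also have "\<dots> = (norm f)\<^sup>2 * (norm z)\<^sup>2" by (rule power_mult_distrib)
  also have "\<dots> \<le> (norm f)\<^sup>2 * A"
    unfolding z_def A_def by (intro mult_left_mono norm_spread) auto
  finally have "A * A \<le> (norm f)\<^sup>2 * A" by (simp add: power2_eq_square)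
  then have "A \<le> (norm f)\<^sup>2"
    using A0 by (cases "A = 0") (auto simp: mult_le_cancel_right)
  then show ?thesis by (simp add: A_def)
qed

lemma branches_separate:
  assumes "finite F"
  shows "\<forall>\<^sub>F n in sequentially. inj_on (\<lambda>\<gamma>. branch_node \<gamma> n) F"
proof -
  have "\<forall>\<^sub>F n in sequentially. \<gamma> \<noteq> \<delta> \<longrightarrow> branch_node \<gamma> n \<noteq> branch_node \<delta> n" for \<gamma> \<delta>
  proof (cases "\<gamma> = \<delta>")
    case False
    then obtain k where k: "\<gamma> k \<noteq> \<delta> k" by blast
    have "branch_node \<gamma> n \<noteq> branch_node \<delta> n" if "Suc k \<le> n" for n
    proof
      assume "branch_node \<gamma> n = branch_node \<delta> n"
      then have "branch_node \<gamma> n ! k = branch_node \<delta> n ! k" by simp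
      then show False using k that by (simp add: branch_node_def)
    qed
    then show ?thesis unfolding eventually_sequentially by blast
  qed simp
  then have "\<forall>\<^sub>F n in sequentially. \<forall>\<gamma>\<in>F. \<forall>\<delta>\<in>F. \<gamma> \<noteq> \<delta> \<longrightarrow> branch_node \<gamma> n \<noteq> branch_node \<delta> n"
    using assms by (simp add: eventually_ball_finite)
  then show ?thesis by eventually_elim (auto simp: inj_on_def)
qed

text \<open>A Bessel inequality: unit vectors at different nodes of one level behave like an orthonormal
  system, and finitely many branches pass through different nodes of each high level.\<close>

lemma branch_limits_square_sum:
  fixes f :: "jt_fin \<Rightarrow>\<^sub>L real"
  assumes F: "finite F"
  shows "(\<Sum>\<gamma>\<in>F. (branch_limit \<gamma> f)\<^sup>2) \<le> (norm f)\<^sup>2"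
proof (rule tendsto_upperbound)
  show "(\<lambda>n. \<Sum>\<gamma>\<in>F. (f (unit_at (branch_node \<gamma> n)))\<^sup>2) \<longlonglongrightarrow> (\<Sum>\<gamma>\<in>F. (branch_limit \<gamma> f)\<^sup>2)"
    by (intro tendsto_sum tendsto_power branch_limit_tendsto)
  show "\<forall>\<^sub>F n in sequentially. (\<Sum>\<gamma>\<in>F. (f (unit_at (branch_node \<gamma> n)))\<^sup>2) \<le> (norm f)\<^sup>2"
    using branches_separate[OF F]
  proof eventually_elim
    case (elim n)
    have "(\<Sum>\<gamma>\<in>F. (f (unit_at (branch_node \<gamma> n)))\<^sup>2) = (\<Sum>u\<in>(\<lambda>\<gamma>. branch_node \<gamma> n) ` F. (f (unit_at u))\<^sup>2)"
      by (simp add: sum.reindex[OF elim])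
    also have "\<dots> \<le> (\<Sum>u\<in>level n. (f (unit_at u))\<^sup>2)"
      by (rule sum_mono2[OF finite_level]) (auto simp: level_def)
    also have "\<dots> \<le> (norm f)\<^sup>2" by (rule level_sum_le_norm)
    finally show ?case .
  qed
qed simp

text \<open>Restricting the sum to the support of \<open>x\<close> makes it finite without choosing an end of the
  branch.\<close>

definition branch_sum :: "(nat \<Rightarrow> bool) \<Rightarrow> nat \<Rightarrow> jt_fin \<Rightarrow>\<^sub>L real" where
  "branch_sum \<gamma> m = Blinfun (\<lambda>x. \<Sum>t | Rep_jt_fin x t \<noteq> 0 \<and> m \<le> length t \<and>
     t = branch_node \<gamma> (length t). Rep_jt_fin x t)"

lemma mem_seg_branch_node:
  "t \<in> seg m (branch_node \<gamma> n) \<longleftrightarrow> m \<le> length t \<and> length t \<le> n \<and> t = branch_node \<gamma> (length t)"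
proof -
  have "t = branch_node \<gamma> (length t)" if "prefix t (branch_node \<gamma> n)"
  proof -
    have "t = take (length t) (branch_node \<gamma> n)" using that by (auto simp: prefix_def)
    then show ?thesis using prefix_length_le[OF that] by (simp add: take_branch_node)
  qed
  then show ?thesis
    unfolding mem_seg_iff by (metis length_branch_node prefix_branch_node prefix_length_le)
qed

lemma raw_branch_sum:
  assumes "supp_lt N x" "N \<le> Suc n"
  shows "(\<Sum>t | Rep_jt_fin x t \<noteq> 0 \<and> m \<le> length t \<and> t = branch_node \<gamma> (length t). Rep_jt_fin x t)
    = segsum x (seg m (branch_node \<gamma> n))"
  unfolding segsum_def
proof (rule sum.mono_neutral_left)
  show "{t. Rep_jt_fin x t \<noteq> 0 \<and> m \<le> length t \<and> t = branch_node \<gamma> (length t)} \<subseteq> seg m (branch_node \<gamma> n)"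
  proof safe
    fix t assume t: "Rep_jt_fin x t \<noteq> 0" "m \<le> length t" "t = branch_node \<gamma> (length t)"
    then have "length t \<le> n" using assms unfolding supp_lt_def by (meson not_less_eq_eq order.trans)
    then show "t \<in> seg m (branch_node \<gamma> n)" unfolding mem_seg_branch_node using t by simp
  qed
qed (auto simp: mem_seg_branch_node)

lemma segments_of_branches:
  assumes inj: "inj_on (\<lambda>\<gamma>. branch_node \<gamma> m) F" and F: "finite F" and n: "m \<le> n"
  shows "(\<Sum>\<gamma>\<in>F. (segsum x (seg m (branch_node \<gamma> n)))\<^sup>2) \<le> (norm x)\<^sup>2"
proof -
  let ?S = "\<lambda>\<gamma>. seg m (branch_node \<gamma> n)"
  have disj: "?S \<gamma> \<inter> ?S \<delta> = {}" if "\<gamma> \<in> F" "\<delta> \<in> F" "\<gamma> \<noteq> \<delta>" for \<gamma> \<delta>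
  proof -
    have "branch_node \<gamma> m \<noteq> branch_node \<delta> m" using inj that by (auto dest: inj_onD)
    moreover have "take m t = branch_node \<gamma> m" if "t \<in> ?S \<gamma>" for t \<gamma>
      using that unfolding mem_seg_branch_node by (metis take_branch_node)
    ultimately show ?thesis by (metis disjoint_iff)
  qed
  have seg: "is_segment (?S \<gamma>)" for \<gamma> using n by (intro is_segment_seg) simp
  have injS: "inj_on ?S F"
  proof (rule inj_onI, rule ccontr)
    fix \<gamma> \<delta> assume "\<gamma> \<in> F" "\<delta> \<in> F" "?S \<gamma> = ?S \<delta>" "\<gamma> \<noteq> \<delta>"
    then show False using disj[of \<gamma> \<delta>] is_segment_nonempty[OF seg[of \<gamma>]] by simp
  qed
  have "(\<Sum>\<gamma>\<in>F. (segsum x (?S \<gamma>))\<^sup>2) = (\<Sum>S\<in>?S ` F. (segsum x S)\<^sup>2)"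
    by (simp add: sum.reindex[OF injS])
  also have "\<dots> \<le> (norm x)\<^sup>2"
  proof (rule segment_family_le_norm)
    have "disjoint (?S ` F)"
    proof (rule disjointI)
      fix A B assume "A \<in> ?S ` F" "B \<in> ?S ` F" "A \<noteq> B"
      then show "A \<inter> B = {}" using disj by auto
    qed
    then show "segment_family (?S ` F)" using F seg by (auto simp: segment_family_def)
  qed
  finally show ?thesis .
qed

lemma branch_sum_segsum:
  assumes "supp_lt N x" "N \<le> Suc n"
  shows "blinfun_apply (branch_sum \<gamma> m) x = segsum x (seg m (branch_node \<gamma> n))"
proof -
  let ?R = "\<lambda>x. \<Sum>t | Rep_jt_fin x t \<noteq> 0 \<and> m \<le> length t \<and> t = branch_node \<gamma> (length t). Rep_jt_fin x t"
  have "bounded_linear ?R"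
  proof (rule bounded_linear_intro[where K = 1])
    fix x y :: jt_fin and r :: real
    obtain N N' where N: "supp_lt N x" "supp_lt N' y" using ex_supp_lt by blast
    define n where "n = max m (max N N')"
    have xy: "supp_lt (max N N') x" "supp_lt (max N N') y"
      using N by (auto elim!: supp_lt_mono)
    then have *: "supp_lt (max N N') (x + y)" "supp_lt (max N N') (r *\<^sub>R x)"
      by (auto simp: supp_lt_def plus_jt_fin.rep_eq scaleR_jt_fin.rep_eq)
    have n: "max N N' \<le> Suc n" unfolding n_def by (rule le_SucI[OF max.cobounded2])
    show "?R (x + y) = ?R x + ?R y"
      unfolding raw_branch_sum[OF xy(1) n] raw_branch_sum[OF xy(2) n] raw_branch_sum[OF *(1) n]
      by (rule segsum_add)
    show "?R (r *\<^sub>R x) = r *\<^sub>R ?R x"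
      unfolding raw_branch_sum[OF xy(1) n] raw_branch_sum[OF *(2) n] by (simp add: segsum_scaleR)
    have "(segsum x (seg m (branch_node \<gamma> n)))\<^sup>2 \<le> (norm x)\<^sup>2"
      using segments_of_branches[of m "{\<gamma>}" n x] by (simp add: n_def)
    then show "norm (?R x) \<le> norm x * 1"
      unfolding raw_branch_sum[OF xy(1) n] by (simp add: abs_le_square_iff[symmetric])
  qed
  then show ?thesis
    using raw_branch_sum[OF assms, of m \<gamma>] by (simp add: branch_sum_def bounded_linear_Blinfun_apply)
qed

text \<open>Truncated at a level where they have separated, branches are disjoint, and their functionals
  satisfy an upper \<open>\<ell>\<^sub>2\<close>-estimate.  This is why \<open>branch_sum\<close> carries a starting level.\<close>

lemma norm_branch_sums:
  assumes inj: "inj_on (\<lambda>\<gamma>. branch_node \<gamma> m) F" and F: "finite F"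
  shows "norm (\<Sum>\<gamma>\<in>F. a \<gamma> *\<^sub>R branch_sum \<gamma> m) \<le> L2_set a F"
proof (rule norm_blinfun_bound)
  fix x :: jt_fin
  obtain N where N: "supp_lt N x" using ex_supp_lt by blast
  let ?s = "\<lambda>\<gamma>. segsum x (seg m (branch_node \<gamma> (max m N)))"
  have "norm (blinfun_apply (\<Sum>\<gamma>\<in>F. a \<gamma> *\<^sub>R branch_sum \<gamma> m) x) = \<bar>\<Sum>\<gamma>\<in>F. a \<gamma> * ?s \<gamma>\<bar>"
    by (simp add: blinfun.sum_left blinfun.scaleR_left branch_sum_segsum[OF N, of "max m N"])
  also have "\<dots> \<le> (\<Sum>\<gamma>\<in>F. \<bar>a \<gamma>\<bar> * \<bar>?s \<gamma>\<bar>)"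
    by (rule order.trans[OF sum_abs]) (simp add: abs_mult)
  also have "\<dots> \<le> L2_set a F * L2_set ?s F" by (rule L2_set_mult_ineq)
  also have "\<dots> \<le> L2_set a F * norm x"
  proof (rule mult_left_mono)
    show "L2_set ?s F \<le> norm x"
      unfolding L2_set_def by (rule real_le_lsqrt) (auto intro: sum_nonneg segments_of_branches[OF inj F])
  qed simp
  finally show "norm (blinfun_apply (\<Sum>\<gamma>\<in>F. a \<gamma> *\<^sub>R branch_sum \<gamma> m) x) \<le> L2_set a F * norm x" .
qed simp

lemma branch_sum_unit_at:
  assumes "m \<le> n"
  shows "blinfun_apply (branch_sum \<gamma> m) (unit_at (branch_node \<delta> n)) =
    (if branch_node \<delta> n = branch_node \<gamma> n then 1 else 0)"
proof -
  have "supp_lt (Suc n) (unit_at (branch_node \<delta> n))"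
    by (auto simp: supp_lt_def unit_at.rep_eq)
  from branch_sum_segsum[OF this order.refl] show ?thesis
    using assms by (simp add: segsum_unit_at mem_seg_branch_node)
qed

lemma branch_limit_branch_sum:
  "blinfun_apply (branch_limit \<delta>) (branch_sum \<gamma> m) = (if \<delta> = \<gamma> then 1 else 0)"
proof (rule branch_limit_eqI, rule tendsto_eventually)
  have "\<forall>\<^sub>F n in sequentially. inj_on (\<lambda>\<gamma>. branch_node \<gamma> n) {\<gamma>, \<delta>}"
    by (rule branches_separate) simp
  then show "\<forall>\<^sub>F n in sequentially. blinfun_apply (branch_sum \<gamma> m) (unit_at (branch_node \<delta> n))
      = (if \<delta> = \<gamma> then 1 else 0)"
    using eventually_ge_at_top[of m]
    by eventually_elim (auto simp: branch_sum_unit_at inj_on_def)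
qed

text \<open>Membership in the span, instead of an explicit linear combination, makes the closure under
  addition immediate; all that is needed later is that elements of the span vanish where the branch
  functionals do.\<close>

definition branch_like :: "(jt_fin \<Rightarrow>\<^sub>L real) \<Rightarrow> bool" where
  "branch_like f \<longleftrightarrow> (\<forall>\<eta>>0. \<exists>F m. \<exists>g\<in>span ((\<lambda>\<gamma>. branch_sum \<gamma> 0) ` F). finite F \<and>
     (\<forall>z. supp_ge m z \<longrightarrow> \<bar>blinfun_apply f z - blinfun_apply g z\<bar> \<le> \<eta> * norm z))"

lemma branch_like_add:
  assumes "branch_like f" "branch_like g"
  shows "branch_like (f + g)"
  unfolding branch_like_def
proof (intro allI impI)
  fix \<eta> :: real assume "0 < \<eta>"
  then have \<eta>: "0 < \<eta> / 2" by simp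
  obtain F m f' where f: "f' \<in> span ((\<lambda>\<gamma>. branch_sum \<gamma> 0) ` F)" "finite F"
    "\<And>z. supp_ge m z \<Longrightarrow> \<bar>f z - f' z\<bar> \<le> \<eta> / 2 * norm z"
    using assms(1) \<eta> unfolding branch_like_def by meson
  obtain H n g' where g: "g' \<in> span ((\<lambda>\<gamma>. branch_sum \<gamma> 0) ` H)" "finite H"
    "\<And>z. supp_ge n z \<Longrightarrow> \<bar>g z - g' z\<bar> \<le> \<eta> / 2 * norm z"
    using assms(2) \<eta> unfolding branch_like_def by meson
  have "f' + g' \<in> span ((\<lambda>\<gamma>. branch_sum \<gamma> 0) ` (F \<union> H))"
    using f(1) g(1) by (intro span_add) (auto intro: subsetD[OF span_mono, rotated])
  moreover have "\<bar>(f + g) z - (f' + g') z\<bar> \<le> \<eta> * norm z" if "supp_ge (max m n) z" for z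
  proof -
    have "supp_ge m z" "supp_ge n z" using that by (auto elim: supp_ge_mono)
    then show ?thesis using f(3)[of z] g(3)[of z] unfolding blinfun.add_left by linarith
  qed
  ultimately show "\<exists>F m. \<exists>h\<in>span ((\<lambda>\<gamma>. branch_sum \<gamma> 0) ` F). finite F \<and>
      (\<forall>z. supp_ge m z \<longrightarrow> \<bar>(f + g) z - h z\<bar> \<le> \<eta> * norm z)"
    using f(2) g(2) by (intro exI[of _ "F \<union> H"] exI[of _ "max m n"] bexI[of _ "f' + g'"]) auto
qed

lemma branch_like_null:
  assumes "\<And>\<gamma>. blinfun_apply (branch_limit \<gamma>) f = 0"
  shows "branch_like f"
  unfolding branch_like_def
proof (intro allI impI)
  fix \<eta> :: real assume "0 < \<eta>"
  have "(\<lambda>n. f (unit_at (branch_node \<gamma> n))) \<longlonglongrightarrow> 0" for \<gamma>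
    using branch_limit_tendsto[of f \<gamma>] assms by simp
  then obtain m where "\<forall>z. supp_ge m z \<longrightarrow> \<bar>f z\<bar> \<le> \<eta> * norm z"
    using vanishing_tails[of f \<eta>] \<open>0 < \<eta>\<close> by blast
  then show "\<exists>F m. \<exists>g\<in>span ((\<lambda>\<gamma>. branch_sum \<gamma> 0) ` F). finite F \<and>
     (\<forall>z. supp_ge m z \<longrightarrow> \<bar>f z - blinfun_apply g z\<bar> \<le> \<eta> * norm z)"
    by (intro exI[of _ "{}"] exI[of _ m] bexI[of _ 0]) (auto simp: span_zero)
qed

lemma branch_sum_supp_ge:
  assumes "supp_ge m z"
  shows "blinfun_apply (branch_sum \<gamma> m) z = blinfun_apply (branch_sum \<gamma> 0) z"
proof -
  obtain N where N: "supp_lt N z" using ex_supp_lt by blast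
  show ?thesis
    unfolding branch_sum_segsum[OF N le_SucI[OF order.refl]]
    by (rule segsum_supp_ge[OF assms, symmetric]) simp
qed

lemma branch_like_branch_sums:
  assumes "finite F"
  shows "branch_like (\<Sum>\<gamma>\<in>F. a \<gamma> *\<^sub>R branch_sum \<gamma> m)"
  unfolding branch_like_def
proof (intro allI impI)
  fix \<eta> :: real assume "0 < \<eta>"
  let ?f = "\<lambda>m. \<Sum>\<gamma>\<in>F. a \<gamma> *\<^sub>R branch_sum \<gamma> m"
  have "?f 0 \<in> span ((\<lambda>\<gamma>. branch_sum \<gamma> 0) ` F)"
    by (intro span_sum span_scale span_base) simp
  moreover have "\<bar>?f m z - ?f 0 z\<bar> \<le> \<eta> * norm z" if "supp_ge m z" for z
    using \<open>0 < \<eta>\<close> by (simp add: blinfun.sum_left blinfun.scaleR_left branch_sum_supp_ge[OF that])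
  ultimately show "\<exists>H n. \<exists>g\<in>span ((\<lambda>\<gamma>. branch_sum \<gamma> 0) ` H). finite H \<and>
     (\<forall>z. supp_ge n z \<longrightarrow> \<bar>?f m z - blinfun_apply g z\<bar> \<le> \<eta> * norm z)"
    using assms by (intro exI[of _ F] exI[of _ m] bexI[of _ "?f 0"]) auto
qed

lemma branch_like_approx:
  assumes "\<And>e. 0 < e \<Longrightarrow> \<exists>g. branch_like g \<and> norm (f - g) \<le> e"
  shows "branch_like f"
  unfolding branch_like_def
proof (intro allI impI)
  fix \<eta> :: real assume "0 < \<eta>"
  then have \<eta>: "0 < \<eta> / 2" by simp
  obtain g where g: "branch_like g" "norm (f - g) \<le> \<eta> / 2" using assms[OF \<eta>] by blast
  obtain F m h where h: "h \<in> span ((\<lambda>\<gamma>. branch_sum \<gamma> 0) ` F)" "finite F"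
    "\<And>z. supp_ge m z \<Longrightarrow> \<bar>g z - h z\<bar> \<le> \<eta> / 2 * norm z"
    using g(1) \<eta> unfolding branch_like_def by meson
  have "\<bar>f z - h z\<bar> \<le> \<eta> * norm z" if "supp_ge m z" for z
  proof -
    have "\<bar>f z - g z\<bar> \<le> norm (f - g) * norm z"
      using norm_blinfun[of "f - g" z] by (simp add: blinfun.diff_left)
    also have "\<dots> \<le> \<eta> / 2 * norm z" using g(2) by (intro mult_right_mono) auto
    finally show ?thesis using h(3)[OF that] by linarith
  qed
  then show "\<exists>F m. \<exists>g\<in>span ((\<lambda>\<gamma>. branch_sum \<gamma> 0) ` F). finite F \<and>
     (\<forall>z. supp_ge m z \<longrightarrow> \<bar>f z - blinfun_apply g z\<bar> \<le> \<eta> * norm z)"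
    using h by blast
qed

lemma small_outside_finite:
  fixes h :: "'i \<Rightarrow> real"
  assumes h: "\<And>i. 0 \<le> h i" and B: "\<And>F. finite F \<Longrightarrow> sum h F \<le> B" and e: "0 < e"
  shows "\<exists>F. finite F \<and> (\<forall>F'. finite F' \<longrightarrow> F' \<inter> F = {} \<longrightarrow> sum h F' < e)"
proof -
  let ?S = "SUP F\<in>{F. finite F}. sum h F"
  have bdd: "bdd_above (sum h ` {F. finite F})" using B by (intro bdd_aboveI2) auto
  have "\<exists>F\<in>{F. finite F}. ?S - e < sum h F"
    using e bdd by (intro less_cSUP_iff[THEN iffD1]) auto
  then obtain F where F: "finite F" "?S - e < sum h F" by blast
  have "sum h F' < e" if "finite F'" "F' \<inter> F = {}" for F'
  proof -
    have "sum h F' + sum h F = sum h (F' \<union> F)" using that F by (simp add: sum.union_disjoint)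
    also have "\<dots> \<le> ?S" using that F bdd by (intro cSUP_upper) auto
    finally show ?thesis using F by simp
  qed
  then show ?thesis using F(1) by blast
qed

text \<open>The branch limits of \<open>f\<close> are square summable.  Combining the corresponding branch functionals
  in blocks of finitely many branches, each truncated where its branches have separated, gives an
  absolutely convergent series with the same branch limits as \<open>f\<close>; the blocks are chosen so that the
  norms decrease geometrically.  What remains of \<open>f\<close> has all branch limits equal to \<open>0\<close> and therefore
  vanishing tails.\<close>

theorem every_functional_branch_like: "branch_like f"
proof -
  define L where "L \<gamma> = blinfun_apply (branch_limit \<gamma>) f" for \<gamma>
  have "\<exists>F. finite F \<and> (\<forall>F'. finite F' \<longrightarrow> F' \<inter> F = {} \<longrightarrow> (\<Sum>\<gamma>\<in>F'. (L \<gamma>)\<^sup>2) < ((1/2) ^ k)\<^sup>2)" for k :: nat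
    by (rule small_outside_finite[where B = "(norm f)\<^sup>2"])
      (auto simp: L_def intro: branch_limits_square_sum)
  then have "\<exists>F. \<forall>k. finite (F k) \<and> (\<forall>F'. finite F' \<longrightarrow> F' \<inter> F k = {} \<longrightarrow> (\<Sum>\<gamma>\<in>F'. (L \<gamma>)\<^sup>2) < ((1/2) ^ k)\<^sup>2)"
    by (intro choice allI)
  then obtain F where F: "\<And>k. finite (F k)"
    "\<And>k F'. finite F' \<Longrightarrow> F' \<inter> F k = {} \<Longrightarrow> (\<Sum>\<gamma>\<in>F'. (L \<gamma>)\<^sup>2) < ((1/2) ^ k)\<^sup>2" by blast
  define D where "D = disjointed F"
  have finD: "finite (D k)" for k using F(1) by (auto simp: D_def disjointed_def)
  have "\<exists>m. inj_on (\<lambda>\<gamma>. branch_node \<gamma> m) (D k)" for k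
    using branches_separate[OF finD[of k]] by (auto simp: eventually_sequentially)
  then obtain m where m: "\<And>k. inj_on (\<lambda>\<gamma>. branch_node \<gamma> (m k)) (D k)" by metis
  define g where "g k = (\<Sum>\<gamma>\<in>D k. L \<gamma> *\<^sub>R branch_sum \<gamma> (m k))" for k
  have small: "norm (g (Suc k)) \<le> (1/2) ^ k" for k
  proof -
    have "D (Suc k) \<inter> F k = {}" by (auto simp: D_def disjointed_def)
    then have "(\<Sum>\<gamma>\<in>D (Suc k). (L \<gamma>)\<^sup>2) \<le> ((1/2) ^ k)\<^sup>2" using F(2)[OF finD] by (simp add: less_imp_le)
    then have "L2_set L (D (Suc k)) \<le> (1/2) ^ k"
      unfolding L2_set_def by (intro real_le_lsqrt) (auto intro: sum_nonneg)
    then show ?thesis unfolding g_def using norm_branch_sums[OF m finD, of L] by (rule order.trans[rotated])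
  qed
  have "summable (\<lambda>k. norm (g (Suc k)))"
    by (rule summable_comparison_test'[OF summable_geometric[of "1/2 :: real"], of 0]) (use small in auto)
  from summable_norm_cancel[OF this] have "summable g" by (simp add: summable_Suc_iff)
  then have sums: "g sums suminf g" by (rule summable_sums)
  have "branch_like (suminf g)"
  proof (rule branch_like_approx)
    fix e :: real assume "0 < e"
    have "(\<lambda>n. \<Sum>k<n. g k) \<longlonglongrightarrow> suminf g" using sums by (simp add: sums_def)
    then obtain n where "norm ((\<Sum>k<n. g k) - suminf g) < e"
      using LIMSEQ_D[OF _ \<open>0 < e\<close>] by (meson order.refl)
    then have "norm (suminf g - (\<Sum>k<n. g k)) \<le> e" by (simp add: norm_minus_commute)
    moreover have "branch_like (\<Sum>k<n. g k)"
    proof (induction n)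
      case 0
      show ?case using branch_like_branch_sums[of "{}"] by simp
    next
      case (Suc n)
      then show ?case by (simp add: branch_like_add g_def branch_like_branch_sums finD)
    qed
    ultimately show "\<exists>h. branch_like h \<and> norm (suminf g - h) \<le> e" by blast
  qed
  moreover have "branch_like (f - suminf g)"
  proof (rule branch_like_null)
    fix \<delta>
    have gk: "branch_limit \<delta> (g k) = (if \<delta> \<in> D k then L \<delta> else 0)" for k
    proof -
      have "branch_limit \<delta> (g k) = (\<Sum>\<gamma>\<in>D k. if \<delta> = \<gamma> then L \<gamma> else 0)"
        unfolding g_def blinfun.sum_right blinfun.scaleR_right branch_limit_branch_sum
        by (intro sum.cong) auto
      then show ?thesis using finD by simp
    qed
    have "(\<lambda>k. branch_limit \<delta> (g k)) sums L \<delta>"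
    proof (cases "\<exists>i. \<delta> \<in> D i")
      case True
      then obtain i where i: "\<delta> \<in> D i" by blast
      have "\<delta> \<in> D k \<longleftrightarrow> k = i" for k
        using i disjoint_family_disjointed[of F] unfolding D_def disjoint_family_on_def by blast
      then show ?thesis using sums_single[of i "\<lambda>_. L \<delta>"] by (simp add: gk)
    next
      case False
      then have "\<delta> \<notin> F k" for k using UN_disjointed_eq[of F] by (auto simp: D_def)
      then have "(L \<delta>)\<^sup>2 \<le> ((1/2) ^ k)\<^sup>2" for k using F(2)[of "{\<delta>}" k] by simp
      then have "\<bar>L \<delta>\<bar> \<le> (1/2) ^ k" for k by (simp add: abs_le_square_iff[symmetric])
      moreover have "(\<lambda>k. (1/2 :: real) ^ k) \<longlonglongrightarrow> 0" by (rule LIMSEQ_realpow_zero) auto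
      ultimately have "\<bar>L \<delta>\<bar> \<le> 0" by (intro LIMSEQ_le_const) auto
      then show ?thesis using False by (simp add: gk)
    qed
    moreover have "(\<lambda>k. branch_limit \<delta> (g k)) sums branch_limit \<delta> (suminf g)"
      by (rule bounded_linear.sums[OF blinfun.bounded_linear_right sums])
    ultimately have "L \<delta> = branch_limit \<delta> (suminf g)" by (rule sums_unique2)
    then show "branch_limit \<delta> (f - suminf g) = 0" by (simp add: blinfun.diff_right L_def)
  qed
  ultimately have "branch_like (suminf g + (f - suminf g))" by (rule branch_like_add)
  then show ?thesis by simp
qed


section \<open>Perturbing a functional far out in the tree\<close>

lemma norming_vector:
  fixes f :: "'a::real_normed_vector \<Rightarrow>\<^sub>L real"
  assumes "0 \<le> c" "c < norm f"
  obtains x where "norm x \<le> 1" "c < f x"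
proof -
  obtain y where y: "c * norm y < norm (f y)"
    using norm_blinfun_bound[of c f] assms by (meson not_le)
  then have ny: "0 < norm y" by (auto simp: blinfun.zero_right)
  define x where "x = (sgn (f y) / norm y) *\<^sub>R y"
  have "f x = \<bar>f y\<bar> / norm y" by (simp add: x_def blinfun.scaleR_right abs_sgn mult.commute)
  then have "c < f x" using y ny by (simp add: pos_less_divide_eq)
  moreover have "norm x \<le> 1" using ny by (simp add: x_def abs_sgn_eq)
  ultimately show thesis by (rule that[rotated])
qed

lemma functional_tail:
  fixes g :: "jt_fin \<Rightarrow>\<^sub>L real"
  assumes "\<And>t. length t < m \<Longrightarrow> blinfun_apply g (unit_at t) = 0"
  shows "g (tail m x) = g x"
proof -
  have "g x = g (tail m x) + (\<Sum>t\<in>{t. length t < m}. Rep_jt_fin x t * g (unit_at t))"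
    by (subst jt_fin_expand[of x m]) (simp add: blinfun.add_right blinfun.sum_right blinfun.scaleR_right)
  also have "(\<Sum>t\<in>{t. length t < m}. Rep_jt_fin x t * g (unit_at t)) = 0"
    using assms by (intro sum.neutral) auto
  finally show ?thesis by simp
qed

text \<open>Subtracting, on each branch of \<open>F\<close>, the total of \<open>z\<close> at one node beyond the support of \<open>z\<close>
  annihilates the branch functionals.  It keeps the signs of all segment sums starting at level \<open>m\<close>,
  since the only sums that change become \<open>0\<close>, and it hardly changes the value of a functional whose
  limits along the branches vanish, when \<open>n\<close> is large.\<close>

lemma cancel_branches:
  assumes z: "supp_ge m z" and zN: "supp_lt n z" and mn: "m \<le> n"
    and F: "finite F" "inj_on (\<lambda>\<gamma>. branch_node \<gamma> m) F"
  shows "\<exists>V. supp_ge m V \<and> norm V \<le> norm z \<and>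
    (\<forall>v. m \<le> length v \<longrightarrow> segsum (z + V) (seg m v) \<in> {0, segsum z (seg m v)}) \<and>
    (\<forall>\<gamma>\<in>F. blinfun_apply (branch_sum \<gamma> 0) (z + V) = 0) \<and>
    (\<forall>g :: jt_fin \<Rightarrow>\<^sub>L real.
      g V = - (\<Sum>\<gamma>\<in>F. branch_sum \<gamma> 0 z * g (unit_at (branch_node \<gamma> n))))"
proof -
  let ?U = "(\<lambda>\<gamma>. branch_node \<gamma> n) ` F"
  define a where "a u = (if u \<in> ?U then - segsum z (seg m u) else 0)" for u
  define V where "V = spread n a"
  have injn: "inj_on (\<lambda>\<gamma>. branch_node \<gamma> n) F"
    using F(2) mn by (auto simp: inj_on_def) (metis take_branch_node)
  have U: "?U \<subseteq> level n" by (auto simp: level_def)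
  have V: "supp_ge m V" unfolding V_def using mn by (intro supp_ge_mono[OF supp_ge_spread])
  have "(norm V)\<^sup>2 \<le> (\<Sum>u\<in>level n. (a u)\<^sup>2)" unfolding V_def by (rule norm_spread)
  also have "\<dots> = (\<Sum>u\<in>?U. (segsum z (seg m u))\<^sup>2)"
    using U by (intro sum.mono_neutral_cong_right) (auto simp: a_def)
  also have "\<dots> = (\<Sum>\<gamma>\<in>F. (segsum z (seg m (branch_node \<gamma> n)))\<^sup>2)"
    by (simp add: sum.reindex[OF injn])
  also have "\<dots> \<le> (norm z)\<^sup>2" by (rule segments_of_branches[OF F(2,1) mn])
  finally have nV: "norm V \<le> norm z" by (simp add: abs_le_square_iff[symmetric])
  have sum_V: "segsum V (seg m v) = (if n \<le> length v then a (take n v) else 0)" for v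
    using mn by (simp add: V_def segsum_spread)
  have sums: "segsum (z + V) (seg m v) \<in> {0, segsum z (seg m v)}" for v
  proof (cases "n \<le> length v \<and> take n v \<in> ?U")
    case True
    then have "segsum z (seg m v) = segsum z (seg m (take n v))"
      using segsum_supp_lt[OF zN] by blast
    then show ?thesis using True by (simp add: segsum_add sum_V a_def)
  next
    case False
    then have "segsum V (seg m v) = 0" by (auto simp: sum_V a_def)
    then show ?thesis by (simp add: segsum_add)
  qed
  have on_branch: "blinfun_apply (branch_sum \<gamma> 0) y = segsum y (seg m (branch_node \<gamma> n))"
    if "supp_ge m y" "supp_lt (Suc n) y" for y \<gamma>
    using branch_sum_segsum[OF that(2) order.refl] segsum_supp_ge[OF that(1), of 0] by simp
  have zS: "supp_lt (Suc n) z" using zN by (rule supp_lt_mono) simp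
  have "supp_lt (Suc n) (z + V)"
    using zS by (auto simp: V_def supp_lt_def plus_jt_fin.rep_eq Rep_spread)
  then have cancel: "branch_sum \<gamma> 0 (z + V) = 0" if "\<gamma> \<in> F" for \<gamma>
    using on_branch[OF supp_ge_add[OF z V], of \<gamma>] that by (simp add: segsum_add sum_V a_def)
  have "g V = - (\<Sum>\<gamma>\<in>F. branch_sum \<gamma> 0 z * g (unit_at (branch_node \<gamma> n)))" for g :: "jt_fin \<Rightarrow>\<^sub>L real"
  proof -
    have "g V = (\<Sum>u\<in>?U. - segsum z (seg m u) * g (unit_at u))"
      unfolding V_def blinfun_spread using U
      by (intro sum.mono_neutral_cong_right) (auto simp: a_def)
    also have "\<dots> = (\<Sum>\<gamma>\<in>F. - (branch_sum \<gamma> 0 z * g (unit_at (branch_node \<gamma> n))))"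
      by (simp add: sum.reindex[OF injn] on_branch[OF z zS])
    finally show ?thesis by (simp add: sum_negf)
  qed
  with V nV sums cancel show ?thesis by (intro exI[of _ V] conjI allI impI ballI) simp_all
qed

lemma vanish_on_span:
  fixes x :: "'a::real_normed_vector" and B :: "('a \<Rightarrow>\<^sub>L real) set"
  assumes "h \<in> span B" "\<And>b. b \<in> B \<Longrightarrow> blinfun_apply b x = 0"
  shows "blinfun_apply h x = 0"
  using assms(1)
proof (induction rule: span_induct)
  case base
  show ?case
    by (rule subspaceI) (simp_all add: blinfun.zero_left blinfun.add_left blinfun.scaleR_left)
next
  case (step b)
  then show ?case using assms(2) by simp
qed

text \<open>The heart of the proof.  The vector \<open>Z\<close> is built from a vector \<open>z\<close> that nearly norms \<open>g\<close> and
  lives beyond level \<open>m\<close>: the vector \<open>spread m w\<close> gives it the signs for gluing and \<open>V\<close> annihilates the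
  finitely many branch functionals that describe \<open>f\<close> far out in the tree.  The first correction does
  not affect \<open>g\<close>, which vanishes on level \<open>m\<close>, and the second one hardly does, because \<open>g\<close> tends to \<open>0\<close>
  along these branches.  Neither the constants nor the gain depend on \<open>f\<close>.\<close>

proposition norm_perturbed_functional:
  fixes f :: "jt_fin \<Rightarrow>\<^sub>L real" and \<epsilon> :: real
  assumes f: "norm f = 1" and \<epsilon>: "0 < \<epsilon>" "\<epsilon> \<le> 1"
  shows "\<exists>F m. finite F \<and> (\<forall>g :: jt_fin \<Rightarrow>\<^sub>L real. norm g = 1 \<longrightarrow>
    (\<forall>t. length t \<le> m \<longrightarrow> blinfun_apply g (unit_at t) = 0) \<longrightarrow>
    (\<forall>\<gamma>\<in>F. blinfun_apply (branch_limit \<gamma>) g = 0) \<longrightarrow>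
    1 + \<epsilon>\<^sup>2 / 200 \<le> norm (f + \<epsilon> *\<^sub>R g))"
proof -
  \<comment> \<open>Since \<open>norm (x + \<tau> *\<^sub>R Z) \<le> 1 + 14 * \<tau>\<^sup>2\<close> will hold, the choice of \<open>\<tau>\<close> maximises the gain
      \<open>\<epsilon> * \<tau> - 14 * \<tau>\<^sup>2 = \<epsilon>\<^sup>2 / 56\<close>; the errors of size \<open>\<eta>\<close> consume only a part of it.\<close>
  define \<eta> where "\<eta> = \<epsilon>\<^sup>2 / 1000"
  define \<tau> where "\<tau> = \<epsilon> / 28"
  have \<eta>: "0 < \<eta>" and \<tau>: "0 < \<tau>" using \<epsilon> by (auto simp: \<eta>_def \<tau>_def)
  have "\<epsilon>\<^sup>2 \<le> 1\<^sup>2" using \<epsilon> by (intro power_mono) auto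
  then have \<eta>1: "\<eta> < 1" by (simp add: \<eta>_def)
  obtain F m0 h where F: "finite F" and h: "h \<in> span ((\<lambda>\<gamma>. branch_sum \<gamma> 0) ` F)"
    and fh: "\<And>z. supp_ge m0 z \<Longrightarrow> \<bar>f z - blinfun_apply h z\<bar> \<le> \<eta> * norm z"
    using every_functional_branch_like[of f] \<eta> unfolding branch_like_def by meson
  obtain x where x: "norm x \<le> 1" "1 - \<eta> < f x"
    using norming_vector[of "1 - \<eta>" f] f \<eta> \<eta>1 by auto
  obtain m1 where m1: "supp_lt m1 x" using ex_supp_lt by blast
  have "\<forall>\<^sub>F m in sequentially. inj_on (\<lambda>\<gamma>. branch_node \<gamma> m) F \<and> m0 \<le> m \<and> m1 \<le> m"
    using branches_separate[OF F] eventually_ge_at_top[of m0] eventually_ge_at_top[of m1]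
    by eventually_elim auto
  then obtain m where inj: "inj_on (\<lambda>\<gamma>. branch_node \<gamma> m) F" and m: "m0 \<le> m" "m1 \<le> m"
    by (auto simp: eventually_sequentially)
  have xm: "supp_lt m x" using m1 m(2) by (rule supp_lt_mono)
  have "1 + \<epsilon>\<^sup>2 / 200 \<le> norm (f + \<epsilon> *\<^sub>R g)"
    if g: "norm g = 1" and low: "\<And>t. length t \<le> m \<Longrightarrow> blinfun_apply g (unit_at t) = 0"
      and lim: "\<And>\<gamma>. \<gamma> \<in> F \<Longrightarrow> blinfun_apply (branch_limit \<gamma>) g = 0" for g :: "jt_fin \<Rightarrow>\<^sub>L real"
  proof -
    obtain z0 where z0: "norm z0 \<le> 1" "1 - \<eta> < g z0"
      using norming_vector[of "1 - \<eta>" g] g \<eta> \<eta>1 by auto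
    define z where "z = tail (Suc m) z0"
    have gz: "1 - \<eta> < g z" using z0 low by (simp add: z_def functional_tail)
    have z1: "norm z \<le> 1" using z0 norm_tail[of "Suc m" z0] by (simp add: z_def)
    have zm: "supp_ge m z" unfolding z_def by (rule supp_ge_mono[OF supp_ge_tail]) simp
    obtain c where c: "\<And>u. 0 \<le> c u" "\<And>v. m \<le> length v \<Longrightarrow> \<bar>segsum z (seg m v)\<bar> \<le> c (take m v)"
      "(\<Sum>u\<in>level m. (c u)\<^sup>2) \<le> (norm z)\<^sup>2" using segsum_bounds[of m z] by metis
    have "(norm z)\<^sup>2 \<le> 1" using z1 by (simp add: abs_square_le_1)
    then have c1: "(\<Sum>u\<in>level m. (c u)\<^sup>2) \<le> 1" using c(3) by linarith
    obtain \<sigma> :: "node \<Rightarrow> real" where \<sigma>: "\<And>u. \<sigma> u = 1 \<or> \<sigma> u = -1"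
      and glue: "\<And>y. supp_ge m y \<Longrightarrow>
        (\<And>v. m \<le> length v \<Longrightarrow> - (2 * \<tau> * c (take m v)) \<le> \<sigma> (take m v) * segsum y (seg m v) \<and>
                             \<sigma> (take m v) * segsum y (seg m v) \<le> 0) \<Longrightarrow>
        (norm (x + y))\<^sup>2 \<le> (norm x)\<^sup>2 + (norm y)\<^sup>2 + 3 * (\<Sum>u\<in>level m. (2 * \<tau> * c u)\<^sup>2)"
      by (rule gluing[OF xm, of "\<lambda>u. 2 * \<tau> * c u"]) (use c \<tau> in auto)
    define w where "w u = - \<sigma> u * c u" for u
    define z1 where "z1 = z + spread m w"
    have z1m: "supp_ge m z1" unfolding z1_def by (intro supp_ge_add zm supp_ge_spread)
    have "(w u)\<^sup>2 = (c u)\<^sup>2" for u using \<sigma>[of u] by (auto simp: w_def)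
    then have "(norm (spread m w))\<^sup>2 \<le> 1" using norm_spread[of m w] c1 by simp
    then have "norm (spread m w) \<le> 1" by (simp add: abs_square_le_1)
    then have nz1: "norm z1 \<le> 2"
      using z1 norm_triangle_ineq[of z "spread m w"] by (simp add: z1_def)
    have sign: "- (2 * c (take m v)) \<le> \<sigma> (take m v) * segsum z1 (seg m v) \<and>
        \<sigma> (take m v) * segsum z1 (seg m v) \<le> 0" if "m \<le> length v" for v
    proof -
      have "segsum z1 (seg m v) = segsum z (seg m v) - \<sigma> (take m v) * c (take m v)"
        using that by (simp add: z1_def segsum_add segsum_spread w_def)
      then show ?thesis using \<sigma>[of "take m v"] c(2)[OF that] by (auto simp: abs_le_iff)
    qed
    have "g (spread m w) = 0"
      unfolding blinfun_spread using low by (intro sum.neutral) (auto simp: level_def)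
    then have gz1: "1 - \<eta> < g z1" using gz by (simp add: z1_def blinfun.add_right)
    obtain N where N: "supp_lt N z1" using ex_supp_lt by blast
    have "(\<lambda>n. \<Sum>\<gamma>\<in>F. branch_sum \<gamma> 0 z1 * g (unit_at (branch_node \<gamma> n)))
        \<longlonglongrightarrow> (\<Sum>\<gamma>\<in>F. branch_sum \<gamma> 0 z1 * branch_limit \<gamma> g)"
      by (intro tendsto_intros branch_limit_tendsto)
    then have "(\<lambda>n. \<Sum>\<gamma>\<in>F. branch_sum \<gamma> 0 z1 * g (unit_at (branch_node \<gamma> n))) \<longlonglongrightarrow> 0"
      using lim by simp
    then have "\<forall>\<^sub>F n in sequentially. (\<Sum>\<gamma>\<in>F. branch_sum \<gamma> 0 z1 * g (unit_at (branch_node \<gamma> n))) < \<eta>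
        \<and> N \<le> n \<and> m \<le> n"
      using \<eta> eventually_ge_at_top[of N] eventually_ge_at_top[of m]
      by (intro eventually_conj order_tendstoD(2)[of _ 0]) auto
    then obtain n where far: "(\<Sum>\<gamma>\<in>F. branch_sum \<gamma> 0 z1 * g (unit_at (branch_node \<gamma> n))) < \<eta>"
      and n: "N \<le> n" "m \<le> n" by (auto simp: eventually_sequentially)
    have z1n: "supp_lt n z1" using N n(1) by (rule supp_lt_mono)
    obtain V where V: "supp_ge m V" "norm V \<le> norm z1"
      and sumV: "\<forall>v. m \<le> length v \<longrightarrow> segsum (z1 + V) (seg m v) \<in> {0, segsum z1 (seg m v)}"
      and kill: "\<forall>\<gamma>\<in>F. blinfun_apply (branch_sum \<gamma> 0) (z1 + V) = 0"
      and gV: "\<forall>g :: jt_fin \<Rightarrow>\<^sub>L real.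
        g V = - (\<Sum>\<gamma>\<in>F. branch_sum \<gamma> 0 z1 * g (unit_at (branch_node \<gamma> n)))"
      using cancel_branches[OF z1m z1n n(2) F inj] by (elim exE conjE)
    define Z where "Z = z1 + V"
    have Zm: "supp_ge m Z" unfolding Z_def by (intro supp_ge_add z1m V)
    have nZ: "norm Z \<le> 4" using nz1 V(2) norm_triangle_ineq[of z1 V] by (simp add: Z_def)
    have gZ: "1 - 2 * \<eta> \<le> g Z" using gz1 spec[OF gV, of g] far by (simp add: Z_def blinfun.add_right)
    have "blinfun_apply h Z = 0" using h by (rule vanish_on_span) (auto simp: kill Z_def)
    moreover have "supp_ge m0 Z" using Zm m(1) by (rule supp_ge_mono)
    ultimately have "\<bar>f Z\<bar> \<le> \<eta> * norm Z" using fh[of Z] by simp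
    also have "\<dots> \<le> \<eta> * 4" using nZ \<eta> by (intro mult_left_mono) auto
    finally have fZ: "- (4 * \<eta>) \<le> f Z" by linarith
    have gx: "g x = 0"
    proof -
      have "tail m x = 0"
        using xm by (intro Rep_jt_fin_inject[THEN iffD1])
          (auto simp: fun_eq_iff tail.rep_eq zero_jt_fin.rep_eq supp_lt_def)
      then show ?thesis using functional_tail[of m g x] low by (simp add: blinfun.zero_right)
    qed
    have "(norm (x + \<tau> *\<^sub>R Z))\<^sup>2 \<le> (norm x)\<^sup>2 + (norm (\<tau> *\<^sub>R Z))\<^sup>2 + 3 * (\<Sum>u\<in>level m. (2 * \<tau> * c u)\<^sup>2)"
    proof (rule glue)
      show "supp_ge m (\<tau> *\<^sub>R Z)" by (intro supp_ge_scaleR Zm)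
      fix v :: node assume v: "m \<le> length v"
      let ?u = "take m v"
      have "- (2 * c ?u) \<le> \<sigma> ?u * segsum Z (seg m v)" "\<sigma> ?u * segsum Z (seg m v) \<le> 0"
        using sign[OF v] sumV v c(1)[of ?u] by (auto simp: Z_def)
      from mult_left_mono[OF this(1), of \<tau>] mult_left_mono[OF this(2), of \<tau>]
      have "\<tau> * - (2 * c ?u) \<le> \<tau> * (\<sigma> ?u * segsum Z (seg m v))"
        "\<tau> * (\<sigma> ?u * segsum Z (seg m v)) \<le> 0" using \<tau> by simp_all
      then show "- (2 * \<tau> * c ?u) \<le> \<sigma> ?u * segsum (\<tau> *\<^sub>R Z) (seg m v) \<and>
          \<sigma> ?u * segsum (\<tau> *\<^sub>R Z) (seg m v) \<le> 0"
        by (simp add: segsum_scaleR algebra_simps)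
    qed
    also have "\<dots> \<le> 1 + 16 * \<tau>\<^sup>2 + 12 * \<tau>\<^sup>2"
    proof (intro add_mono)
      show "(norm x)\<^sup>2 \<le> 1" using x by (simp add: abs_square_le_1)
      have "(norm Z)\<^sup>2 \<le> 4\<^sup>2" using nZ by (intro power_mono) auto
      then show "(norm (\<tau> *\<^sub>R Z))\<^sup>2 \<le> 16 * \<tau>\<^sup>2"
        using mult_left_mono[of "(norm Z)\<^sup>2" 16 "\<tau>\<^sup>2"] by (simp add: power_mult_distrib)
      have "3 * (\<Sum>u\<in>level m. (2 * \<tau> * c u)\<^sup>2) = 12 * \<tau>\<^sup>2 * (\<Sum>u\<in>level m. (c u)\<^sup>2)"
        by (simp add: power_mult_distrib sum_distrib_left mult.assoc)
      also have "\<dots> \<le> 12 * \<tau>\<^sup>2 * 1" using c1 by (intro mult_left_mono) auto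
      finally show "3 * (\<Sum>u\<in>level m. (2 * \<tau> * c u)\<^sup>2) \<le> 12 * \<tau>\<^sup>2" by simp
    qed
    also have "\<dots> \<le> (1 + 14 * \<tau>\<^sup>2)\<^sup>2" by (simp add: power2_sum)
    finally have test: "norm (x + \<tau> *\<^sub>R Z) \<le> 1 + 14 * \<tau>\<^sup>2" by (rule power2_le_imp_le) simp
    let ?k = "f + \<epsilon> *\<^sub>R g"
    have "1 - \<eta> + \<tau> * - (4 * \<eta>) + \<epsilon> * \<tau> * (1 - 2 * \<eta>) \<le> f x + \<tau> * f Z + \<epsilon> * \<tau> * g Z"
      using x(2) fZ gZ \<tau> \<epsilon>(1) by (intro add_mono mult_left_mono) auto
    also have "\<dots> = ?k (x + \<tau> *\<^sub>R Z)"
      using gx by (simp add: blinfun.add_left blinfun.scaleR_left blinfun.add_right blinfun.scaleR_right algebra_simps)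
    also have "\<dots> \<le> norm ?k * norm (x + \<tau> *\<^sub>R Z)" using norm_blinfun[of ?k "x + \<tau> *\<^sub>R Z"] by simp
    also have "\<dots> \<le> norm ?k * (1 + 14 * \<tau>\<^sup>2)" using test by (intro mult_left_mono) auto
    finally have upper: "1 - \<eta> + \<tau> * - (4 * \<eta>) + \<epsilon> * \<tau> * (1 - 2 * \<eta>) \<le> norm ?k * (1 + 14 * \<tau>\<^sup>2)" .
    have "(1 + \<epsilon>\<^sup>2 / 200) * (1 + 14 * \<tau>\<^sup>2) \<le> 1 - \<eta> + \<tau> * - (4 * \<eta>) + \<epsilon> * \<tau> * (1 - 2 * \<eta>)"
    proof -
      have "\<epsilon> * \<epsilon>\<^sup>2 \<le> 1 * \<epsilon>\<^sup>2" "\<epsilon>\<^sup>2 * \<epsilon>\<^sup>2 \<le> 1 * \<epsilon>\<^sup>2"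
        using \<epsilon> \<open>\<epsilon>\<^sup>2 \<le> 1\<^sup>2\<close> by (intro mult_right_mono; simp)+
      moreover have "(1 + \<epsilon>\<^sup>2 / 200) * (1 + 14 * \<tau>\<^sup>2) = 1 + \<epsilon>\<^sup>2 / 200 + \<epsilon>\<^sup>2 / 56 + \<epsilon>\<^sup>2 * \<epsilon>\<^sup>2 / 11200"
        by (simp add: \<tau>_def power2_eq_square field_simps)
      moreover have "1 - \<eta> + \<tau> * - (4 * \<eta>) + \<epsilon> * \<tau> * (1 - 2 * \<eta>)
          = 1 - \<epsilon>\<^sup>2 / 1000 - \<epsilon> * \<epsilon>\<^sup>2 / 7000 + \<epsilon>\<^sup>2 / 28 - \<epsilon>\<^sup>2 * \<epsilon>\<^sup>2 / 14000"
        by (simp add: \<tau>_def \<eta>_def algebra_simps power2_eq_square)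
      ultimately show ?thesis using zero_le_power2[of \<epsilon>] by linarith
    qed
    then have "(1 + \<epsilon>\<^sup>2 / 200) * (1 + 14 * \<tau>\<^sup>2) \<le> norm ?k * (1 + 14 * \<tau>\<^sup>2)" using upper by linarith
    then show ?thesis by (rule mult_right_le_imp_le) (simp add: add_pos_nonneg)
  qed
  with F show ?thesis by (intro exI[of _ F] exI[of _ m]) simp
qed


section \<open>Passing to the completion\<close>

text \<open>Functionals on a completion are the same as functionals on the dense subspace, isometrically, so
  the estimate for functionals on finitely supported vectors carries over.\<close>

definition restrict_functional ::
    "('a::real_normed_vector completion \<Rightarrow>\<^sub>L real) \<Rightarrow> ('a \<Rightarrow>\<^sub>L real)" where
  "restrict_functional f = f o\<^sub>L Blinfun to_completion"

lemma bounded_linear_to_completion: "bounded_linear (to_completion :: 'a::real_normed_vector \<Rightarrow> _)"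
proof (rule bounded_linear_intro[where K = 1])
  show "to_completion (x + y) = to_completion x + to_completion y" for x y :: 'a
    by (rule linear_add[OF linear_to_completion])
  show "to_completion (r *\<^sub>R x) = r *\<^sub>R to_completion x" for r and x :: 'a
    by (rule linear_scale[OF linear_to_completion])
  show "norm (to_completion x) \<le> norm x * 1" for x :: 'a
    by (simp add: norm_to_completion)
qed

lemma restrict_functional_apply: "restrict_functional f x = f (to_completion x)"
  by (simp add: restrict_functional_def bounded_linear_Blinfun_apply[OF bounded_linear_to_completion])

lemma bounded_linear_restrict_functional: "bounded_linear restrict_functional"
  unfolding restrict_functional_def
  by (rule bounded_bilinear.bounded_linear_left[OF bounded_bilinear_blinfun_compose])

lemma norm_restrict_functional:
  fixes f :: "'a::real_normed_vector completion \<Rightarrow>\<^sub>L real"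
  shows "norm (restrict_functional f) = norm f"
proof (rule antisym)
  show "norm (restrict_functional f) \<le> norm f"
  proof (rule norm_blinfun_bound)
    fix x
    show "norm (restrict_functional f x) \<le> norm f * norm x"
      using norm_blinfun[of f "to_completion x"] by (simp add: restrict_functional_apply norm_to_completion)
  qed simp
  show "norm f \<le> norm (restrict_functional f)"
  proof (rule norm_blinfun_bound)
    fix \<xi> :: "'a completion"
    obtain A :: "nat \<Rightarrow> 'a" where A: "(\<lambda>n. to_completion (A n)) \<longlonglongrightarrow> \<xi>" by (rule to_completion_approx)
    have "(\<lambda>n. norm (f (to_completion (A n)))) \<longlonglongrightarrow> norm (f \<xi>)"
      by (intro tendsto_norm blinfun.tendsto tendsto_const A)
    moreover have "(\<lambda>n. norm (restrict_functional f) * norm (to_completion (A n)))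
        \<longlonglongrightarrow> norm (restrict_functional f) * norm \<xi>"
      by (intro tendsto_intros A)
    ultimately show "norm (f \<xi>) \<le> norm (restrict_functional f) * norm \<xi>"
    proof (rule LIMSEQ_le)
      show "\<exists>N. \<forall>n\<ge>N. norm (f (to_completion (A n)))
          \<le> norm (restrict_functional f) * norm (to_completion (A n))"
        using norm_blinfun[of "restrict_functional f"]
        by (simp add: restrict_functional_apply norm_to_completion)
    qed
  qed simp
qed

lemma extend_functional:
  fixes f :: "'a::real_normed_vector \<Rightarrow>\<^sub>L real"
  obtains g where "restrict_functional g = f"
proof -
  let ?c = "to_completion :: 'a \<Rightarrow> 'a completion"
  have ex: "\<exists>l. \<forall>B. (\<lambda>n. ?c (B n)) \<longlonglongrightarrow> \<xi> \<longrightarrow> (\<lambda>n. f (B n)) \<longlonglongrightarrow> l" for \<xi>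
  proof -
    obtain A where A: "Cauchy A" "(\<lambda>n. ?c (A n)) \<longlonglongrightarrow> \<xi>" by (rule to_completion_approx)
    have "Cauchy (\<lambda>n. f (A n))" by (rule bounded_linear.Cauchy[OF blinfun.bounded_linear_right A(1)])
    then obtain l where l: "(\<lambda>n. f (A n)) \<longlonglongrightarrow> l" by (auto simp: Cauchy_convergent_iff convergent_def)
    have "(\<lambda>n. f (B n)) \<longlonglongrightarrow> l" if B: "(\<lambda>n. ?c (B n)) \<longlonglongrightarrow> \<xi>" for B
    proof -
      have "(\<lambda>n. ?c (B n - A n)) \<longlonglongrightarrow> 0"
        using tendsto_diff[OF B A(2)] by (simp add: linear_diff[OF linear_to_completion])
      then have "(\<lambda>n. norm (?c (B n - A n))) \<longlonglongrightarrow> 0" by (rule tendsto_norm_zero)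
      then have "(\<lambda>n. B n - A n) \<longlonglongrightarrow> 0"
        unfolding norm_to_completion by (rule tendsto_norm_zero_cancel)
      then have "(\<lambda>n. f (B n - A n)) \<longlonglongrightarrow> f 0" by (intro blinfun.tendsto tendsto_const)
      then have "(\<lambda>n. f (A n) + f (B n - A n)) \<longlonglongrightarrow> l + f 0" by (intro tendsto_add l)
      then show ?thesis by (simp add: blinfun.diff_right blinfun.zero_right)
    qed
    then show ?thesis by blast
  qed
  then obtain G where G: "\<And>\<xi> B. (\<lambda>n. ?c (B n)) \<longlonglongrightarrow> \<xi> \<Longrightarrow> (\<lambda>n. f (B n)) \<longlonglongrightarrow> G \<xi>" by metis
  have "bounded_linear G"
  proof (rule bounded_linear_intro[where K = "norm f"])
    fix \<xi> \<zeta> :: "'a completion" and r :: real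
    obtain A where A: "(\<lambda>n. ?c (A n)) \<longlonglongrightarrow> \<xi>" by (rule to_completion_approx)
    obtain B where B: "(\<lambda>n. ?c (B n)) \<longlonglongrightarrow> \<zeta>" by (rule to_completion_approx)
    have "(\<lambda>n. ?c (A n + B n)) \<longlonglongrightarrow> \<xi> + \<zeta>"
      using tendsto_add[OF A B] by (simp add: linear_add[OF linear_to_completion])
    then have "(\<lambda>n. f (A n) + f (B n)) \<longlonglongrightarrow> G (\<xi> + \<zeta>)"
      using G by (fastforce simp: blinfun.add_right)
    then show "G (\<xi> + \<zeta>) = G \<xi> + G \<zeta>"
      using tendsto_add[OF G[OF A] G[OF B]] LIMSEQ_unique by blast
    have "(\<lambda>n. ?c (r *\<^sub>R A n)) \<longlonglongrightarrow> r *\<^sub>R \<xi>"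
      using tendsto_scaleR[OF tendsto_const A, of r] by (simp add: linear_scale[OF linear_to_completion])
    then have "(\<lambda>n. r *\<^sub>R f (A n)) \<longlonglongrightarrow> G (r *\<^sub>R \<xi>)"
      using G by (fastforce simp: blinfun.scaleR_right)
    then show "G (r *\<^sub>R \<xi>) = r *\<^sub>R G \<xi>"
      using tendsto_scaleR[OF tendsto_const G[OF A], of r] LIMSEQ_unique by blast
    have "(\<lambda>n. norm f * norm (?c (A n))) \<longlonglongrightarrow> norm f * norm \<xi>" by (intro tendsto_intros A)
    then have "norm (G \<xi>) \<le> norm f * norm \<xi>"
      by (rule LIMSEQ_le[OF tendsto_norm[OF G[OF A]]]) (use norm_blinfun[of f] in \<open>auto simp: norm_to_completion\<close>)
    then show "norm (G \<xi>) \<le> norm \<xi> * norm f" by (simp add: mult.commute)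
  qed
  then have app: "blinfun_apply (Blinfun G) = G" by (rule bounded_linear_Blinfun_apply)
  have "restrict_functional (Blinfun G) = f"
  proof (rule blinfun_eqI)
    fix x
    have "(\<lambda>n. f x) \<longlonglongrightarrow> G (?c x)" using G[of "\<lambda>_. x"] by simp
    then show "restrict_functional (Blinfun G) x = f x"
      by (simp add: restrict_functional_apply app LIMSEQ_const_iff)
  qed
  then show thesis by (rule that)
qed

text \<open>The coordinate functionals along one branch, obtained as differences of truncated branch
  functionals, are biorthogonal to unit vectors.\<close>

lemma infinite_dimensional_jt_dual: "infinite_dimensional TYPE(jt_dual)"
  unfolding infinite_dimensional_def
proof
  let ?e = "\<lambda>n. unit_at (branch_node (\<lambda>_. True) n)"
  have "\<exists>\<phi>. restrict_functional \<phi> = branch_sum (\<lambda>_. True) n - branch_sum (\<lambda>_. True) (Suc n)" for n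
    using extend_functional by metis
  then obtain \<phi> :: "nat \<Rightarrow> jt_dual"
    where \<phi>: "\<And>n. restrict_functional (\<phi> n) = branch_sum (\<lambda>_. True) n - branch_sum (\<lambda>_. True) (Suc n)"
    by metis
  have above: "branch_sum (\<lambda>_. True) m (?e k) = 0" if "k < m" for m k
  proof -
    have "supp_lt (Suc k) (?e k)" by (auto simp: supp_lt_def unit_at.rep_eq)
    from branch_sum_segsum[OF this order.refl] show ?thesis
      using that by (simp add: segsum_unit_at mem_seg_branch_node)
  qed
  have dual: "\<phi> n (to_completion (?e k)) = (if n = k then 1 else 0)" for n k
  proof -
    have eq: "\<phi> n (to_completion (?e k)) = branch_sum (\<lambda>_. True) n (?e k) - branch_sum (\<lambda>_. True) (Suc n) (?e k)"
      by (simp add: restrict_functional_apply[symmetric] \<phi> blinfun.diff_left)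
    consider "k < n" | "k = n" | "n < k" by linarith
    then show ?thesis
      unfolding eq by cases (simp_all add: above branch_sum_unit_at)
  qed
  have inj: "inj \<phi>"
  proof (rule injI)
    fix a b assume "\<phi> a = \<phi> b"
    then show "a = b" using dual[of a a] dual[of b a] by (metis zero_neq_one)
  qed
  have "independent (range \<phi>)"
    unfolding dependent_def
  proof safe
    fix n assume "\<phi> n \<in> span (range \<phi> - {\<phi> n})"
    then have "\<phi> n (to_completion (?e n)) = 0"
      by (rule vanish_on_span) (auto simp: dual)
    then show False by (simp add: dual)
  qed
  moreover assume "\<exists>B :: jt_dual set. finite B \<and> span B = UNIV"
  then obtain B :: "jt_dual set" where "finite B" "span B = UNIV" by blast
  ultimately have "finite (range \<phi>)" using independent_span_bound[of B "range \<phi>"] by simp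
  then show False using finite_imageD[OF _ inj] by simp
qed


section \<open>The modulus of asymptotic convexity\<close>

text \<open>The conditional infima and suprema in the modulus behave as intended because every subspace
  in question meets the unit sphere; this is a dimension count.\<close>

lemma finite_codim_decomposition:
  fixes F :: "('a::real_normed_vector \<Rightarrow>\<^sub>L real) set"
  assumes "finite F"
  shows "\<exists>B. finite B \<and> (\<forall>x. \<exists>y. (\<forall>f\<in>F. f y = 0) \<and> x - y \<in> span B)"
  using assms
proof induction
  case empty
  show ?case by (intro exI[of _ "{}"] conjI allI, simp) (metis diff_self empty_iff span_zero)
next
  case (insert f F)
  then obtain B where B: "finite B" "\<And>x. \<exists>y. (\<forall>f\<in>F. f y = 0) \<and> x - y \<in> span B" by blast
  show ?case
  proof (cases "\<exists>b. (\<forall>f\<in>F. f b = 0) \<and> f b \<noteq> 0")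
    case True
    then obtain b where b: "\<And>h. h \<in> F \<Longrightarrow> h b = 0" "f b \<noteq> 0" by blast
    have "\<exists>y. (\<forall>h\<in>insert f F. h y = 0) \<and> x - y \<in> span (insert b B)" for x
    proof -
      obtain y where y: "\<And>h. h \<in> F \<Longrightarrow> h y = 0" "x - y \<in> span B" using B(2) by blast
      define y' where "y' = y - (f y / f b) *\<^sub>R b"
      have "x - y' = (x - y) + (f y / f b) *\<^sub>R b" by (simp add: y'_def)
      moreover have "x - y \<in> span (insert b B)" using y(2) span_mono[of B "insert b B"] by blast
      moreover have "(f y / f b) *\<^sub>R b \<in> span (insert b B)" by (intro span_scale span_base) simp
      ultimately have "x - y' \<in> span (insert b B)" using span_add by metis
      moreover have "h y' = 0" if "h \<in> insert f F" for h
        using that y b by (auto simp: y'_def blinfun.diff_right blinfun.scaleR_right)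
      ultimately show ?thesis by blast
    qed
    then show ?thesis using B(1) by (intro exI[of _ "insert b B"]) simp
  next
    case False
    then have "\<exists>y. (\<forall>h\<in>insert f F. h y = 0) \<and> x - y \<in> span B" for x
      using B(2)[of x] by (metis insertE)
    then show ?thesis using B(1) by blast
  qed
qed

lemma finite_codim_meets_sphere:
  fixes Y :: "'a::real_normed_vector set"
  assumes inf: "infinite_dimensional TYPE('a)" and Y: "Y \<in> finite_codim_subspaces"
  shows "Y \<inter> sphere 0 1 \<noteq> {}"
proof -
  obtain F :: "('a \<Rightarrow>\<^sub>L real) set" where F: "finite F" "Y = {x. \<forall>f\<in>F. f x = 0}"
    using Y unfolding finite_codim_subspaces_def by blast
  obtain B where B: "finite B" "\<And>x. \<exists>y. (\<forall>f\<in>F. f y = 0) \<and> x - y \<in> span B"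
    using finite_codim_decomposition[OF F(1)] by blast
  obtain x where x: "x \<notin> span B" using inf B(1) unfolding infinite_dimensional_def by blast
  obtain y where y: "\<And>f. f \<in> F \<Longrightarrow> f y = 0" "x - y \<in> span B" using B(2) by blast
  have "y \<noteq> 0" using x y(2) by auto
  then have "(1 / norm y) *\<^sub>R y \<in> Y \<inter> sphere 0 1"
    using y(1) by (auto simp: F(2) blinfun.scaleR_right)
  then show ?thesis by blast
qed

lemma asymp_convexity_modulus_ge:
  fixes \<delta> \<epsilon> :: real
  assumes inf: "infinite_dimensional TYPE('a::banach)"
    and Y: "\<And>x::'a. norm x = 1 \<Longrightarrow> \<exists>Y\<in>finite_codim_subspaces. \<forall>y\<in>Y. norm y = 1 \<longrightarrow> \<delta> \<le> norm (x + \<epsilon> *\<^sub>R y) - 1"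
  shows "\<delta> \<le> asymp_convexity_modulus TYPE('a) \<epsilon>"
  unfolding asymp_convexity_modulus_def
proof (rule cINF_greatest)
  have "UNIV \<in> (finite_codim_subspaces :: 'a set set)"
    unfolding finite_codim_subspaces_def by (intro CollectI exI[of _ "{}"]) auto
  then show "sphere (0::'a) 1 \<noteq> {}" using finite_codim_meets_sphere[OF inf] by fastforce
next
  fix x :: 'a assume "x \<in> sphere 0 1"
  then have x: "norm x = 1" by simp
  let ?I = "\<lambda>Y. INF y\<in>Y \<inter> sphere 0 1. norm (x + \<epsilon> *\<^sub>R y) - 1"
  have bdd: "bdd_above (?I ` finite_codim_subspaces)"
  proof (rule bdd_aboveI2)
    fix Y :: "'a set" assume "Y \<in> finite_codim_subspaces"
    then obtain y where y: "y \<in> Y \<inter> sphere 0 1" using finite_codim_meets_sphere[OF inf] by blast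
    have "norm (x + \<epsilon> *\<^sub>R y) - 1 \<le> \<bar>\<epsilon>\<bar>"
      using norm_triangle_ineq[of x "\<epsilon> *\<^sub>R y"] x y by simp
    moreover have "bdd_below ((\<lambda>y. norm (x + \<epsilon> *\<^sub>R y) - 1) ` (Y \<inter> sphere 0 1))"
      by (rule bdd_belowI2[of _ "-1"]) simp
    ultimately show "?I Y \<le> \<bar>\<epsilon>\<bar>" using y by (intro cINF_lower2)
  qed
  obtain Y where Y': "Y \<in> finite_codim_subspaces"
    "\<And>y. y \<in> Y \<Longrightarrow> norm y = 1 \<Longrightarrow> \<delta> \<le> norm (x + \<epsilon> *\<^sub>R y) - 1" using Y[OF x] by blast
  have "\<delta> \<le> ?I Y" using Y' finite_codim_meets_sphere[OF inf Y'(1)] by (intro cINF_greatest) auto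
  also have "\<dots> \<le> (SUP Y\<in>finite_codim_subspaces. ?I Y)" by (rule cSUP_upper[OF Y'(1) bdd])
  finally show "\<delta> \<le> (SUP Y\<in>finite_codim_subspaces. ?I Y)" .
qed

theorem theorem5:
  shows "asymptotically_uniformly_convex TYPE(jt_dual)"
  unfolding asymptotically_uniformly_convex_def
proof (intro conjI allI impI)
  show "infinite_dimensional TYPE(jt_dual)" by (rule infinite_dimensional_jt_dual)
  fix \<epsilon> :: real assume "0 < \<epsilon> \<and> \<epsilon> \<le> 1"
  then have \<epsilon>: "0 < \<epsilon>" "\<epsilon> \<le> 1" by simp_all
  have "\<epsilon>\<^sup>2 / 200 \<le> asymp_convexity_modulus TYPE(jt_dual) \<epsilon>"
  proof (rule asymp_convexity_modulus_ge[OF infinite_dimensional_jt_dual])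
    fix x :: jt_dual assume "norm x = 1"
    then have "norm (restrict_functional x) = 1" by (simp add: norm_restrict_functional)
    from norm_perturbed_functional[OF this \<epsilon>] obtain F m where F: "finite F"
      and perturb: "\<forall>g :: jt_fin \<Rightarrow>\<^sub>L real. norm g = 1 \<longrightarrow>
        (\<forall>t. length t \<le> m \<longrightarrow> blinfun_apply g (unit_at t) = 0) \<longrightarrow>
        (\<forall>\<gamma>\<in>F. blinfun_apply (branch_limit \<gamma>) g = 0) \<longrightarrow>
        1 + \<epsilon>\<^sup>2 / 200 \<le> norm (restrict_functional x + \<epsilon> *\<^sub>R g)" by (elim exE conjE)
    define at_node :: "node \<Rightarrow> jt_dual \<Rightarrow>\<^sub>L real"
      where "at_node t = Blinfun (\<lambda>y. blinfun_apply y (to_completion (unit_at t)))" for t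
    define at_branch :: "(nat \<Rightarrow> bool) \<Rightarrow> jt_dual \<Rightarrow>\<^sub>L real"
      where "at_branch \<gamma> = branch_limit \<gamma> o\<^sub>L Blinfun restrict_functional" for \<gamma>
    have at_node: "at_node t y = restrict_functional y (unit_at t)" for t y
      by (simp add: at_node_def bounded_linear_Blinfun_apply[OF blinfun.bounded_linear_left] restrict_functional_apply)
    have at_branch: "at_branch \<gamma> y = branch_limit \<gamma> (restrict_functional y)" for \<gamma> y
      by (simp add: at_branch_def bounded_linear_Blinfun_apply[OF bounded_linear_restrict_functional])
    define H where "H = at_node ` (\<Union>k\<le>m. level k) \<union> at_branch ` F"
    have "finite H" using F by (simp add: H_def)
    then have "{y. \<forall>h\<in>H. h y = 0} \<in> finite_codim_subspaces"
      unfolding finite_codim_subspaces_def by blast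
    moreover have "\<epsilon>\<^sup>2 / 200 \<le> norm (x + \<epsilon> *\<^sub>R y) - 1" if "\<forall>h\<in>H. h y = 0" "norm y = 1" for y
    proof -
      have "1 + \<epsilon>\<^sup>2 / 200 \<le> norm (restrict_functional x + \<epsilon> *\<^sub>R restrict_functional y)"
      proof (rule perturb[rule_format])
        show "norm (restrict_functional y) = 1" using that(2) by (simp add: norm_restrict_functional)
        show "restrict_functional y (unit_at t) = 0" if "length t \<le> m" for t
          using \<open>\<forall>h\<in>H. h y = 0\<close> that by (auto simp: H_def level_def at_node[symmetric])
        show "branch_limit \<gamma> (restrict_functional y) = 0" if "\<gamma> \<in> F" for \<gamma>
          using \<open>\<forall>h\<in>H. h y = 0\<close> that by (auto simp: H_def at_branch[symmetric])
      qed
      also have "restrict_functional x + \<epsilon> *\<^sub>R restrict_functional y = restrict_functional (x + \<epsilon> *\<^sub>R y)"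
        by (rule blinfun_eqI) (simp add: restrict_functional_apply blinfun.add_left blinfun.scaleR_left)
      finally show ?thesis by (simp add: norm_restrict_functional)
    qed
    ultimately show "\<exists>Y\<in>finite_codim_subspaces. \<forall>y\<in>Y. norm y = 1 \<longrightarrow> \<epsilon>\<^sup>2 / 200 \<le> norm (x + \<epsilon> *\<^sub>R y) - 1"
      by (intro bexI[of _ "{y. \<forall>h\<in>H. h y = 0}"]) simp_all
  qed
  moreover have "0 < \<epsilon>\<^sup>2 / 200" using \<epsilon> by simp
  ultimately show "0 < asymp_convexity_modulus TYPE(jt_dual) \<epsilon>" by linarith
qed

end
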